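(* Assume that the data $\{\mathcal K;a_1,\ldots,a_m\}$ define a complete fan $\Sigma$ in $N_{\mathbb R}\cong\mathbb R^n$, and $m-n=2\ell$. Assume further that (a) there is at most one ghost vertex in $\mathcal K$; (b) no nonzero rational linear function on $\mathbb R^m$ vanishes identically on $\operatorname{Ker}A$. Then there are no non-constant meromorphic functions on $\mathcal Z_{\mathcal K}=U(\mathcal K)/C$.
   Context: Setting. Let $m,n,\ell\ge 0$ be integers with $m-n=2\ell$, $[m]=\{1,\dots,m\}$. $\mathcal K$ is an abstract simplicial complex on $[m]$: a collection of subsets of $[m]$ closed under taking subsets and containing $\varnothing$; an element $i$ with $\{i\}\notin\mathcal K$ is called a ghost vertex. $N_{\mathbb R}$ is a real vector space of dimension $n$, and $a_1,\dots,a_m\in N_{\mathbb R}$ (the vector $a_i$ may be zero if $i$ is a ghost vertex). The data $\{\mathcal K;a_1,\dots,a_m\}$ define a complete (simplicial) fan $\Sigma$ in $N_{\mathbb R}$: for each $I\in\mathcal K$ the vectors $a_i$, $i\in I$, are linearly independent; the cones $\sigma_I=\{\sum_{i\in I}\mu_ia_i:\mu_i\ge0\}$, $I\in\mathcal K$, satisfy $\sigma_I\cap\sigma_J=\sigma_{I\cap J}$; and $\bigcup_{I\in\mathcal K}\sigma_I=N_{\mathbb R}$. Then $\Sigma=\{\sigma_I: I\in\mathcal K\}$. Let $A\colon\mathbb R^m\to N_{\mathbb R}$, $e_i\mapsto a_i$, with complexification $A_{\mathbb C}\colon\mathbb C^m\to N_{\mathbb C}$. Put $U(\mathcal K)=\{z\in\mathbb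 C^m:\{i:z_i=0\}\in\mathcal K\}$, an open subset of $\mathbb C^m$. Fix a $\mathbb C$-linear map $\Psi\colon\mathbb C^\ell\to\mathbb C^m$ such that $\mathrm{Re}\circ\Psi\colon\mathbb C^\ell\to\mathbb R^m$ is injective and $A\circ\mathrm{Re}\circ\Psi=0$, where $\mathrm{Re}$ is the coordinatewise real part. Put $\mathfrak c=\Psi(\mathbb C^\ell)$ (equivalently, $\Psi$ is injective, $\mathfrak c\cap\overline{\mathfrak c}=\{0\}$ and $\mathfrak c\subset\operatorname{Ker}A_{\mathbb C}$) and $C=\{(e^{w_1},\dots,e^{w_m}): w\in\mathfrak c\}\subset(\mathbb C^\times)^m$, a closed complex subgroup acting on $U(\mathcal K)$ by coordinatewise multiplication. It is known that this action is free and proper and $\mathcal Z_{\mathcal K}=U(\mathcal K)/C$ is a compact complex manifold (a complex moment-angle manifold). A linear function $\mathbb R^m\to\mathbb R$ is rational if it takes rational values on vectors of $\mathbb Q^m$. *)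

theory Defs
  imports "HOL-Analysis.Analysis"
begin

section \<open>Coordinate spaces\<close>

text \<open>
  Vectors of \<open>k\<close>-space are functions on \<open>nat\<close> vanishing outside \<open>{1..k}\<close>, so that \<open>k = 0\<close> is
  allowed. The topology is the subspace topology of the product topology on functions, which is the
  usual one on \<open>k\<close>-space since only finitely many coordinates are free.
\<close>

definition coord_space :: "nat \<Rightarrow> (nat \<Rightarrow> 'a::zero) set" where
  "coord_space k = {x. \<forall>i. i \<notin> {1..k} \<longrightarrow> x i = 0}"

definition clinear_map :: "nat \<Rightarrow> nat \<Rightarrow> ((nat \<Rightarrow> complex) \<Rightarrow> (nat \<Rightarrow> complex)) \<Rightarrow> bool" where
  "clinear_map l m F \<longleftrightarrow>
     F ` coord_space l \<subseteq> coord_space m \<and>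
     (\<forall>u\<in>coord_space l. \<forall>v\<in>coord_space l. F (\<lambda>i. u i + v i) = (\<lambda>i. F u i + F v i)) \<and>
     (\<forall>c. \<forall>u\<in>coord_space l. F (\<lambda>i. c * u i) = (\<lambda>i. c * F u i))"

definition linear_form :: "nat \<Rightarrow> ((nat \<Rightarrow> real) \<Rightarrow> real) \<Rightarrow> bool" where
  "linear_form m \<phi> \<longleftrightarrow>
     (\<forall>x\<in>coord_space m. \<forall>y\<in>coord_space m. \<phi> (\<lambda>i. x i + y i) = \<phi> x + \<phi> y) \<and>
     (\<forall>c. \<forall>x\<in>coord_space m. \<phi> (\<lambda>i. c * x i) = c * \<phi> x)"

definition rational_linear_form :: "nat \<Rightarrow> ((nat \<Rightarrow> real) \<Rightarrow> real) \<Rightarrow> bool" where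
  "rational_linear_form m \<phi> \<longleftrightarrow>
     linear_form m \<phi> \<and> (\<forall>x\<in>coord_space m. (\<forall>i. x i \<in> \<rat>) \<longrightarrow> \<phi> x \<in> \<rat>)"

section \<open>Simplicial complexes and complete fans\<close>

definition abstract_simplicial_complex :: "nat \<Rightarrow> nat set set \<Rightarrow> bool" where
  "abstract_simplicial_complex m K \<longleftrightarrow>
     K \<subseteq> Pow {1..m} \<and> {} \<in> K \<and> (\<forall>I\<in>K. \<forall>J. J \<subseteq> I \<longrightarrow> J \<in> K)"

definition ghost_vertices :: "nat \<Rightarrow> nat set set \<Rightarrow> nat set" where
  "ghost_vertices m K = {i \<in> {1..m}. {i} \<notin> K}"

definition spanned_cone :: "(nat \<Rightarrow> 'v::real_vector) \<Rightarrow> nat set \<Rightarrow> 'v set" where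
  "spanned_cone a I = {\<Sum>i\<in>I. \<mu> i *\<^sub>R a i | \<mu>. \<forall>i\<in>I. 0 \<le> \<mu> i}"

text \<open>Injectivity on \<open>I\<close> turns independence of the set of vectors into that of the family.\<close>

definition complete_fan_data :: "nat set set \<Rightarrow> (nat \<Rightarrow> 'v::real_vector) \<Rightarrow> bool" where
  "complete_fan_data K a \<longleftrightarrow>
     (\<forall>I\<in>K. inj_on a I \<and> independent (a ` I)) \<and>
     (\<forall>I\<in>K. \<forall>J\<in>K. spanned_cone a I \<inter> spanned_cone a J = spanned_cone a (I \<inter> J)) \<and>
     (\<Union>I\<in>K. spanned_cone a I) = UNIV"

definition vector_map :: "nat \<Rightarrow> (nat \<Rightarrow> 'v::real_vector) \<Rightarrow> (nat \<Rightarrow> real) \<Rightarrow> 'v" where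
  "vector_map m a x = (\<Sum>i=1..m. x i *\<^sub>R a i)"

definition vector_map_ker :: "nat \<Rightarrow> (nat \<Rightarrow> 'v::real_vector) \<Rightarrow> (nat \<Rightarrow> real) set" where
  "vector_map_ker m a = {x \<in> coord_space m. vector_map m a x = 0}"

section \<open>Holomorphic functions of several variables\<close>

definition holomorphic_coord :: "nat \<Rightarrow> (nat \<Rightarrow> complex) set \<Rightarrow> ((nat \<Rightarrow> complex) \<Rightarrow> complex) \<Rightarrow> bool" where
  "holomorphic_coord m W f \<longleftrightarrow>
     openin (top_of_set (coord_space m)) W \<and> continuous_on W f \<and>
     (\<forall>z\<in>W. \<forall>i\<in>{1..m}. (\<lambda>t. f (z(i := t))) field_differentiable at (z i))"

section \<open>Meromorphic functions\<close>

text \<open>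
  Let \<open>hol V g\<close> say that \<open>g\<close> is a section over the open set \<open>V\<close> of the sheaf of holomorphic functions
  of a complex manifold with underlying space \<open>X\<close>. A meromorphic function is a global section of the
  sheaf of total quotient rings. It is given here by its restriction \<open>f\<close> to a dense open set \<open>D\<close> where
  it is holomorphic, and it is locally a quotient \<open>g / h\<close> with \<open>h\<close> a non-zero-divisor, that is, with
  \<open>h\<close> not identically zero on any nonempty open subset of \<open>V\<close>. Different domains \<open>D\<close> may represent the
  same section; by density, the section is constant if and only if \<open>f\<close> is constant on \<open>D\<close>.
\<close>

definition meromorphic_function ::
    "'x topology \<Rightarrow> ('x set \<Rightarrow> ('x \<Rightarrow> complex) \<Rightarrow> bool) \<Rightarrow> 'x set \<Rightarrow> ('x \<Rightarrow> complex) \<Rightarrow> bool" where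
  "meromorphic_function X hol D f \<longleftrightarrow>
     openin X D \<and> X closure_of D = topspace X \<and> hol D f \<and>
     (\<forall>x\<in>topspace X. \<exists>V g h.
        openin X V \<and> x \<in> V \<and> hol V g \<and> hol V h \<and>
        V \<subseteq> X closure_of {y \<in> V. h y \<noteq> 0} \<and>
        (\<forall>y\<in>V \<inter> D. f y * h y = g y))"

section \<open>The complex moment-angle manifold\<close>

definition U_set :: "nat \<Rightarrow> nat set set \<Rightarrow> (nat \<Rightarrow> complex) set" where
  "U_set m K = {z \<in> coord_space m. {i \<in> {1..m}. z i = 0} \<in> K}"

definition exp_group ::
    "nat \<Rightarrow> nat \<Rightarrow> ((nat \<Rightarrow> complex) \<Rightarrow> (nat \<Rightarrow> complex)) \<Rightarrow> (nat \<Rightarrow> complex) set" where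
  "exp_group l m \<Psi> = {(\<lambda>i. if i \<in> {1..m} then exp (w i) else 0) | w. w \<in> \<Psi> ` coord_space l}"

definition orbit :: "(nat \<Rightarrow> complex) set \<Rightarrow> (nat \<Rightarrow> complex) \<Rightarrow> (nat \<Rightarrow> complex) set" where
  "orbit C z = {(\<lambda>i. g i * z i) | g. g \<in> C}"

definition quotient_topology :: "'a topology \<Rightarrow> ('a \<Rightarrow> 'b) \<Rightarrow> 'b topology" where
  "quotient_topology X p =
     topology (\<lambda>V. V \<subseteq> p ` topspace X \<and> openin X {x \<in> topspace X. p x \<in> V})"

lemma openin_quotient_topology:
  "openin (quotient_topology X p) V \<longleftrightarrow>
     V \<subseteq> p ` topspace X \<and> openin X {x \<in> topspace X. p x \<in> V}"
proof -
  have "istopology (\<lambda>V. V \<subseteq> p ` topspace X \<and> openin X {x \<in> topspace X. p x \<in> V})"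
    unfolding istopology_def
  proof (intro conjI allI impI)
    fix S T
    assume "S \<subseteq> p ` topspace X \<and> openin X {x \<in> topspace X. p x \<in> S}"
      and "T \<subseteq> p ` topspace X \<and> openin X {x \<in> topspace X. p x \<in> T}"
    moreover have "{x \<in> topspace X. p x \<in> S \<inter> T} =
        {x \<in> topspace X. p x \<in> S} \<inter> {x \<in> topspace X. p x \<in> T}"
      by blast
    ultimately show "S \<inter> T \<subseteq> p ` topspace X" "openin X {x \<in> topspace X. p x \<in> S \<inter> T}"
      by auto
  next
    fix \<V>
    assume *: "\<forall>V\<in>\<V>. V \<subseteq> p ` topspace X \<and> openin X {x \<in> topspace X. p x \<in> V}"
    then show "\<Union>\<V> \<subseteq> p ` topspace X"
      by blast
    have "{x \<in> topspace X. p x \<in> \<Union>\<V>} = (\<Union>V\<in>\<V>. {x \<in> topspace X. p x \<in> V})"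
      by blast
    then show "openin X {x \<in> topspace X. p x \<in> \<Union>\<V>}"
      using * by auto
  qed
  then show ?thesis
    by (simp add: quotient_topology_def)
qed

lemma topspace_quotient_topology: "topspace (quotient_topology X p) = p ` topspace X"
proof
  show "topspace (quotient_topology X p) \<subseteq> p ` topspace X"
    using openin_quotient_topology[of X p "topspace (quotient_topology X p)"] by simp
  have "{x \<in> topspace X. p x \<in> p ` topspace X} = topspace X"
    by blast
  then have "openin (quotient_topology X p) (p ` topspace X)"
    by (simp add: openin_quotient_topology)
  then show "p ` topspace X \<subseteq> topspace (quotient_topology X p)"
    by (rule openin_subset)
qed

lemma quotient_map_quotient_topology: "quotient_map X (quotient_topology X p) p"
  by (simp add: quotient_map_def topspace_quotient_topology openin_quotient_topology)

definition Z_topology ::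
    "nat \<Rightarrow> nat set set \<Rightarrow> (nat \<Rightarrow> complex) set \<Rightarrow> (nat \<Rightarrow> complex) set topology" where
  "Z_topology m K C = quotient_topology (top_of_set (U_set m K)) (orbit C)"

text \<open>
  For a free and proper holomorphic action, the complex structure of the quotient is the unique one
  making the projection a holomorphic submersion; its holomorphic functions on an open set \<open>V\<close> are
  the functions whose pullback to the preimage of \<open>V\<close> is holomorphic.
\<close>

definition Z_holomorphic ::
    "nat \<Rightarrow> nat set set \<Rightarrow> (nat \<Rightarrow> complex) set \<Rightarrow>
     (nat \<Rightarrow> complex) set set \<Rightarrow> ((nat \<Rightarrow> complex) set \<Rightarrow> complex) \<Rightarrow> bool" where
  "Z_holomorphic m K C V f \<longleftrightarrow>
     openin (Z_topology m K C) V \<and>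
     holomorphic_coord m {z \<in> U_set m K. orbit C z \<in> V} (\<lambda>z. f (orbit C z))"

end

theory Submission
  imports Defs "HOL-Complex_Analysis.Complex_Analysis"
begin

text \<open>
  Let \<open>J\<close> be the set of vertices that are not ghosts. There is at most one ghost vertex, its
  coordinate never vanishes on \<open>U(K)\<close>, and it can be moved to \<open>1\<close> by the group \<open>C\<close>. Hence every
  orbit meets the slice on which the ghost coordinate is \<open>1\<close>, and a meromorphic function on \<open>Z\<close>
  becomes a meromorphic function \<open>F\<close> on a subset of \<open>\<complex>\<^sup>J\<close>. The subset contains all points with at
  most one vanishing coordinate, so that its complement has codimension at least two; and \<open>F\<close> is
  invariant under \<open>exp w\<close> for those \<open>w\<close> in \<open>\<cc> = \<Psi>(\<complex>\<^sup>l)\<close> whose ghost coordinate lies in \<open>2\<pi>i\<int>\<close>.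

  A count of dimensions shows that the real parts of \<open>\<cc>\<close> fill the kernel of \<open>A\<close>. As the fan is
  complete, some positive combination of the non-ghost vectors \<open>a\<^sub>i\<close> vanishes; therefore some of the
  \<open>w\<close> above are contractions, with \<open>Re w\<^sub>i < 0\<close> for all \<open>i \<in> J\<close>. As no nonzero rational linear
  function vanishes on the kernel, distinct monomials \<open>z\<^sup>k\<close> have distinct characters \<open>w \<mapsto> e\<^bsup>\<langle>k,w\<rangle>\<^esup>\<close> on the
  contractions (\<open>contractions_nonempty\<close>, \<open>contractions_separate\<close>, \<open>fan_exponent_subspace\<close>).

  By Levi's extension theorem, \<open>F = g / h\<close> near the origin with \<open>g\<close> and \<open>h\<close> holomorphic
  (\<open>local_denominator\<close>). Expand both in power series and evaluate \<open>F h - g = 0\<close> at \<open>exp w \<cdot> z\<close> for a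
  contraction \<open>w\<close>. Since \<open>F\<close> is invariant, this reads \<open>\<Sum>\<^sub>k e\<^bsup>\<langle>k,w\<rangle>\<^esup> z\<^sup>k (F(z) h\<^sub>k - g\<^sub>k) = 0\<close>. The
  characters are distinct and decay along multiples of a contraction, so that every term of the sum vanishes
  (\<open>character_sum_eq_0_imp_coefficients_0\<close>). For any \<open>k\<close> with \<open>h\<^sub>k \<noteq> 0\<close> this gives \<open>F(z) = g\<^sub>k / h\<^sub>k\<close>:
  the function is constant near the origin, and a contraction carries every point there
  (\<open>quot_constant\<close>).

  Levi's theorem is proved with moments. Fix a direction \<open>d\<close> and a radius \<open>r\<close> such that \<open>F\<close> is
  holomorphic near the circle \<open>{s d | \<bar>s\<bar> = r}\<close>. The moments \<open>c\<^sub>n(y) = \<integral> F(y + s d) s\<^sup>n ds\<close> over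
  \<open>\<bar>s\<bar> = r\<close> are holomorphic in \<open>y\<close> near \<open>0\<close>. A generic line \<open>y + \<complex> d\<close> avoids the set where \<open>F\<close> is
  undefined, as this has codimension two. So \<open>F\<close> has finitely many poles in the disc on that line,
  and the moments satisfy a linear recurrence with constant coefficients. Baire's theorem and Gaussian
  elimination turn this into one recurrence with coefficients \<open>q\<^sub>i(y)\<close> holomorphic in \<open>y\<close>
  (\<open>recurrence_of_moments\<close>). The polynomial \<open>Q(y, s) = \<Sum> q\<^sub>i(y) s\<^sup>i\<close> clears the poles on all lines at
  once, and \<open>h(z) = Q(z - s\<^sub>0 d, s\<^sub>0)\<close> is a denominator for a suitable constant \<open>s\<^sub>0\<close>.
\<close>

section \<open>Holomorphic functions of several variables\<close>

lemma continuous_on_circle_integral: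
  fixes F :: "'a::topological_space \<Rightarrow> complex \<Rightarrow> complex"
  assumes "continuous_on (X \<times> sphere c r) (\<lambda>(y, s). F y s)" "0 \<le> r"
  shows "continuous_on X (\<lambda>y. contour_integral (circlepath c r) (F y))"
proof -
  have "continuous_on (X \<times> cbox 0 (1::real))
      (\<lambda>(y, t). F y (circlepath c r t) * vector_derivative (circlepath c r) (at t))"
    unfolding case_prod_beta vector_derivative_circlepath
  proof (intro continuous_on_mult)
    have "continuous_on (X \<times> cbox 0 (1::real)) (\<lambda>p. (\<lambda>(y, s). F y s) (fst p, circlepath c r (snd p)))"
    proof (rule continuous_on_compose2[OF assms(1)])
      show "continuous_on (X \<times> cbox 0 (1::real)) (\<lambda>p. (fst p, circlepath c r (snd p)))"
        unfolding circlepath by (intro continuous_intros)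
      show "(\<lambda>p. (fst p, circlepath c r (snd p))) ` (X \<times> cbox 0 1) \<subseteq> X \<times> sphere c r"
        using assms(2) by (auto simp: circlepath dist_norm norm_mult)
    qed
    then show "continuous_on (X \<times> cbox 0 (1::real)) (\<lambda>p. F (fst p) (circlepath c r (snd p)))"
      by simp
  qed (auto intro!: continuous_intros)
  from integral_continuous_on_param[OF this] show ?thesis
    by (simp add: contour_integral_integral)
qed

text \<open>
  Morera's theorem applies, because the integral over the boundary of a triangle can be interchanged
  with the integral over the circle.
\<close>
lemma holomorphic_on_circle_integral:
  assumes "open S" "0 < r"
    and cont: "continuous_on (S \<times> sphere c r) (\<lambda>(z, s). F z s)"
    and hol: "\<And>s. s \<in> sphere c r \<Longrightarrow> (\<lambda>z. F z s) holomorphic_on S"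
  shows "(\<lambda>z. contour_integral (circlepath c r) (F z)) holomorphic_on S"
proof -
  let ?I = "\<lambda>z. contour_integral (circlepath c r) (F z)"
  have pim: "path_image (circlepath c r) = sphere c r"
    using assms(2) by simp
  have contI: "continuous_on S ?I"
    using continuous_on_circle_integral[OF cont] assms(2) by simp
  have swap: "contour_integral (linepath a b) ?I =
        contour_integral (circlepath c r) (\<lambda>s. contour_integral (linepath a b) (\<lambda>z. F z s))"
    if "closed_segment a b \<subseteq> S" for a b
  proof (rule contour_integral_swap)
    show "continuous_on (path_image (linepath a b) \<times> path_image (circlepath c r)) (\<lambda>(y1, y2). F y1 y2)"
      using that pim by (auto intro: continuous_on_subset[OF cont])
    show "continuous_on {0..1} (\<lambda>t. vector_derivative (circlepath c r) (at t))"
      unfolding vector_derivative_circlepath by (intro continuous_intros)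
  qed (auto intro!: continuous_intros)
  have integ: "(\<lambda>s. contour_integral (linepath a b) (\<lambda>z. F z s)) contour_integrable_on circlepath c r"
    if "closed_segment a b \<subseteq> S" for a b
  proof -
    have "continuous_on (closed_segment a b \<times> sphere c r) (\<lambda>(z, s). F z s)"
      using that by (auto intro: continuous_on_subset[OF cont])
    then have sw: "continuous_on (sphere c r \<times> closed_segment a b) (\<lambda>(s, z). F z s)"
      by (rule continuous_on_swap_args)
    have "continuous_on (sphere c r \<times> cbox 0 (1::real))
      (\<lambda>(s, t). F (linepath a b t) s * vector_derivative (linepath a b) (at t))"
      unfolding case_prod_beta vector_derivative_linepath_at
    proof (intro continuous_on_mult continuous_on_const)
      have "continuous_on (sphere c r \<times> cbox 0 (1::real))
              (\<lambda>p. (\<lambda>(s, z). F z s) (fst p, linepath a b (snd p)))"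
        by (rule continuous_on_compose2[OF sw])
          (auto intro!: continuous_intros simp: linepath_def closed_segment_def)
      then show "continuous_on (sphere c r \<times> cbox 0 (1::real)) (\<lambda>p. F (linepath a b (snd p)) (fst p))"
        by simp
    qed
    from integral_continuous_on_param[OF this]
    have "continuous_on (sphere c r) (\<lambda>s. contour_integral (linepath a b) (\<lambda>z. F z s))"
      by (simp add: contour_integral_integral)
    then show ?thesis
      using pim by (intro contour_integrable_continuous_circlepath) simp
  qed
  have "?I analytic_on S"
  proof (rule Morera_triangle[OF contI \<open>open S\<close>], intro allI impI)
    fix a b d assume sub: "convex hull {a, b, d} \<subseteq> S"
    have segs: "closed_segment a b \<subseteq> S" "closed_segment b d \<subseteq> S" "closed_segment d a \<subseteq> S"
      using sub by (meson closed_segment_subset_convex_hull hull_inc insertI1 insertI2 order_trans)+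
    let ?L = "\<lambda>x y s. contour_integral (linepath x y) (\<lambda>z. F z s)"
    have "contour_integral (linepath a b) ?I + contour_integral (linepath b d) ?I
            + contour_integral (linepath d a) ?I
        = contour_integral (circlepath c r) (\<lambda>s. ?L a b s + ?L b d s + ?L d a s)"
      by (simp add: swap segs integ contour_integral_add contour_integrable_add)
    also have "\<dots> = contour_integral (circlepath c r) (\<lambda>s. 0)"
    proof (rule contour_integral_cong[OF refl])
      fix s assume "s \<in> path_image (circlepath c r)"
      then have "s \<in> sphere c r" using pim by blast
      then have h: "(\<lambda>z. F z s) holomorphic_on convex hull {a, b, d}"
        using hol sub holomorphic_on_subset by blast
      have "((\<lambda>z. F z s) has_contour_integral 0) (linepath a b +++ linepath b d +++ linepath d a)"
        by (rule Cauchy_theorem_triangle[OF h])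
      then show "?L a b s + ?L b d s + ?L d a s = 0"
        using has_chain_integral_chain_integral3 by blast
    qed
    finally show "contour_integral (linepath a b) ?I + contour_integral (linepath b d) ?I
            + contour_integral (linepath d a) ?I = 0" by simp
  qed
  then show ?thesis
    by (rule analytic_imp_holomorphic)
qed

lemma open_all_compact:
  fixes \<phi> :: "'a::topological_space \<times> 'b::topological_space \<Rightarrow> 'c::topological_space"
  assumes "open V" "compact K" "continuous_on UNIV \<phi>"
  shows "open {y. \<forall>s\<in>K. \<phi> (y, s) \<in> V}"
proof (subst open_subopen, intro ballI)
  fix z assume z: "z \<in> {y. \<forall>s\<in>K. \<phi> (y, s) \<in> V}"
  have "open (\<phi> -` V)" by (rule open_vimage[OF assms(1,3)])
  moreover have "{z} \<times> K \<subseteq> \<phi> -` V" using z by blast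
  ultimately have "\<exists>X. z \<in> X \<and> open X \<and> X \<times> K \<subseteq> \<phi> -` V"
    by (rule Elementary_Topology.tube_lemma[OF assms(2)])
  then show "\<exists>T. open T \<and> z \<in> T \<and> T \<subseteq> {y. \<forall>s\<in>K. \<phi> (y, s) \<in> V}" by blast
qed

text \<open>
  Only the coordinates in \<open>J\<close> are constrained, so this is a polydisc of \<open>\<complex>\<^sup>J\<close> times a full space in
  the other coordinates.
\<close>
definition polydisc :: "nat set \<Rightarrow> (nat \<Rightarrow> complex) \<Rightarrow> real \<Rightarrow> (nat \<Rightarrow> complex) set" where
  "polydisc J a r = {z. \<forall>i\<in>J. cmod (z i - a i) < r}"

text \<open>
  Functions on open subsets of \<open>\<complex>\<^sup>J\<close> are represented by functions on \<open>nat \<Rightarrow> complex\<close> that depend on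
  the coordinates in \<open>J\<close> only. This keeps a single type while the set of variables changes in an
  induction. The requirement is continuity and holomorphy in each variable; that such functions are
  holomorphic jointly is Osgood's lemma, which follows from the power series expansion below.
\<close>
definition holomorphic_vars ::
    "nat set \<Rightarrow> (nat \<Rightarrow> complex) set \<Rightarrow> ((nat \<Rightarrow> complex) \<Rightarrow> complex) \<Rightarrow> bool" where
  "holomorphic_vars J V f \<longleftrightarrow> open V
     \<and> (\<forall>z\<in>V. \<forall>z'. (\<forall>i\<in>J. z' i = z i) \<longrightarrow> z' \<in> V \<and> f z' = f z)
     \<and> continuous_on V f
     \<and> (\<forall>z\<in>V. \<forall>i\<in>J. (\<lambda>t. f (z(i := t))) field_differentiable at (z i))"

lemma holomorphic_varsD:
  assumes "holomorphic_vars J V f"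
  shows "open V" "\<And>z z'. z \<in> V \<Longrightarrow> (\<And>i. i \<in> J \<Longrightarrow> z' i = z i) \<Longrightarrow> z' \<in> V"
    "\<And>z z'. z \<in> V \<Longrightarrow> (\<And>i. i \<in> J \<Longrightarrow> z' i = z i) \<Longrightarrow> f z' = f z"
    "continuous_on V f"
    "\<And>z i. z \<in> V \<Longrightarrow> i \<in> J \<Longrightarrow> (\<lambda>t. f (z(i := t))) field_differentiable at (z i)"
  using assms unfolding holomorphic_vars_def by blast+

lemma open_polydisc: "finite J \<Longrightarrow> open (polydisc J a r)"
proof -
  assume "finite J"
  have "polydisc J a r = (\<Inter>i\<in>J. {z. cmod (z i - a i) < r})"
    by (auto simp: polydisc_def)
  moreover have "open {z. cmod (z i - a i) < r}" for i
    by (intro open_Collect_less continuous_intros continuous_on_product_coordinates)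
  ultimately show ?thesis using \<open>finite J\<close> by auto
qed

lemma centre_in_polydisc: "0 < r \<Longrightarrow> a \<in> polydisc J a r"
  by (simp add: polydisc_def)

text \<open>
  A basic neighbourhood for the product topology may constrain finitely many coordinates outside \<open>J\<close>,
  but these constraints can be dropped because \<open>V\<close> does not depend on them.
\<close>
lemma polydisc_in_open:
  assumes "open V" "a \<in> V" "finite J"
    and cyl: "\<And>z z'. z \<in> V \<Longrightarrow> (\<And>i. i \<in> J \<Longrightarrow> z' i = z i) \<Longrightarrow> z' \<in> V"
  obtains r where "0 < r" "polydisc J a r \<subseteq> V"
proof -
  have "openin (product_topology (\<lambda>i. euclidean) UNIV) V"
    using \<open>open V\<close> by (simp add: euclidean_product_topology)
  then obtain X where X: "a \<in> (\<Pi>\<^sub>E i\<in>UNIV. X i)" "\<And>i. open (X i)" "(\<Pi>\<^sub>E i\<in>UNIV. X i) \<subseteq> V"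
    using product_topology_open_contains_basis[of "\<lambda>_. euclidean" UNIV V a] \<open>a \<in> V\<close> by auto
  have "\<exists>e>0. ball (a i) e \<subseteq> X i" for i
    using X(1,2) by (meson PiE_mem UNIV_I open_contains_ball)
  then obtain e where e: "\<And>i. e i > 0" "\<And>i. ball (a i) (e i) \<subseteq> X i"
    by metis
  define r where "r = Min (insert 1 (e ` J))"
  have "r > 0" using \<open>finite J\<close> e by (auto simp: r_def)
  moreover have "polydisc J a r \<subseteq> V"
  proof
    fix z assume z: "z \<in> polydisc J a r"
    define z' where "z' i = (if i \<in> J then z i else a i)" for i
    have "z' i \<in> X i" for i
    proof (cases "i \<in> J")
      case True
      then have "r \<le> e i" using \<open>finite J\<close> by (auto simp: r_def)
      then show ?thesis
        using e(2)[of i] z True by (auto simp: z'_def polydisc_def dist_norm norm_minus_commute subset_eq)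
    next
      case False
      then show ?thesis using e[of i] by (auto simp: z'_def subset_eq)
    qed
    then have "z' \<in> V" using X(3) by auto
    then show "z \<in> V" by (rule cyl) (auto simp: z'_def)
  qed
  ultimately show ?thesis by (rule that)
qed

lemma holomorphic_vars_polydisc:
  assumes "holomorphic_vars J V f" "finite J" "a \<in> V"
  obtains r where "0 < r" "polydisc J a r \<subseteq> V"
  using polydisc_in_open[of V a J] holomorphic_varsD[OF assms(1)] assms(2,3) by metis

lemma holomorphic_varsI:
  assumes "open V" "\<And>z z'. z \<in> V \<Longrightarrow> (\<And>i. i \<in> J \<Longrightarrow> z' i = z i) \<Longrightarrow> z' \<in> V"
    "\<And>z z'. z \<in> V \<Longrightarrow> (\<And>i. i \<in> J \<Longrightarrow> z' i = z i) \<Longrightarrow> f z' = f z"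
    "continuous_on V f"
    "\<And>z i. z \<in> V \<Longrightarrow> i \<in> J \<Longrightarrow> (\<lambda>t. f (z(i := t))) field_differentiable at (z i)"
  shows "holomorphic_vars J V f"
  unfolding holomorphic_vars_def
proof (intro conjI ballI allI impI)
  fix z z' assume "z \<in> V" "\<forall>i\<in>J. z' i = z i"
  then show "z' \<in> V" "f z' = f z"
    using assms(2)[of z z'] assms(3)[of z z'] by blast+
qed (use assms in blast)+

lemma holomorphic_vars_subset:
  assumes f: "holomorphic_vars J V f" and oW: "open W" and sub: "W \<subseteq> V"
    and cyl: "\<And>z z'. z \<in> W \<Longrightarrow> (\<And>i. i \<in> J \<Longrightarrow> z' i = z i) \<Longrightarrow> z' \<in> W"
  shows "holomorphic_vars J W f"
proof (rule holomorphic_varsI)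
  fix z z' assume z: "z \<in> W" and eq: "\<And>i. i \<in> J \<Longrightarrow> z' i = z i"
  show "z' \<in> W" by (rule cyl[OF z eq])
  show "f z' = f z" by (rule holomorphic_varsD(3)[OF f _ eq]) (use sub z in blast)
next
  show "continuous_on W f" by (rule continuous_on_subset[OF holomorphic_varsD(4)[OF f] sub])
  show "(\<lambda>t. f (z(i := t))) field_differentiable at (z i)" if "z \<in> W" "i \<in> J" for z i
    by (rule holomorphic_varsD(5)[OF f]) (use sub that in blast)+
qed (rule oW)

lemma polydisc_cylinder:
  assumes "z \<in> polydisc J a r" "\<And>i. i \<in> J \<Longrightarrow> z' i = z i"
  shows "z' \<in> polydisc J a r"
  unfolding polydisc_def
proof (intro CollectI ballI)
  fix i assume "i \<in> J"
  then show "cmod (z' i - a i) < r"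
    using assms(1) assms(2)[of i] by (simp add: polydisc_def)
qed

lemma holomorphic_vars_const:
  assumes "open V" "\<And>z z'. z \<in> V \<Longrightarrow> (\<And>i. i \<in> J \<Longrightarrow> z' i = z i) \<Longrightarrow> z' \<in> V"
  shows "holomorphic_vars J V (\<lambda>_. c)"
proof (rule holomorphic_varsI)
  show "z' \<in> V" if "z \<in> V" "\<And>i. i \<in> J \<Longrightarrow> z' i = z i" for z z'
    by (rule assms(2)[OF that])
qed (simp_all add: assms(1))

lemma holomorphic_vars_binary:
  assumes f: "holomorphic_vars J V f" and g: "holomorphic_vars J V g"
    and "continuous_on V (\<lambda>z. b (f z) (g z))"
    and "\<And>z i. z \<in> V \<Longrightarrow> i \<in> J \<Longrightarrow> (\<lambda>t. b (f (z(i := t))) (g (z(i := t)))) field_differentiable at (z i)"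
  shows "holomorphic_vars J V (\<lambda>z. b (f z) (g z))"
proof (rule holomorphic_varsI)
  fix z z' assume z: "z \<in> V" and eq: "\<And>i. i \<in> J \<Longrightarrow> z' i = z i"
  show "z' \<in> V" by (rule holomorphic_varsD(2)[OF f z eq])
  have "f z' = f z" by (rule holomorphic_varsD(3)[OF f z eq])
  moreover have "g z' = g z" by (rule holomorphic_varsD(3)[OF g z eq])
  ultimately show "b (f z') (g z') = b (f z) (g z)" by simp
qed (use assms holomorphic_varsD(1)[OF f] in blast)+

lemma holomorphic_vars_mult:
  assumes "holomorphic_vars J V f" "holomorphic_vars J V g"
  shows "holomorphic_vars J V (\<lambda>z. f z * g z)"
  by (rule holomorphic_vars_binary[OF assms])
    (simp_all add: continuous_on_mult field_differentiable_mult holomorphic_varsD(4,5)[OF assms(1)] holomorphic_varsD(4,5)[OF assms(2)])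

lemma holomorphic_vars_add:
  assumes "holomorphic_vars J V f" "holomorphic_vars J V g"
  shows "holomorphic_vars J V (\<lambda>z. f z + g z)"
  by (rule holomorphic_vars_binary[OF assms])
    (simp_all add: continuous_on_add field_differentiable_add holomorphic_varsD(4,5)[OF assms(1)] holomorphic_varsD(4,5)[OF assms(2)])

lemma holomorphic_vars_diff:
  assumes "holomorphic_vars J V f" "holomorphic_vars J V g"
  shows "holomorphic_vars J V (\<lambda>z. f z - g z)"
  by (rule holomorphic_vars_binary[OF assms])
    (simp_all add: continuous_on_diff field_differentiable_diff holomorphic_varsD(4,5)[OF assms(1)] holomorphic_varsD(4,5)[OF assms(2)])

lemma holomorphic_vars_divide:
  assumes "holomorphic_vars J V f" "holomorphic_vars J V g" "\<And>z. z \<in> V \<Longrightarrow> g z \<noteq> 0"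
  shows "holomorphic_vars J V (\<lambda>z. f z / g z)"
proof (rule holomorphic_vars_binary[OF assms(1,2)])
  show "continuous_on V (\<lambda>z. f z / g z)"
    using holomorphic_varsD(4)[OF assms(1)] holomorphic_varsD(4)[OF assms(2)] assms(3)
    by (intro continuous_on_divide) auto
  show "(\<lambda>t. f (z(i := t)) / g (z(i := t))) field_differentiable at (z i)" if "z \<in> V" "i \<in> J" for z i
    using holomorphic_varsD(5)[OF assms(1) that] holomorphic_varsD(5)[OF assms(2) that] assms(3)[OF that(1)]
    by (intro field_differentiable_divide) (simp_all add: fun_upd_idem)
qed

lemma holomorphic_vars_sum:
  assumes "finite A" "\<And>k. k \<in> A \<Longrightarrow> holomorphic_vars J V (f k)" "open V"
    "\<And>z z'. z \<in> V \<Longrightarrow> (\<And>i. i \<in> J \<Longrightarrow> z' i = z i) \<Longrightarrow> z' \<in> V"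
  shows "holomorphic_vars J V (\<lambda>z. \<Sum>k\<in>A. f k z)"
  using assms(1,2)
proof (induction A rule: finite_induct)
  case empty
  show ?case unfolding sum.empty by (rule holomorphic_vars_const[OF assms(3,4)])
next
  case (insert x F)
  then show ?case by (simp add: holomorphic_vars_add)
qed

lemma holomorphic_vars_locally:
  assumes "\<And>a. a \<in> V \<Longrightarrow> \<exists>W g. a \<in> W \<and> W \<subseteq> V \<and> holomorphic_vars J W g \<and> (\<forall>z\<in>W. f z = g z)"
    and finJ: "finite J"
  shows "holomorphic_vars J V f"
proof -
  obtain W g where W: "\<And>a. a \<in> V \<Longrightarrow> a \<in> W a" "\<And>a. a \<in> V \<Longrightarrow> W a \<subseteq> V"
     "\<And>a. a \<in> V \<Longrightarrow> holomorphic_vars J (W a) (g a)" "\<And>a z. a \<in> V \<Longrightarrow> z \<in> W a \<Longrightarrow> f z = g a z"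
    using assms(1) by metis
  have "V = (\<Union>a\<in>V. W a)" using W(1,2) by blast
  moreover have "open (\<Union>a\<in>V. W a)"
    using holomorphic_varsD(1)[OF W(3)] by (intro open_UN ballI)
  ultimately have oV: "open V" by simp
  have "continuous_on V f"
    unfolding continuous_on_eq_continuous_at[OF oV]
  proof
    fix a assume a: "a \<in> V"
    have "continuous_on (W a) f"
      using holomorphic_varsD(4)[OF W(3)[OF a]] W(4)[OF a] by (simp cong: continuous_on_cong)
    then show "isCont f a"
      using W(1)[OF a] holomorphic_varsD(1)[OF W(3)[OF a]] continuous_on_eq_continuous_at by blast
  qed
  moreover have "(\<lambda>t. f (a(i := t))) field_differentiable at (a i)" if a: "a \<in> V" and i: "i \<in> J" for a i
  proof -
    obtain r where r: "0 < r" "polydisc J a r \<subseteq> W a"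
      using holomorphic_vars_polydisc[OF W(3)[OF a] finJ W(1)[OF a]] .
    have "\<forall>\<^sub>F t in nhds (a i). f (a(i := t)) = g a (a(i := t))"
      unfolding eventually_nhds_metric
    proof (intro exI[of _ r] conjI allI impI)
      fix t assume "dist t (a i) < r"
      then have "a(i := t) \<in> polydisc J a r" using r(1) by (auto simp: polydisc_def dist_norm)
      then show "f (a(i := t)) = g a (a(i := t))" using r(2) W(4)[OF a] by blast
    qed (use r in auto)
    then show ?thesis
      using holomorphic_varsD(5)[OF W(3)[OF a] W(1)[OF a] i]
      unfolding field_differentiable_def by (metis DERIV_cong_ev)
  qed
  moreover have "z' \<in> V \<and> f z' = f z" if "z \<in> V" "\<forall>i\<in>J. z' i = z i" for z z'
    using holomorphic_varsD(2,3)[OF W(3)[OF that(1)]] W(1,2,4)[OF that(1)] that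
    by (metis subsetD)
  ultimately show ?thesis
    using oV unfolding holomorphic_vars_def by blast
qed

lemma continuous_on_fun_upd:
  fixes z :: "nat \<Rightarrow> complex"
  assumes "continuous_on X f"
  shows "continuous_on X (\<lambda>p. z(i := f p))"
proof (rule continuous_on_coordinatewise_then_product)
  show "continuous_on X (\<lambda>p. (z(i := f p)) j)" for j
    using assms by (cases "j = i") simp_all
qed

lemma holomorphic_vars_circle_integral:
  assumes oW: "open W" and finJ: "finite J" and r: "0 < r"
    and cyl: "\<And>z z'. z \<in> W \<Longrightarrow> (\<And>i. i \<in> J \<Longrightarrow> z' i = z i) \<Longrightarrow> z' \<in> W"
    and cont: "continuous_on (W \<times> sphere c r) (\<lambda>(y, s). F y s)"
    and hol: "\<And>s. s \<in> sphere c r \<Longrightarrow> holomorphic_vars J W (\<lambda>y. F y s)"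
  shows "holomorphic_vars J W (\<lambda>y. contour_integral (circlepath c r) (F y))"
  unfolding holomorphic_vars_def
proof (intro conjI ballI allI impI)
  show "continuous_on W (\<lambda>y. contour_integral (circlepath c r) (F y))"
    using continuous_on_circle_integral[OF cont] r by simp
next
  fix z z' assume z: "z \<in> W" and eq: "\<forall>i\<in>J. z' i = z i"
  then show "z' \<in> W" using cyl by blast
  show "contour_integral (circlepath c r) (F z') = contour_integral (circlepath c r) (F z)"
  proof (rule contour_integral_cong[OF refl])
    fix s assume "s \<in> path_image (circlepath c r)"
    then have "s \<in> sphere c r" using path_image_circlepath_nonneg[of r c] r by simp
    then show "F z' s = F z s"
      using holomorphic_varsD(3)[OF hol z, of s z'] eq by blast
  qed
next
  fix z i assume z: "z \<in> W" and i: "i \<in> J"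
  obtain e where e: "0 < e" "polydisc J z e \<subseteq> W"
    by (rule polydisc_in_open[OF oW z finJ cyl])
  have inW: "z(i := t) \<in> W" if "t \<in> ball (z i) e" for t
  proof -
    have "z(i := t) \<in> polydisc J z e"
      using that e(1) by (simp add: polydisc_def dist_norm norm_minus_commute)
    then show ?thesis using e(2) by blast
  qed
  have "(\<lambda>t. contour_integral (circlepath c r) (F (z(i := t)))) holomorphic_on ball (z i) e"
  proof (rule holomorphic_on_circle_integral[OF open_ball r])
    have "continuous_on (ball (z i) e \<times> sphere c r) (\<lambda>p. (\<lambda>(y, s). F y s) (z(i := fst p), snd p))"
    proof (rule continuous_on_compose2[OF cont])
      have "continuous_on (ball (z i) e \<times> sphere c r) (\<lambda>p. z(i := fst p))"
        by (rule continuous_on_fun_upd) (rule continuous_on_fst[OF continuous_on_id])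
      then show "continuous_on (ball (z i) e \<times> sphere c r) (\<lambda>p. (z(i := fst p), snd p))"
        by (rule continuous_on_Pair) (rule continuous_on_snd[OF continuous_on_id])
      show "(\<lambda>p. (z(i := fst p), snd p)) ` (ball (z i) e \<times> sphere c r) \<subseteq> W \<times> sphere c r"
      proof (rule image_subsetI)
        fix p assume "p \<in> ball (z i) e \<times> sphere c r"
        then show "(z(i := fst p), snd p) \<in> W \<times> sphere c r"
          using inW[of "fst p"] by (simp only: mem_Times_iff fst_conv snd_conv)
      qed
    qed
    then show "continuous_on (ball (z i) e \<times> sphere c r) (\<lambda>(t, s). F (z(i := t)) s)"
      by (simp add: case_prod_beta)
  next
    fix s assume s: "s \<in> sphere c r"
    show "(\<lambda>t. F (z(i := t)) s) holomorphic_on ball (z i) e"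
      unfolding holomorphic_on_def
    proof
      fix t assume t: "t \<in> ball (z i) e"
      show "(\<lambda>t. F (z(i := t)) s) field_differentiable at t within ball (z i) e"
        using holomorphic_varsD(5)[OF hol[OF s] inW[OF t] i] 
        by (simp add: field_differentiable_at_within)
    qed
  qed
  then show "(\<lambda>t. contour_integral (circlepath c r) (F (z(i := t)))) field_differentiable at (z i)"
    using e(1) by (auto simp: holomorphic_on_open field_differentiable_def)
qed (use oW in auto)

section \<open>Power series expansions and the identity theorem\<close>

text \<open>
  Exponents are total functions vanishing off \<open>J\<close>, so that those for \<open>insert j J\<close> are pairs of a number
  and an exponent for \<open>J\<close>.
\<close>
definition exponents :: "nat set \<Rightarrow> (nat \<Rightarrow> nat) set" where
  "exponents J = {k. \<forall>i. i \<notin> J \<longrightarrow> k i = 0}"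

definition monomial :: "nat set \<Rightarrow> (nat \<Rightarrow> nat) \<Rightarrow> (nat \<Rightarrow> 'a::comm_monoid_mult) \<Rightarrow> 'a" where
  "monomial J k z = (\<Prod>i\<in>J. z i ^ k i)"

lemma bij_betw_exponents_insert:
  assumes "j \<notin> J"
  shows "bij_betw (\<lambda>(n, k). k(j := n)) (UNIV \<times> exponents J) (exponents (insert j J))"
proof (rule bij_betwI[where g = "\<lambda>k. (k j, k(j := 0))"])
  show "(\<lambda>(n, k). k(j := n)) \<in> UNIV \<times> exponents J \<rightarrow> exponents (insert j J)"
    by (auto simp: exponents_def)
  show "(\<lambda>k. (k j, k(j := 0))) \<in> exponents (insert j J) \<rightarrow> UNIV \<times> exponents J"
    by (auto simp: exponents_def)
qed (use assms in \<open>auto simp: exponents_def\<close>)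

lemma monomial_insert:
  assumes "finite J" "j \<notin> J"
  shows "monomial (insert j J) (k(j := n)) z = z j ^ n * monomial J k z"
proof -
  have "(\<Prod>i\<in>J. z i ^ (k(j := n)) i) = (\<Prod>i\<in>J. z i ^ k i)"
    by (rule prod.cong) (use assms in auto)
  then show ?thesis using assms by (simp add: monomial_def)
qed

lemma exponents_empty: "exponents {} = {\<lambda>_. 0}"
  by (auto simp: exponents_def)

lemma summable_on_monomial:
  fixes q :: "nat \<Rightarrow> real"
  assumes "finite J" "\<And>i. i \<in> J \<Longrightarrow> 0 \<le> q i \<and> q i < 1"
  shows "(\<lambda>k. monomial J k q) summable_on exponents J"
  using assms
proof (induction J rule: finite_induct)
  case empty
  then show ?case by (simp add: exponents_empty)
next
  case (insert j J)
  have mono_nonneg: "0 \<le> monomial J k q" for k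
    using insert.prems by (auto simp: monomial_def intro!: prod_nonneg)
  have qj: "0 \<le> q j" "q j < 1" using insert.prems by auto
  have S: "(\<lambda>k. monomial J k q) summable_on exponents J"
    using insert by auto
  have "(\<lambda>(n, k). q j ^ n * monomial J k q) summable_on (UNIV \<times> exponents J)"
  proof (rule summable_on_SigmaI)
    show "((\<lambda>k. case (n, k) of (n, k) \<Rightarrow> q j ^ n * monomial J k q) has_sum
        q j ^ n * infsum (\<lambda>k. monomial J k q) (exponents J)) (exponents J)" for n
      using has_sum_cmult_right[OF has_sum_infsum[OF S]] by simp
    have "(\<lambda>n. q j ^ n) summable_on UNIV"
      using qj by (intro norm_summable_imp_summable_on) (simp add: summable_geometric)
    then show "(\<lambda>n. q j ^ n * infsum (\<lambda>k. monomial J k q) (exponents J)) summable_on UNIV"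
      by (rule summable_on_cmult_left)
  qed (use mono_nonneg qj in auto)
  then have "(\<lambda>p. monomial (insert j J) ((\<lambda>(n, k). k(j := n)) p) q) summable_on (UNIV \<times> exponents J)"
    by (simp only: case_prod_unfold monomial_insert[OF insert.hyps(1,2)])
  then show ?case
    using summable_on_reindex_bij_betw[OF bij_betw_exponents_insert[OF insert.hyps(2)],
        of "\<lambda>k. monomial (insert j J) k q"] by simp
qed

lemma norm_monomial: "norm (monomial J k (z :: nat \<Rightarrow> complex)) = monomial J k (\<lambda>i. norm (z i))"
  by (simp add: monomial_def prod_norm norm_power flip: prod_norm)

lemma power_series_summable:
  fixes c :: "(nat \<Rightarrow> nat) \<Rightarrow> complex"
  assumes "finite J" "0 < r" "\<And>k. k \<in> exponents J \<Longrightarrow> cmod (c k) \<le> M / r ^ (\<Sum>i\<in>J. k i)"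
    "\<And>i. i \<in> J \<Longrightarrow> \<rho> i < r" "\<And>i. i \<in> J \<Longrightarrow> 0 \<le> \<rho> i"
  shows "(\<lambda>k. cmod (c k) * monomial J k \<rho>) summable_on exponents J"
proof -
  define q where "q i = \<rho> i / r" for i
  have S: "(\<lambda>k. M * monomial J k q) summable_on exponents J"
    using assms by (intro summable_on_cmult_right summable_on_monomial) (auto simp: q_def)
  have "norm (cmod (c k) * monomial J k \<rho>) \<le> M * monomial J k q" if "k \<in> exponents J" for k
  proof -
    have nn: "0 \<le> monomial J k \<rho>" using assms(5) by (auto simp: monomial_def intro!: prod_nonneg)
    have "monomial J k q = monomial J k \<rho> / r ^ (\<Sum>i\<in>J. k i)"
      by (simp add: monomial_def q_def power_divide prod_dividef power_sum)
    moreover have "cmod (c k) * monomial J k \<rho> \<le> (M / r ^ (\<Sum>i\<in>J. k i)) * monomial J k \<rho>"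
      by (rule mult_right_mono[OF assms(3)[OF that] nn])
    ultimately show ?thesis using nn by (simp add: mult.assoc)
  qed
  then show ?thesis
    by (rule abs_summable_summable[OF Infinite_Sum.abs_summable_on_comparison_test'[OF S]])
qed

lemma one_variable_coefficients:
  assumes r: "0 < r" and cont: "continuous_on (cball 0 r) \<phi>" and hol: "\<phi> holomorphic_on ball 0 r"
    and bd: "\<And>s. s \<in> cball 0 r \<Longrightarrow> cmod (\<phi> s) \<le> M"
  defines "a \<equiv> \<lambda>n. contour_integral (circlepath 0 r) (\<lambda>s. \<phi> s / s ^ Suc n) / (2 * pi * \<i>)"
  shows "cmod (a n) \<le> M / r ^ n" "w \<in> ball 0 r \<Longrightarrow> (\<lambda>n. a n * w ^ n) sums \<phi> w"
proof -
  have der: "((\<lambda>u. \<phi> u / (u - 0) ^ Suc n) has_contour_integral (2 * pi * \<i>) / fact n * (deriv ^^ n) \<phi> 0)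
      (circlepath 0 r)" for n
    by (rule Cauchy_has_contour_integral_higher_derivative_circlepath[OF cont hol]) (use r in simp)
  have a: "a n = (deriv ^^ n) \<phi> 0 / fact n" for n
    using contour_integral_unique[OF der[of n]] by (simp add: a_def)
  have M0: "0 \<le> M" using bd[of 0] r norm_ge_zero[of "\<phi> 0"] by (simp del: norm_ge_zero)
  have "cmod ((2 * pi * \<i>) / fact n * (deriv ^^ n) \<phi> 0) \<le> M / r ^ Suc n * (2 * pi * r)"
  proof (rule has_contour_integral_bound_circlepath[OF der])
    fix x assume "cmod (x - 0) = r"
    then show "cmod (\<phi> x / (x - 0) ^ Suc n) \<le> M / r ^ Suc n"
      using bd[of x] r by (simp add: norm_divide norm_power norm_mult divide_right_mono del: power_Suc)
  qed (use M0 r in auto)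
  then have "2 * pi * cmod (a n) \<le> 2 * pi * (M / r ^ n)"
    using r by (simp add: a norm_mult norm_divide field_simps)
  then show "cmod (a n) \<le> M / r ^ n"
    by (rule mult_left_le_imp_le) simp
  show "(\<lambda>n. a n * w ^ n) sums \<phi> w" if "w \<in> ball 0 r"
    using holomorphic_power_series[OF hol that] by (simp add: a)
qed

text \<open>
  Cauchy's formula in the variable \<open>j\<close> gives coefficients that are holomorphic in the remaining
  variables. They are bounded by \<open>M / r ^ n\<close>, and this bound is what the induction on the number of
  variables passes on; it also makes the resulting multiple series absolutely summable.
\<close>
lemma power_series_expansion:
  assumes "finite J" "holomorphic_vars J V f" "0 < r" "{z. \<forall>i\<in>J. cmod (z i) \<le> r} \<subseteq> V"
    "\<And>z. (\<forall>i\<in>J. cmod (z i) \<le> r) \<Longrightarrow> cmod (f z) \<le> M"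
  shows "\<exists>c. (\<forall>k\<in>exponents J. cmod (c k) \<le> M / r ^ (\<Sum>i\<in>J. k i)) \<and>
     (\<forall>z\<in>polydisc J (\<lambda>_. 0) r. ((\<lambda>k. c k * monomial J k z) has_sum f z) (exponents J))"
  using assms
proof (induction J arbitrary: f V M rule: finite_induct)
  case empty
  have "f z = f (\<lambda>_. 0)" for z
    using holomorphic_varsD(3)[OF empty.prems(1), of "\<lambda>_. 0" z] empty.prems(3) by auto
  moreover have "cmod (f (\<lambda>_. 0)) \<le> M" using empty.prems(4) by simp
  ultimately show ?case
    by (intro exI[of _ "\<lambda>_. f (\<lambda>_. 0)"]) (simp add: exponents_empty monomial_def has_sum_finite_iff)
next
  case (insert j J)
  note f = insert.prems(1) and r = insert.prems(2)
  note fin = insert.hyps(1) and jJ = insert.hyps(2)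
  define V' where "V' = {z. \<forall>s\<in>cball 0 r. z(j := s) \<in> V}"
  have contupd: "continuous_on UNIV (\<lambda>p :: (nat \<Rightarrow> complex) \<times> complex. (fst p)(j := snd p))"
  proof (rule continuous_on_coordinatewise_then_product)
    fix i
    have "continuous_on UNIV (\<lambda>p :: (nat \<Rightarrow> complex) \<times> complex. (fst p) i)"
      by (rule continuous_on_product_then_coordinatewise) (rule continuous_on_fst[OF continuous_on_id])
    then show "continuous_on UNIV (\<lambda>p :: (nat \<Rightarrow> complex) \<times> complex. ((fst p)(j := snd p)) i)"
      by (cases "i = j") (simp_all add: continuous_on_snd[OF continuous_on_id])
  qed
  have oV': "open V'"
    using open_all_compact[OF holomorphic_varsD(1)[OF f] compact_cball contupd]
    by (simp add: V'_def)
  have cylV': "z' \<in> V'" if "z \<in> V'" "\<And>i. i \<in> J \<Longrightarrow> z' i = z i" for z z'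
    unfolding V'_def
  proof (intro CollectI ballI)
    fix s :: complex assume "s \<in> cball 0 r"
    then have "z(j := s) \<in> V" using that(1) by (auto simp: V'_def)
    then show "z'(j := s) \<in> V"
      by (rule holomorphic_varsD(2)[OF f]) (use that(2) in auto)
  qed
  define a where "a n z = contour_integral (circlepath 0 r) (\<lambda>s. f (z(j := s)) / s ^ Suc n) / (2 * pi * \<i>)"
    for n and z :: "nat \<Rightarrow> complex"
  have sub': "{z. \<forall>i\<in>J. cmod (z i) \<le> r} \<subseteq> V'"
  proof
    fix z :: "nat \<Rightarrow> complex" assume "z \<in> {z. \<forall>i\<in>J. cmod (z i) \<le> r}"
    then show "z \<in> V'" using insert.prems(3) by (auto simp: V'_def)
  qed
  have hola: "holomorphic_vars J V' (a n)" for n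
  proof -
    have "holomorphic_vars J V' (\<lambda>z. contour_integral (circlepath 0 r) (\<lambda>s. f (z(j := s)) / s ^ Suc n))"
    proof (rule holomorphic_vars_circle_integral[OF oV' fin r cylV'])
      have "continuous_on (V' \<times> sphere 0 r) (\<lambda>p. f ((fst p)(j := snd p)) / (snd p) ^ Suc n)"
      proof (intro continuous_on_divide)
        show "continuous_on (V' \<times> sphere 0 r) (\<lambda>p. f ((fst p)(j := snd p)))"
          by (rule continuous_on_compose2[OF holomorphic_varsD(4)[OF f] continuous_on_subset[OF contupd]])
            (auto simp: V'_def)
        show "continuous_on (V' \<times> sphere 0 r) (\<lambda>p. (snd p :: complex) ^ Suc n)"
          by (intro continuous_on_power continuous_on_snd continuous_on_id)
      qed (use r in auto)
      then show "continuous_on (V' \<times> sphere 0 r) (\<lambda>(z, s). f (z(j := s)) / s ^ Suc n)"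
        by (simp add: case_prod_beta)
    next
      fix s :: complex assume s: "s \<in> sphere 0 r"
      show "holomorphic_vars J V' (\<lambda>z. f (z(j := s)) / s ^ Suc n)"
      proof (rule holomorphic_varsI)
        fix z z' assume z: "z \<in> V'" and eq: "\<And>i. i \<in> J \<Longrightarrow> z' i = z i"
        show "z' \<in> V'" by (rule cylV'[OF z eq])
        have zV: "z(j := s) \<in> V" using z s by (simp add: V'_def)
        have "f (z'(j := s)) = f (z(j := s))"
          by (rule holomorphic_varsD(3)[OF f zV]) (metis eq fun_upd_apply insertE)
        then show "f (z'(j := s)) / s ^ Suc n = f (z(j := s)) / s ^ Suc n" by simp
      next
        have "continuous_on V' (\<lambda>z. f (z(j := s)))"
        proof (rule continuous_on_compose2[OF holomorphic_varsD(4)[OF f]])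
          have "continuous_on V' (\<lambda>z. (fst (z, s))(j := snd (z, s)))"
            by (rule continuous_on_compose2[OF contupd, of V' "\<lambda>z. (z, s)"])
              (auto intro!: continuous_on_Pair continuous_on_id continuous_on_const)
          then show "continuous_on V' (\<lambda>z. z(j := s))" by simp
          have "s \<in> cball 0 r" using s by simp
          then show "(\<lambda>z. z(j := s)) ` V' \<subseteq> V" unfolding V'_def by blast
        qed
        then show "continuous_on V' (\<lambda>z. f (z(j := s)) / s ^ Suc n)"
          by (rule continuous_on_divide) (use s r in \<open>auto intro: continuous_on_const\<close>)
      next
        fix z i assume z: "z \<in> V'" and i: "i \<in> J"
        have ij: "i \<noteq> j" using i jJ by auto
        have "(\<lambda>t. f ((z(j := s))(i := t))) field_differentiable at ((z(j := s)) i)"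
          by (rule holomorphic_varsD(5)[OF f]) (use z s i in \<open>simp_all add: V'_def\<close>)
        then have "(\<lambda>t. f (z(i := t, j := s))) field_differentiable at (z i)"
          using ij by (simp add: fun_upd_twist)
        then have "(\<lambda>t. inverse (s ^ Suc n) * f (z(i := t, j := s))) field_differentiable at (z i)"
          by (rule field_differentiable_mult[OF field_differentiable_const])
        then show "(\<lambda>t. f (z(i := t, j := s)) / s ^ Suc n) field_differentiable at (z i)"
          by (simp add: field_simps)
      qed (rule oV')
    qed
    from holomorphic_vars_mult[OF this holomorphic_vars_const[where c = "1 / (2 * complex_of_real pi * \<i>)", OF oV' cylV']]
    show ?thesis by (simp add: a_def[abs_def])
  qed
  have phi: "continuous_on (cball 0 r) (\<lambda>s. f (z(j := s)))" "(\<lambda>s. f (z(j := s))) holomorphic_on ball 0 r"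
    "\<And>s. s \<in> cball 0 r \<Longrightarrow> cmod (f (z(j := s))) \<le> M"
    if z: "\<forall>i\<in>J. cmod (z i) \<le> r" for z
  proof -
    have zV: "z(j := s) \<in> V" if "s \<in> cball 0 r" for s
      using z sub' that by (auto simp: V'_def)
    show "continuous_on (cball 0 r) (\<lambda>s. f (z(j := s)))"
      by (rule continuous_on_compose2[OF holomorphic_varsD(4)[OF f] continuous_on_fun_upd[OF continuous_on_id]])
        (use zV in auto)
    show "(\<lambda>s. f (z(j := s))) holomorphic_on ball 0 r"
      unfolding holomorphic_on_def
    proof
      fix s :: complex assume "s \<in> ball 0 r"
      then have "z(j := s) \<in> V" using zV by auto
      then have "(\<lambda>t. f ((z(j := s))(j := t))) field_differentiable at ((z(j := s)) j)"
        by (rule holomorphic_varsD(5)[OF f]) simp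
      then have "(\<lambda>t. f (z(j := t))) field_differentiable at s"
        by (simp only: fun_upd_upd fun_upd_same)
      then show "(\<lambda>s. f (z(j := s))) field_differentiable at s within ball 0 r"
        by (rule field_differentiable_at_within)
    qed
    show "cmod (f (z(j := s))) \<le> M" if "s \<in> cball 0 r" for s
      using insert.prems(4) z that by auto
  qed
  have "\<exists>c. (\<forall>k\<in>exponents J. cmod (c k) \<le> (M / r ^ n) / r ^ (\<Sum>i\<in>J. k i)) \<and>
     (\<forall>z\<in>polydisc J (\<lambda>_. 0) r. ((\<lambda>k. c k * monomial J k z) has_sum a n z) (exponents J))" for n
  proof (rule insert.IH[OF hola r sub'])
    fix z assume "\<forall>i\<in>J. cmod (z i) \<le> r"
    from one_variable_coefficients(1)[OF r phi[OF this]]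
    show "cmod (a n z) \<le> M / r ^ n" by (simp add: a_def)
  qed
  then obtain c where c: "\<And>n k. k \<in> exponents J \<Longrightarrow> cmod (c n k) \<le> (M / r ^ n) / r ^ (\<Sum>i\<in>J. k i)"
     "\<And>n z. z \<in> polydisc J (\<lambda>_. 0) r \<Longrightarrow> ((\<lambda>k. c n k * monomial J k z) has_sum a n z) (exponents J)"
    by metis
  define C where "C k = c (k j) (k(j := 0))" for k
  have CB: "cmod (C k) \<le> M / r ^ (\<Sum>i\<in>insert j J. k i)" if k: "k \<in> exponents (insert j J)" for k
  proof -
    have "k(j := 0) \<in> exponents J" using k by (auto simp: exponents_def)
    from c(1)[OF this, of "k j"] have "cmod (C k) \<le> (M / r ^ k j) / r ^ (\<Sum>i\<in>J. (k(j := 0)) i)"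
      by (simp add: C_def)
    moreover have "(\<Sum>i\<in>J. (k(j := 0)) i) = (\<Sum>i\<in>J. k i)"
      by (rule sum.cong) (use jJ in auto)
    ultimately show ?thesis using fin jJ by (simp add: power_add)
  qed
  have "((\<lambda>k. C k * monomial (insert j J) k z) has_sum f z) (exponents (insert j J))"
    if z: "z \<in> polydisc (insert j J) (\<lambda>_. 0) r" for z
  proof -
    have zi: "cmod (z i) < r" if "i \<in> insert j J" for i
    proof -
      have "cmod (z i - 0) < r"
        using z that unfolding polydisc_def mem_Collect_eq by (rule bspec)
      then show ?thesis by simp
    qed
    let ?t = "\<lambda>k. C k * monomial (insert j J) k z"
    have "(\<lambda>k. cmod (C k) * monomial (insert j J) k (\<lambda>i. cmod (z i))) summable_on exponents (insert j J)"
      by (rule power_series_summable[OF _ r CB zi]) (use fin in auto)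
    then have "(\<lambda>k. norm (?t k)) summable_on exponents (insert j J)"
      by (simp add: norm_mult norm_monomial)
    then have sm: "?t summable_on exponents (insert j J)"
      by (rule abs_summable_summable)
    have bij: "bij_betw (\<lambda>(n, k). k(j := n)) (UNIV \<times> exponents J) (exponents (insert j J))"
      by (rule bij_betw_exponents_insert[OF jJ])
    have "((\<lambda>p. ?t ((\<lambda>(n, k). k(j := n)) p)) has_sum infsum ?t (exponents (insert j J))) (UNIV \<times> exponents J)"
      by (rule has_sum_reindex_bij_betw[OF bij, THEN iffD2]) (rule has_sum_infsum[OF sm])
    then have "((\<lambda>n. a n z * z j ^ n) has_sum infsum ?t (exponents (insert j J))) UNIV"
    proof (rule has_sum_SigmaD)
      fix n
      have "((\<lambda>k. (c n k * monomial J k z) * z j ^ n) has_sum a n z * z j ^ n) (exponents J)"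
        by (rule has_sum_cmult_left[OF c(2)]) (use zi in \<open>auto simp: polydisc_def\<close>)
      then show "((\<lambda>k. ?t ((\<lambda>(n, k). k(j := n)) (n, k))) has_sum a n z * z j ^ n) (exponents J)"
      proof (rule has_sum_cong[THEN iffD1, rotated])
        fix k assume "k \<in> exponents J"
        then have "k j = 0" using jJ by (auto simp: exponents_def)
        then have "C (k(j := n)) = c n k" by (simp add: C_def fun_upd_idem)
        then show "c n k * monomial J k z * z j ^ n = ?t ((\<lambda>(n, k). k(j := n)) (n, k))"
          by (simp add: monomial_insert[OF fin jJ])
      qed
    qed
    then have "(\<lambda>n. a n z * z j ^ n) sums infsum ?t (exponents (insert j J))"
      by (rule has_sum_imp_sums)
    moreover have "(\<lambda>n. a n z * z j ^ n) sums f (z(j := z j))"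
      using one_variable_coefficients(2)[OF r phi[of z], of "z j"] zi
      by (auto simp: a_def less_imp_le)
    ultimately have "infsum ?t (exponents (insert j J)) = f z"
      using sums_unique2 by force
    then show ?thesis using has_sum_infsum[OF sm] by simp
  qed
  then show ?case using CB by (intro exI[of _ C]) blast
qed

lemma continuous_on_shift:
  fixes c :: "nat \<Rightarrow> complex"
  shows "continuous_on X (\<lambda>z i. z i + c i)"
proof (rule continuous_on_coordinatewise_then_product)
  show "continuous_on X (\<lambda>z. z i + c i)" for i
    by (rule continuous_on_add[OF continuous_on_product_then_coordinatewise[OF continuous_on_id] continuous_on_const])
qed

lemma holomorphic_vars_shift:
  assumes f: "holomorphic_vars J V f"
  shows "holomorphic_vars J {z. (\<lambda>i. z i + c i) \<in> V} (\<lambda>z. f (\<lambda>i. z i + c i))"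
proof (rule holomorphic_varsI)
  show "open {z. (\<lambda>i. z i + c i) \<in> V}"
    using open_vimage[OF holomorphic_varsD(1)[OF f] continuous_on_shift[of UNIV c]] by (simp add: vimage_def)
  show "continuous_on {z. (\<lambda>i. z i + c i) \<in> V} (\<lambda>z. f (\<lambda>i. z i + c i))"
    by (rule continuous_on_compose2[OF holomorphic_varsD(4)[OF f] continuous_on_shift]) blast
next
  fix z z' assume z: "z \<in> {z. (\<lambda>i. z i + c i) \<in> V}" and eq: "\<And>i. i \<in> J \<Longrightarrow> z' i = z i"
  then have zV: "(\<lambda>i. z i + c i) \<in> V" by simp
  have "(\<lambda>i. z' i + c i) \<in> V"
    by (rule holomorphic_varsD(2)[OF f zV]) (simp add: eq)
  then show "z' \<in> {z. (\<lambda>i. z i + c i) \<in> V}" by simp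
  show "f (\<lambda>i. z' i + c i) = f (\<lambda>i. z i + c i)"
    by (rule holomorphic_varsD(3)[OF f zV]) (simp add: eq)
next
  fix z i assume z: "z \<in> {z. (\<lambda>i. z i + c i) \<in> V}" and i: "i \<in> J"
  let ?a = "\<lambda>i. z i + c i"
  have "(\<lambda>t. f (?a(i := t))) field_differentiable at (?a i)"
    using z by (intro holomorphic_varsD(5)[OF f _ i]) simp
  then have "((\<lambda>t. f (?a(i := t))) \<circ> (\<lambda>t. t + c i)) field_differentiable at (z i)"
    by (intro field_differentiable_compose) (auto intro!: derivative_intros)
  moreover have "(\<lambda>t. f (?a(i := t))) \<circ> (\<lambda>t. t + c i) = (\<lambda>t. f (\<lambda>j. (z(i := t)) j + c j))"
    by (auto simp: fun_eq_iff intro!: arg_cong[of _ _ f])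
  ultimately show "(\<lambda>t. f (\<lambda>j. (z(i := t)) j + c j)) field_differentiable at (z i)" by simp
qed

text \<open>
  The expansion needs a bound for \<open>f\<close> near \<open>a\<close>; continuity at \<open>a\<close> provides \<open>\<bar>f a\<bar> + 1\<close>.
\<close>
lemma local_power_series:
  assumes finJ: "finite J" and f: "holomorphic_vars J V f" and a: "a \<in> V"
  obtains r c M where "0 < r" "polydisc J a r \<subseteq> V"
    "\<And>k. k \<in> exponents J \<Longrightarrow> cmod (c k) \<le> M / r ^ (\<Sum>i\<in>J. k i)"
    "\<And>z. z \<in> polydisc J a r \<Longrightarrow>
      ((\<lambda>k. c k * monomial J k (\<lambda>i. z i - a i)) has_sum f z) (exponents J)"
proof -
  define W where "W = V \<inter> f -` ball (f a) 1"
  have oW: "open W"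
    unfolding W_def by (rule continuous_open_preimage[OF holomorphic_varsD(4,1)[OF f] open_ball])
  have aW: "a \<in> W" using a by (simp add: W_def)
  have cylW: "z' \<in> W" if "z \<in> W" "\<And>i. i \<in> J \<Longrightarrow> z' i = z i" for z z'
  proof -
    have zV: "z \<in> V" using that(1) by (simp add: W_def)
    have "z' \<in> V" "f z' = f z"
      using holomorphic_varsD(2,3)[OF f zV that(2)] by simp_all
    then show ?thesis using that(1) by (simp add: W_def)
  qed
  obtain \<rho> where \<rho>: "0 < \<rho>" "polydisc J a \<rho> \<subseteq> W"
    by (rule polydisc_in_open[OF oW aW finJ cylW])
  define r where "r = \<rho> / 2"
  have r: "0 < r" "r < \<rho>" using \<rho> by (auto simp: r_def)
  let ?f = "\<lambda>z. f (\<lambda>i. z i + a i)"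
  have shift: "(\<lambda>i. z i + a i) \<in> W" if "\<forall>i\<in>J. cmod (z i) \<le> r" for z
  proof -
    have "(\<lambda>i. z i + a i) \<in> polydisc J a \<rho>"
      unfolding polydisc_def
    proof (intro CollectI ballI)
      fix i assume "i \<in> J"
      then show "cmod (z i + a i - a i) < \<rho>" using that r by force
    qed
    then show ?thesis using \<rho>(2) by blast
  qed
  have "\<exists>c. (\<forall>k\<in>exponents J. cmod (c k) \<le> (cmod (f a) + 1) / r ^ (\<Sum>i\<in>J. k i)) \<and>
     (\<forall>z\<in>polydisc J (\<lambda>_. 0) r. ((\<lambda>k. c k * monomial J k z) has_sum ?f z) (exponents J))"
  proof (rule power_series_expansion[OF finJ holomorphic_vars_shift[OF f] r(1)])
    show "{z. \<forall>i\<in>J. cmod (z i) \<le> r} \<subseteq> {z. (\<lambda>i. z i + a i) \<in> V}"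
      using shift by (auto simp: W_def)
    fix z assume "\<forall>i\<in>J. cmod (z i) \<le> r"
    then have "dist (f a) (?f z) < 1" using shift[of z] by (simp add: W_def)
    moreover have "cmod (?f z) \<le> cmod (f a) + dist (f a) (?f z)"
      by (metis dist_commute dist_norm norm_triangle_sub)
    ultimately show "cmod (?f z) \<le> cmod (f a) + 1" by linarith
  qed
  then obtain c where c: "\<And>k. k \<in> exponents J \<Longrightarrow> cmod (c k) \<le> (cmod (f a) + 1) / r ^ (\<Sum>i\<in>J. k i)"
    "\<And>z. z \<in> polydisc J (\<lambda>_. 0) r \<Longrightarrow> ((\<lambda>k. c k * monomial J k z) has_sum ?f z) (exponents J)"
    by blast
  show ?thesis
  proof (rule that[OF r(1) _ c(1)])
    show "polydisc J a r \<subseteq> V"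
      using \<rho>(2) r(2) by (force simp: W_def polydisc_def)
    fix z assume "z \<in> polydisc J a r"
    then have "(\<lambda>i. z i - a i) \<in> polydisc J (\<lambda>_. 0) r" by (simp add: polydisc_def)
    from c(2)[OF this] show "((\<lambda>k. c k * monomial J k (\<lambda>i. z i - a i)) has_sum f z) (exponents J)"
      by simp
  qed
qed

lemma continuous_on_line:
  fixes y d :: "nat \<Rightarrow> complex"
  shows "continuous_on X (\<lambda>s i. y i + s * d i)"
  by (rule continuous_on_coordinatewise_then_product) (intro continuous_intros)

lemma open_line_preimage:
  fixes y d :: "nat \<Rightarrow> complex"
  assumes "open V"
  shows "open {s. (\<lambda>i. y i + s * d i) \<in> V}"
  using open_vimage[OF assms continuous_on_line[of UNIV y d]] by (simp add: vimage_def)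

text \<open>
  An affine function of one variable may be substituted into the power series, because the convergence
  stays locally uniform.
\<close>
lemma holomorphic_on_line:
  assumes finJ: "finite J" and f: "holomorphic_vars J V f"
  shows "(\<lambda>s. f (\<lambda>i. y i + s * d i)) holomorphic_on {s. (\<lambda>i. y i + s * d i) \<in> V}"
proof -
  let ?L = "\<lambda>s i. y i + s * d i"
  have "\<exists>e>0. (\<lambda>s. f (?L s)) holomorphic_on ball s0 e" if s0: "?L s0 \<in> V" for s0
  proof -
    obtain r c M where r: "0 < r" and sub: "polydisc J (?L s0) r \<subseteq> V"
      and c: "\<And>k. k \<in> exponents J \<Longrightarrow> cmod (c k) \<le> M / r ^ (\<Sum>i\<in>J. k i)"
      and sums: "\<And>z. z \<in> polydisc J (?L s0) r \<Longrightarrow>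
        ((\<lambda>k. c k * monomial J k (\<lambda>i. z i - ?L s0 i)) has_sum f z) (exponents J)"
      by (rule local_power_series[OF finJ f s0]) blast
    define D where "D = 1 + (\<Sum>i\<in>J. cmod (d i))"
    have D: "0 < D" "cmod (d i) \<le> D" if "i \<in> J" for i
      using member_le_sum[OF that, of "\<lambda>i. cmod (d i)"] finJ sum_nonneg[of J "\<lambda>i. cmod (d i)"]
      by (auto simp: D_def)
    have D0: "0 < D" using sum_nonneg[of J "\<lambda>i. cmod (d i)"] by (simp add: D_def)
    define e where "e = r / (2 * D)"
    have e: "0 < e" using r D0 by (simp add: e_def)
    have small: "cmod ((s - s0) * d i) \<le> r / 2" if "s \<in> cball s0 e" "i \<in> J" for s i
    proof -
      have "cmod (s - s0) * cmod (d i) \<le> e * D"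
        using that D(2)[OF that(2)] e by (intro mult_mono) (auto simp: dist_norm norm_minus_commute)
      also have "\<dots> = r / 2" using D0 by (simp add: e_def)
      finally show ?thesis by (simp add: norm_mult)
    qed
    let ?g = "\<lambda>k s. c k * monomial J k (\<lambda>i. (s - s0) * d i)"
    have ul: "uniform_limit (cball s0 e) (\<lambda>X s. \<Sum>k\<in>X. ?g k s) (\<lambda>s. f (?L s)) (finite_subsets_at_top (exponents J))"
    proof (rule Weierstrass_m_test_general')
      fix k s assume k: "k \<in> exponents J" and s: "s \<in> cball s0 e"
      have "monomial J k (\<lambda>i. cmod ((s - s0) * d i)) \<le> monomial J k (\<lambda>i. r / 2)"
        unfolding monomial_def
        by (intro prod_mono conjI power_mono small[OF s]) auto
      then show "norm (?g k s) \<le> cmod (c k) * monomial J k (\<lambda>i. r / 2)"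
        by (simp add: norm_mult[of "c k"] norm_monomial mult_left_mono del: norm_mult)
    next
      fix s assume s: "s \<in> cball s0 e"
      have "?L s \<in> polydisc J (?L s0) r"
        unfolding polydisc_def
      proof (intro CollectI ballI)
        fix i assume "i \<in> J"
        from small[OF s this] r show "cmod (?L s i - ?L s0 i) < r"
          by (simp add: algebra_simps)
      qed
      from sums[OF this] show "((\<lambda>k. ?g k s) has_sum f (?L s)) (exponents J)"
        by (simp add: algebra_simps)
    next
      show "(\<lambda>k. cmod (c k) * monomial J k (\<lambda>i. r / 2)) summable_on exponents J"
        by (rule power_series_summable[OF finJ r c]) (use r in auto)
    qed
    have ev: "\<forall>\<^sub>F X in finite_subsets_at_top (exponents J).
        continuous_on (cball s0 e) (\<lambda>s. \<Sum>k\<in>X. ?g k s) \<and> (\<lambda>s. \<Sum>k\<in>X. ?g k s) holomorphic_on ball s0 e"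
      unfolding monomial_def
      by (intro always_eventually allI conjI continuous_intros holomorphic_intros)
    have "(\<lambda>s. f (?L s)) holomorphic_on ball s0 e"
      by (rule holomorphic_uniform_limit[OF ev ul]) (simp_all add: finite_subsets_at_top_neq_bot)
    then show ?thesis using e by blast
  qed
  then have "\<exists>e>0. (\<lambda>s. f (?L s)) holomorphic_on ball s0 e" if "s0 \<in> {s. ?L s \<in> V}" for s0
    using that by simp
  then have "(\<lambda>s. f (?L s)) analytic_on {s. ?L s \<in> V}"
    unfolding analytic_on_def by blast
  then show ?thesis by (rule analytic_imp_holomorphic)
qed

text \<open>
  Join a point of \<open>O'\<close> to \<open>z\<close> by a complex line. The line meets the polydisc in a convex set, to which
  analytic continuation in one variable applies.
\<close>
lemma identity_theorem:
  assumes finJ: "finite J" and f: "holomorphic_vars J (polydisc J a r) f"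
    and O: "open O'" "O' \<subseteq> polydisc J a r" "O' \<noteq> {}" "\<And>z. z \<in> O' \<Longrightarrow> f z = 0"
    and z: "z \<in> polydisc J a r"
  shows "f z = 0"
proof -
  obtain y where y: "y \<in> O'" using O(3) by blast
  have yP: "y \<in> polydisc J a r" using y O(2) by blast
  let ?L = "\<lambda>s i. y i + s * (z i - y i)"
  define S where "S = {s. ?L s \<in> polydisc J a r}"
  have oS: "open S"
    unfolding S_def by (rule open_line_preimage[OF open_polydisc[OF finJ]])
  have "convex S"
  proof (rule convexI)
    fix s t :: complex and u v :: real
    assume s: "s \<in> S" and t: "t \<in> S" and uv: "0 \<le> u" "0 \<le> v" "u + v = 1"
    show "u *\<^sub>R s + v *\<^sub>R t \<in> S"
      unfolding S_def polydisc_def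
    proof (intro CollectI ballI)
      fix i assume i: "i \<in> J"
      let ?A = "?L s i - a i" and ?B = "?L t i - a i"
      have lt: "?A \<in> ball 0 r" "?B \<in> ball 0 r" using s t i by (auto simp: S_def polydisc_def)
      have one: "complex_of_real u + complex_of_real v = 1" using uv(3) by (metis of_real_1 of_real_add)
      then have u: "complex_of_real u = 1 - complex_of_real v" by (simp add: eq_diff_eq)
      have "u *\<^sub>R ?A + v *\<^sub>R ?B = ?L (u *\<^sub>R s + v *\<^sub>R t) i - a i"
        unfolding scaleR_conv_of_real u by (simp add: algebra_simps)
      moreover have "u *\<^sub>R ?A + v *\<^sub>R ?B \<in> ball 0 r"
        by (rule convexD[OF convex_ball lt uv])
      ultimately show "cmod (?L (u *\<^sub>R s + v *\<^sub>R t) i - a i) < r" by simp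
    qed
  qed
  then have conS: "connected S" by (rule convex_connected)
  define U where "U = {s. ?L s \<in> O'}"
  have oU: "open U" unfolding U_def by (rule open_line_preimage[OF O(1)])
  have U0: "0 \<in> U" using y by (simp add: U_def)
  have "f (?L 1) = 0"
  proof (rule analytic_continuation[of "\<lambda>s. f (?L s)" S U 0 1])
    show "(\<lambda>s. f (?L s)) holomorphic_on S"
      unfolding S_def by (rule holomorphic_on_line[OF finJ f])
    show "U \<subseteq> S" using O(2) by (auto simp: U_def S_def)
    show "0 \<in> S" using yP by (simp add: S_def)
    show "0 islimpt U" using U0 oU interior_limit_point interior_open by metis
    show "1 \<in> S" using z by (simp add: S_def)
    show "f (?L s) = 0" if "s \<in> U" for s using that O(4) by (simp add: U_def)
  qed (use oS conS in auto)
  then show ?thesis by simp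
qed

lemma dense_nonzero:
  assumes finJ: "finite J" and f: "holomorphic_vars J (polydisc J a r) f"
    and y: "y \<in> polydisc J a r" "f y \<noteq> 0"
    and O: "open O'" "O' \<subseteq> polydisc J a r" "O' \<noteq> {}"
  obtains z where "z \<in> O'" "f z \<noteq> 0"
  using identity_theorem[OF finJ f O _ y(1)] y(2) by blast

section \<open>Dense sets and generic points\<close>

lemma denseI:
  assumes "open P" "\<And>O'. open O' \<Longrightarrow> O' \<subseteq> P \<Longrightarrow> O' \<noteq> {} \<Longrightarrow> \<exists>x\<in>O'. x \<in> T"
  shows "P \<subseteq> closure T"
proof
  fix x assume x: "x \<in> P"
  show "x \<in> closure T"
    unfolding closure_iff_nhds_not_empty
  proof (intro allI impI)
    fix A U assume "U \<subseteq> A" "open U" "x \<in> U"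
    then obtain w where "w \<in> U \<inter> P" "w \<in> T"
      using assms(2)[of "U \<inter> P"] x assms(1) by blast
    then show "T \<inter> A \<noteq> {}" using \<open>U \<subseteq> A\<close> by blast
  qed
qed

lemma denseD:
  assumes "P \<subseteq> closure T" "open O'" "O' \<subseteq> P" "O' \<noteq> {}"
  shows "\<exists>x\<in>O'. x \<in> T"
  using open_Int_closure_eq_empty[OF assms(2), of T] assms by blast

text \<open>
  Adding the exterior of \<open>P\<close> to every member of the family makes it dense in the whole space.
\<close>
lemma Baire_open:
  fixes P :: "'a::complete_space set"
  assumes P: "open P" "P \<noteq> {}" and T: "countable \<T>" "\<And>T. T \<in> \<T> \<Longrightarrow> open T" "\<And>T. T \<in> \<T> \<Longrightarrow> P \<subseteq> closure T"
  shows "P \<inter> \<Inter>\<T> \<noteq> {}"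
proof -
  let ?G = "(\<lambda>T. T \<union> - closure P) ` \<T>"
  have "(euclidean :: 'a topology) closure_of \<Inter>?G = topspace euclidean"
  proof (rule Baire_category)
    fix G assume "G \<in> ?G"
    then obtain T where G: "G = T \<union> - closure P" "T \<in> \<T>" by blast
    have "UNIV \<subseteq> closure G"
    proof (rule denseI)
      fix O' :: "'a set" assume O: "open O'" "O' \<noteq> {}"
      show "\<exists>x\<in>O'. x \<in> G"
      proof (cases "O' \<inter> P = {}")
        case True
        then have "O' \<inter> closure P = {}" using open_Int_closure_eq_empty[OF O(1)] by blast
        then show ?thesis using O(2) G(1) by blast
      next
        case False
        then have "\<exists>x\<in>O' \<inter> P. x \<in> T"
          using O(1) P(1) by (intro denseD[OF T(3)[OF G(2)]]) auto
        then show ?thesis using G(1) by blast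
      qed
    qed simp
    moreover have "open G" unfolding G(1) by (intro open_Un T(2) G(2) open_Compl closed_closure)
    ultimately show "openin euclidean G \<and> euclidean closure_of G = topspace euclidean"
      by (simp add: top.extremum_unique)
  qed (use T(1) completely_metrizable_space_euclidean in auto)
  then have "UNIV \<subseteq> closure (\<Inter>?G)" by simp
  from denseD[OF this P(1) _ P(2)] obtain x where "x \<in> P" "x \<in> \<Inter>?G" by blast
  moreover have "x \<notin> - closure P" using \<open>x \<in> P\<close> closure_subset by blast
  ultimately show ?thesis by blast
qed

lemma dense_vimage:
  fixes \<phi> :: "'a::topological_space \<Rightarrow> 'b::topological_space"
  assumes W: "UNIV \<subseteq> closure W" and \<psi>: "continuous_on UNIV \<psi>"
    and inv: "\<And>x. \<psi> (\<phi> x) = x" "\<And>w. \<phi> (\<psi> w) = w"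
  shows "UNIV \<subseteq> closure (\<phi> -` W)"
proof (rule denseI)
  fix O' :: "'a set" assume O: "open O'" "O' \<noteq> {}"
  obtain x where x: "x \<in> O'" using O(2) by blast
  have "\<exists>w\<in>\<psi> -` O'. w \<in> W"
  proof (rule denseD[OF W])
    show "open (\<psi> -` O')" by (rule open_vimage[OF O(1) \<psi>])
    have "\<phi> x \<in> \<psi> -` O'" using inv(1)[of x] x by simp
    then show "\<psi> -` O' \<noteq> {}" by blast
  qed simp
  then obtain w where "\<psi> w \<in> O'" "w \<in> W" by blast
  then show "\<exists>x\<in>O'. x \<in> \<phi> -` W" using inv(2)[of w] by (intro bexI[of _ "\<psi> w"]) auto
qed simp

lemma infinite_Diff_singleton_ne: "infinite A \<Longrightarrow> A - {c} \<noteq> {}"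
  using finite_subset[of A "{c}"] by blast

lemma dense_avoid_coordinate:
  fixes T :: "(nat \<Rightarrow> complex) set"
  assumes "\<And>y. \<exists>c. \<forall>t. t \<noteq> c \<longrightarrow> y(i := t) \<in> T"
  shows "UNIV \<subseteq> closure T"
proof (rule denseI)
  fix O' :: "(nat \<Rightarrow> complex) set" assume O: "open O'" "O' \<noteq> {}"
  obtain y where y: "y \<in> O'" using O(2) by blast
  obtain c where c: "\<And>t. t \<noteq> c \<Longrightarrow> y(i := t) \<in> T" using assms by blast
  have "open ((\<lambda>t. y(i := t)) -` O')"
    by (rule open_vimage[OF O(1) continuous_on_fun_upd[OF continuous_on_id]])
  moreover have "y i \<in> (\<lambda>t. y(i := t)) -` O'" using y by simp
  ultimately have "infinite ((\<lambda>t. y(i := t)) -` O')"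
    using finite_imp_not_open by blast
  then have "(\<lambda>t. y(i := t)) -` O' - {c} \<noteq> {}"
    by (rule infinite_Diff_singleton_ne)
  then obtain t where "t \<noteq> c" "y(i := t) \<in> O'" by auto
  then show "\<exists>x\<in>O'. x \<in> T" using c by blast
qed simp

lemma continuous_on_line2:
  fixes d :: "nat \<Rightarrow> complex"
  shows "continuous_on X (\<lambda>p :: (nat \<Rightarrow> complex) \<times> complex. \<lambda>i. fst p i + snd p * d i)"
proof (rule continuous_on_coordinatewise_then_product)
  fix i
  have "continuous_on X (\<lambda>p :: (nat \<Rightarrow> complex) \<times> complex. (fst p) i)"
    by (rule continuous_on_product_then_coordinatewise) (rule continuous_on_fst[OF continuous_on_id])
  moreover have "continuous_on X (\<lambda>p :: (nat \<Rightarrow> complex) \<times> complex. snd p * d i)"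
    by (rule continuous_on_mult[OF continuous_on_snd[OF continuous_on_id] continuous_on_const])
  ultimately show "continuous_on X (\<lambda>p :: (nat \<Rightarrow> complex) \<times> complex. fst p i + snd p * d i)"
    by (rule continuous_on_add)
qed

lemma continuous_eq_on_dense:
  fixes f g :: "'a::topological_space \<Rightarrow> complex"
  assumes "open U" "continuous_on U f" "continuous_on U g" "U \<subseteq> closure S"
    "\<And>x. x \<in> U \<Longrightarrow> x \<in> S \<Longrightarrow> f x = g x" "x \<in> U"
  shows "f x = g x"
proof (rule ccontr)
  assume ne: "f x \<noteq> g x"
  define N where "N = U \<inter> (\<lambda>x. f x - g x) -` (- {0})"
  have "open N" unfolding N_def
    by (rule continuous_open_preimage) (use assms in \<open>auto intro: continuous_on_diff\<close>)
  moreover have "x \<in> N \<inter> closure S" using ne assms(4,6) by (auto simp: N_def)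
  ultimately have "N \<inter> S \<noteq> {}" using open_Int_closure_eq_empty[of N S] by blast
  then obtain y where "y \<in> N" "y \<in> S" by blast
  then show False using assms(5) by (auto simp: N_def)
qed

lemma countable_dense_complex:
  "\<exists>Q :: complex set. countable Q \<and> (\<forall>O'. open O' \<longrightarrow> O' \<noteq> {} \<longrightarrow> (\<exists>s\<in>Q. s \<in> O'))"
  by (rule countable_dense_exists)

lemma finite_exceptions_imp_dense:
  fixes F :: "complex set"
  assumes "finite F"
  shows "U \<subseteq> closure (- F)"
proof -
  have "UNIV \<subseteq> closure (- F)"
  proof (rule denseI)
    fix O' :: "complex set" assume O: "open O'" "O' \<noteq> {}"
    then have "infinite O'" using finite_imp_not_open by blast
    then have "\<not> O' \<subseteq> F" using assms finite_subset by blast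
    then show "\<exists>x\<in>O'. x \<in> - F" by blast
  qed simp
  then show ?thesis by blast
qed

section \<open>Clearing the poles of a function of one variable\<close>

text \<open>
  Near \<open>s0\<close> the denominator is a power of \<open>s - s0\<close> times a function without zeros.
\<close>
lemma local_pole_clearing:
  fixes \<phi> :: "complex \<Rightarrow> complex"
  assumes "0 < \<delta>" and a: "a holomorphic_on ball s0 \<delta>" and b: "b holomorphic_on ball s0 \<delta>"
    and nz: "s1 \<in> ball s0 \<delta>" "b s1 \<noteq> 0"
    and eq: "\<And>s. s \<in> S \<Longrightarrow> s \<in> ball s0 \<delta> \<Longrightarrow> \<phi> s * b s = a s"
  shows "\<exists>e>0. \<exists>k \<psi>. \<psi> holomorphic_on ball s0 e \<and> (\<forall>s\<in>S \<inter> ball s0 e. (s - s0) ^ k * \<phi> s = \<psi> s)"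
proof -
  have "\<exists>e k g. 0 < e \<and> e \<le> \<delta> \<and> g holomorphic_on ball s0 e \<and>
    (\<forall>s\<in>ball s0 e. g s \<noteq> 0 \<and> b s = (s - s0) ^ k * g s)"
  proof (cases "b s0 = 0")
    case True
    have nc: "\<not> b constant_on ball s0 \<delta>"
    proof
      assume "b constant_on ball s0 \<delta>"
      then have "b s1 = b s0" using nz(1) \<open>0 < \<delta>\<close> by (auto simp: constant_on_def)
      then show False using nz(2) True by simp
    qed
    obtain g e n where "0 < n" "0 < e" "ball s0 e \<subseteq> ball s0 \<delta>" "g holomorphic_on ball s0 e"
      "\<And>w. w \<in> ball s0 e \<Longrightarrow> b w = (w - s0) ^ n * g w" "\<And>w. w \<in> ball s0 e \<Longrightarrow> g w \<noteq> 0"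
      by (rule holomorphic_factor_zero_nonconstant[OF b open_ball connected_ball _ True nc])
        (use \<open>0 < \<delta>\<close> in auto)
    then show ?thesis
      by (intro exI[of _ e] exI[of _ n] exI[of _ g]) (auto simp: ball_subset_ball_iff)
  next
    case False
    have "continuous_on (ball s0 \<delta>) b" using b by (rule holomorphic_on_imp_continuous_on)
    then have "open (ball s0 \<delta> \<inter> b -` (- {0}))"
      by (rule continuous_open_preimage) auto
    moreover have "s0 \<in> ball s0 \<delta> \<inter> b -` (- {0})" using False \<open>0 < \<delta>\<close> by auto
    ultimately obtain e where "0 < e" "ball s0 e \<subseteq> ball s0 \<delta> \<inter> b -` (- {0})"
      unfolding open_contains_ball by blast
    then show ?thesis
      using holomorphic_on_subset[OF b, of "ball s0 e"]
      by (intro exI[of _ e] exI[of _ 0] exI[of _ b]) (auto simp: ball_subset_ball_iff)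
  qed
  then obtain e k g where e: "0 < e" "e \<le> \<delta>" and g: "g holomorphic_on ball s0 e"
    "\<And>s. s \<in> ball s0 e \<Longrightarrow> g s \<noteq> 0" "\<And>s. s \<in> ball s0 e \<Longrightarrow> b s = (s - s0) ^ k * g s" by blast
  have sub: "ball s0 e \<subseteq> ball s0 \<delta>" using e(2) by (rule subset_ball)
  have "(\<lambda>s. a s / g s) holomorphic_on ball s0 e"
    using holomorphic_on_subset[OF a sub] g by (intro holomorphic_on_divide) auto
  moreover have "(s - s0) ^ k * \<phi> s = a s / g s" if "s \<in> S \<inter> ball s0 e" for s
    using eq[of s] g(2,3)[of s] sub that by (auto simp: field_simps)
  ultimately show ?thesis using e(1) by blast
qed

text \<open>
  The function \<open>\<phi>\<close> matters on the dense set \<open>S\<close> only. By compactness finitely many of the local powers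
  \<open>(s - x) ^ k x\<close> suffice. The local extensions of \<open>P \<phi>\<close> agree on overlaps, because they are
  continuous and agree on \<open>S\<close>.
\<close>
lemma pole_clearing_polynomial:
  fixes \<phi> :: "complex \<Rightarrow> complex"
  assumes dense: "closure S = UNIV"
    and loc: "\<And>s0. s0 \<in> cball 0 r \<Longrightarrow> \<exists>\<delta>>0. \<exists>a b. a holomorphic_on ball s0 \<delta> \<and> b holomorphic_on ball s0 \<delta>
      \<and> (\<exists>s\<in>ball s0 \<delta>. b s \<noteq> 0) \<and> (\<forall>s\<in>S \<inter> ball s0 \<delta>. \<phi> s * b s = a s)"
  obtains P :: "complex poly" and \<Phi> \<Omega> where "P \<noteq> 0" "open \<Omega>" "cball 0 r \<subseteq> \<Omega>" "\<Phi> holomorphic_on \<Omega>"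
    "\<And>s. s \<in> S \<Longrightarrow> s \<in> \<Omega> \<Longrightarrow> \<Phi> s = poly P s * \<phi> s"
proof -
  have "\<exists>e>0. \<exists>k \<psi>. \<psi> holomorphic_on ball x e \<and> (\<forall>s\<in>S \<inter> ball x e. (s - x) ^ k * \<phi> s = \<psi> s)"
    if "x \<in> cball 0 r" for x
    using loc[OF that] local_pole_clearing[of _ _ x _ _ S \<phi>] by blast
  then obtain e k \<psi> where e: "\<And>x. x \<in> cball 0 r \<Longrightarrow> 0 < e x"
    and hol: "\<And>x. x \<in> cball 0 r \<Longrightarrow> \<psi> x holomorphic_on ball x (e x)"
    and eq: "\<And>x s. x \<in> cball 0 r \<Longrightarrow> s \<in> S \<Longrightarrow> s \<in> ball x (e x) \<Longrightarrow> (s - x) ^ k x * \<phi> s = \<psi> x s"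
    by (metis IntI)
  have "cball 0 r \<subseteq> (\<Union>x\<in>cball 0 r. ball x (e x))" using e by force
  then obtain F where F: "F \<subseteq> cball 0 r" "finite F" "cball 0 r \<subseteq> (\<Union>x\<in>F. ball x (e x))"
    using compactE_image[OF compact_cball[of 0 r], of "cball 0 r" "\<lambda>x. ball x (e x)"] by auto
  define P where "P = (\<Prod>x\<in>F. pCons (- x) 1 ^ k x)"
  define \<kappa> where "\<kappa> x s = (\<Prod>y\<in>F - {x}. (s - y) ^ k y) * \<psi> x s" for x s
  define \<Omega> where "\<Omega> = (\<Union>x\<in>F. ball x (e x))"
  define \<Phi> where "\<Phi> s = \<kappa> (SOME x. x \<in> F \<and> s \<in> ball x (e x)) s" for s
  have P0: "P \<noteq> 0" using F(2) by (auto simp: P_def)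
  have holchi: "\<kappa> x holomorphic_on ball x (e x)" if "x \<in> F" for x
    unfolding \<kappa>_def[abs_def] using hol that F(1) by (intro holomorphic_intros) auto
  have chi: "\<kappa> x s = poly P s * \<phi> s" if "x \<in> F" "s \<in> S" "s \<in> ball x (e x)" for x s
  proof -
    have "poly P s = (s - x) ^ k x * (\<Prod>y\<in>F - {x}. (s - y) ^ k y)"
      using F(2) that(1) by (simp add: P_def poly_prod prod.remove)
    moreover have "(s - x) ^ k x * \<phi> s = \<psi> x s"
      using eq that F(1) by blast
    ultimately show ?thesis by (simp add: \<kappa>_def mult_ac flip: \<open>(s - x) ^ k x * \<phi> s = \<psi> x s\<close>)
  qed
  have same: "\<kappa> x s = \<kappa> y s" if "x \<in> F" "y \<in> F" "s \<in> ball x (e x) \<inter> ball y (e y)" for x y s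
  proof (rule continuous_eq_on_dense[where f = "\<kappa> x" and g = "\<kappa> y" and U = "ball x (e x) \<inter> ball y (e y)" and S = S])
    show "continuous_on (ball x (e x) \<inter> ball y (e y)) (\<kappa> x)"
      by (rule continuous_on_subset[OF holomorphic_on_imp_continuous_on[OF holchi[OF that(1)]]]) blast
    show "continuous_on (ball x (e x) \<inter> ball y (e y)) (\<kappa> y)"
      by (rule continuous_on_subset[OF holomorphic_on_imp_continuous_on[OF holchi[OF that(2)]]]) blast
  qed (use that dense chi in auto)
  have Phi: "\<Phi> s = \<kappa> x s" if "x \<in> F" "s \<in> ball x (e x)" for x s
  proof -
    have "(SOME x. x \<in> F \<and> s \<in> ball x (e x)) \<in> F \<and> s \<in> ball (SOME x. x \<in> F \<and> s \<in> ball x (e x)) (e (SOME x. x \<in> F \<and> s \<in> ball x (e x)))"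
      by (rule someI[of "\<lambda>x. x \<in> F \<and> s \<in> ball x (e x)"]) (use that in blast)
    then show ?thesis unfolding \<Phi>_def using that by (intro same) auto
  qed
  show ?thesis
  proof (rule that[OF P0])
    show "open \<Omega>" "cball 0 r \<subseteq> \<Omega>" using F(3) by (auto simp: \<Omega>_def)
    show "\<Phi> holomorphic_on \<Omega>"
      unfolding \<Omega>_def
    proof (rule holomorphic_on_UN_open)
      show "\<Phi> holomorphic_on ball x (e x)" if "x \<in> F" for x
        using holomorphic_transform[OF holchi[OF that]] Phi[OF that] by metis
    qed auto
    show "\<Phi> s = poly P s * \<phi> s" if "s \<in> S" "s \<in> \<Omega>" for s
      using that Phi chi by (auto simp: \<Omega>_def)
  qed
qed

lemma moments_imp_polynomial_integral:
  assumes r: "0 < r" and cont: "continuous_on (sphere 0 r) u"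
    and mom: "\<And>n. contour_integral (circlepath 0 r) (\<lambda>s. u s * s ^ n) = 0"
  shows "contour_integral (circlepath 0 r) (\<lambda>s. u s * poly p s) = 0"
proof -
  have pim: "path_image (circlepath 0 r) = sphere 0 r" using r by simp
  have int: "(\<lambda>s. coeff p i * (u s * s ^ i)) contour_integrable_on circlepath 0 r" for i
    by (rule contour_integrable_continuous_circlepath) (use pim cont in \<open>auto intro!: continuous_intros\<close>)
  have int': "(\<lambda>s. u s * s ^ i) contour_integrable_on circlepath 0 r" for i
    by (rule contour_integrable_continuous_circlepath) (use pim cont in \<open>auto intro!: continuous_intros\<close>)
  have "contour_integral (circlepath 0 r) (\<lambda>s. u s * poly p s)
      = contour_integral (circlepath 0 r) (\<lambda>s. \<Sum>i\<le>degree p. coeff p i * (u s * s ^ i))"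
    by (simp add: poly_altdef sum_distrib_left mult_ac)
  also have "\<dots> = (\<Sum>i\<le>degree p. contour_integral (circlepath 0 r) (\<lambda>s. coeff p i * (u s * s ^ i)))"
    by (rule contour_integral_sum) (use int in auto)
  also have "\<dots> = 0"
    by (rule sum.neutral) (simp add: contour_integral_lmul[OF int'] mom)
  finally show ?thesis .
qed

text \<open>
  A polynomial \<open>R\<close> for which all moments of \<open>R \<phi>\<close> vanish clears the poles of \<open>\<phi>\<close> in the disc, as soon
  as some nonzero polynomial \<open>p\<close> does. Indeed, in Cauchy's formula for \<open>p R \<phi>\<close> at \<open>w\<close> the factor
  \<open>p s\<close> can be written as \<open>p w + (s - w) p1 s\<close>. The part with \<open>p1\<close> integrates to zero by the vanishing
  of the moments, and what remains is \<open>p w\<close> times Cauchy's formula for \<open>R \<phi>\<close>. The zeros of \<open>p\<close> are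
  reached by continuity.
\<close>
lemma cleared_quotient_Cauchy:
  fixes \<phi> :: "complex \<Rightarrow> complex" and p R :: "complex poly"
  assumes r: "0 < r" and S: "open S" "closure S = UNIV" "sphere 0 r \<subseteq> S" and \<phi>: "continuous_on S \<phi>"
    and p: "p \<noteq> 0" and \<Omega>: "open \<Omega>" "cball 0 r \<subseteq> \<Omega>" "\<Phi> holomorphic_on \<Omega>"
    and eq: "\<And>s. s \<in> S \<Longrightarrow> s \<in> \<Omega> \<Longrightarrow> \<Phi> s = poly p s * \<phi> s"
    and mom: "\<And>n. contour_integral (circlepath 0 r) (\<lambda>s. poly R s * \<phi> s * s ^ n) = 0"
    and s0: "s0 \<in> ball 0 r" "s0 \<in> S"
  shows "poly R s0 * \<phi> s0 = contour_integral (circlepath 0 r) (\<lambda>s. poly R s * \<phi> s / (s - s0)) / (2 * pi * \<i>)"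
proof -
  have pim: "path_image (circlepath 0 r) = sphere 0 r" using r by simp
  let ?u = "\<lambda>s. poly R s * \<phi> s"
  let ?G = "\<lambda>w. contour_integral (circlepath 0 r) (\<lambda>s. ?u s / (s - w))"
  have contu: "continuous_on (sphere 0 r) ?u"
    using continuous_on_subset[OF \<phi> S(3)] by (intro continuous_intros)
  have ne: "s \<noteq> w" if "s \<in> sphere 0 r" "w \<in> ball 0 r" for s w :: complex using that by auto
  have contG: "continuous_on (ball 0 r) ?G"
  proof (rule continuous_on_circle_integral)
    have "continuous_on (ball 0 r \<times> sphere 0 r) (\<lambda>q. ?u (snd q) / (snd q - fst q))"
    proof (intro continuous_on_divide continuous_on_diff continuous_on_snd continuous_on_fst continuous_on_id)
      show "continuous_on (ball 0 r \<times> sphere 0 r) (\<lambda>q. ?u (snd q))"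
        by (rule continuous_on_compose2[OF contu continuous_on_snd[OF continuous_on_id]]) auto
    qed auto
    then show "continuous_on (ball 0 r \<times> sphere 0 r) (\<lambda>(w, s). ?u s / (s - w))"
      by (simp add: case_prod_beta)
  qed (use r in simp)
  have main: "?u w = ?G w / (2 * pi * \<i>)" if w: "w \<in> ball 0 r \<inter> S" and pw: "poly p w \<noteq> 0" for w
  proof -
    define p1 where "p1 = synthetic_div p w"
    have psplit: "poly p s = poly p w + (s - w) * poly p1 s" for s
    proof -
      have "poly (p + smult w p1) s = poly (pCons (poly p w) p1) s"
        unfolding p1_def synthetic_div_correct ..
      then show ?thesis by (simp add: algebra_simps)
    qed
    have "(\<lambda>s. poly R s * \<Phi> s) holomorphic_on cball 0 r"
      using holomorphic_on_subset[OF \<Omega>(3,2)] by (intro holomorphic_intros) auto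
    then have "((\<lambda>s. (poly R s * \<Phi> s) / (s - w)) has_contour_integral (2 * of_real pi * \<i> * (poly R w * \<Phi> w)))
       (circlepath 0 r)"
      by (rule Cauchy_integral_circlepath_simple) (use w in auto)
    then have A: "contour_integral (circlepath 0 r) (\<lambda>s. (poly R s * \<Phi> s) / (s - w)) = 2 * of_real pi * \<i> * (poly R w * \<Phi> w)"
      by (rule contour_integral_unique)
    have int1: "(\<lambda>s. ?u s / (s - w)) contour_integrable_on circlepath 0 r"
      by (rule contour_integrable_continuous_circlepath)
        (use pim contu ne w in \<open>auto intro!: continuous_intros\<close>)
    have int2: "(\<lambda>s. ?u s * poly p1 s) contour_integrable_on circlepath 0 r"
      by (rule contour_integrable_continuous_circlepath) (use pim contu in \<open>auto intro!: continuous_intros\<close>)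
    have "contour_integral (circlepath 0 r) (\<lambda>s. (poly R s * \<Phi> s) / (s - w))
        = contour_integral (circlepath 0 r) (\<lambda>s. poly p w * (?u s / (s - w)) + ?u s * poly p1 s)"
    proof (rule contour_integral_cong[OF refl])
      fix s assume "s \<in> path_image (circlepath 0 r)"
      then have s: "s \<in> sphere 0 r" using pim by blast
      have "s \<in> S" "s \<in> \<Omega>" using s S(3) \<Omega>(2) by auto
      then have eqs: "\<Phi> s = (poly p w + (s - w) * poly p1 s) * \<phi> s" using eq psplit by metis
      show "(poly R s * \<Phi> s) / (s - w) = poly p w * (?u s / (s - w)) + ?u s * poly p1 s"
        unfolding eqs using ne[OF s, of w] w by (simp add: field_simps)
    qed
    also have "\<dots> = poly p w * ?G w + contour_integral (circlepath 0 r) (\<lambda>s. ?u s * poly p1 s)"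
      by (simp only: contour_integral_add[OF contour_integrable_lmul[OF int1] int2] contour_integral_lmul[OF int1])
    also have "\<dots> = poly p w * ?G w"
      using moments_imp_polynomial_integral[OF r contu mom] by simp
    finally have "poly p w * ?G w = 2 * of_real pi * \<i> * (poly R w * \<Phi> w)" using A by simp
    moreover have "\<Phi> w = poly p w * \<phi> w"
    proof (rule eq)
      show "w \<in> \<Omega>" using w \<Omega>(2) ball_subset_cball[of 0 r] by blast
    qed (use w in blast)
    ultimately show ?thesis using pw by (simp add: field_simps)
  qed
  show ?thesis
  proof (rule continuous_eq_on_dense[where U = "ball 0 r \<inter> S" and S = "- {s. poly p s = 0}"
        and f = ?u and g = "\<lambda>w. ?G w / (2 * pi * \<i>)"])
    show "open (ball 0 r \<inter> S)" using S(1) by auto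
    show "continuous_on (ball 0 r \<inter> S) ?u"
      using continuous_on_subset[OF \<phi>, of "ball 0 r \<inter> S"] by (auto intro!: continuous_intros)
    show "continuous_on (ball 0 r \<inter> S) (\<lambda>w. ?G w / (2 * pi * \<i>))"
      by (intro continuous_on_divide continuous_on_const continuous_on_subset[OF contG]) auto
    show "ball 0 r \<inter> S \<subseteq> closure (- {s. poly p s = 0})"
      by (rule finite_exceptions_imp_dense[OF poly_roots_finite[OF p]])
  qed (use main s0 in auto)
qed

section \<open>Linear relations over the ring of holomorphic functions\<close>

lemma open_nonzero_set:
  assumes "holomorphic_vars J V f"
  shows "open {y \<in> V. f y \<noteq> 0}"
proof -
  have "{y \<in> V. f y \<noteq> 0} = V \<inter> f -` (- {0})" by auto
  then show ?thesis
    using continuous_open_preimage[OF holomorphic_varsD(4,1)[OF assms] open_delete[OF open_UNIV], of 0]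
    by (simp add: Compl_eq_Diff_UNIV)
qed

lemma product_not_identically_zero:
  assumes "finite J" "holomorphic_vars J (polydisc J a r) f" "holomorphic_vars J (polydisc J a r) g"
    "\<exists>y\<in>polydisc J a r. f y \<noteq> 0" "\<exists>y\<in>polydisc J a r. g y \<noteq> 0"
  shows "\<exists>y\<in>polydisc J a r. f y * g y \<noteq> 0"
proof -
  obtain y where y: "y \<in> polydisc J a r" "f y \<noteq> 0" using assms(4) by blast
  obtain z where "z \<in> {y \<in> polydisc J a r. g y \<noteq> 0}" "f z \<noteq> 0"
    by (rule dense_nonzero[OF assms(1,2) y open_nonzero_set[OF assms(3)]]) (use assms(5) in auto)
  then show ?thesis by auto
qed

text \<open>
  Gaussian elimination over the ring of holomorphic functions on a polydisc, which is an integral domain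
  by the identity theorem. The matrix has \<open>N\<close> columns and infinitely many rows. Either its columns are
  linearly dependent over the ring, or they are linearly independent at every point where some nonzero
  function \<open>\<theta>\<close> does not vanish; \<open>\<theta>\<close> is the product of the pivots.
\<close>
lemma linear_relation_or_nonvanishing_minor:
  fixes v :: "nat \<Rightarrow> nat \<Rightarrow> (nat \<Rightarrow> complex) \<Rightarrow> complex"
  assumes finJ: "finite J" and r: "0 < r"
    and hol: "\<And>n i. i < N \<Longrightarrow> holomorphic_vars J (polydisc J a r) (v n i)"
  shows "(\<exists>q. (\<forall>i<N. holomorphic_vars J (polydisc J a r) (q i)) \<and> (\<exists>i<N. \<exists>y\<in>polydisc J a r. q i y \<noteq> 0)
           \<and> (\<forall>n. \<forall>y\<in>polydisc J a r. (\<Sum>i<N. q i y * v n i y) = 0)) \<or>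
    (\<exists>\<theta>. holomorphic_vars J (polydisc J a r) \<theta> \<and> (\<exists>y\<in>polydisc J a r. \<theta> y \<noteq> 0)
       \<and> (\<forall>y\<in>polydisc J a r. \<theta> y \<noteq> 0 \<longrightarrow> (\<forall>x. (\<forall>n. (\<Sum>i<N. x i * v n i y) = 0) \<longrightarrow> (\<forall>i<N. x i = 0))))"
  using hol
proof (induction N arbitrary: v)
  case 0
  have "holomorphic_vars J (polydisc J a r) (\<lambda>_. 1)"
    by (rule holomorphic_vars_const[OF open_polydisc[OF finJ]]) (rule polydisc_cylinder)
  then show ?case using centre_in_polydisc[OF r, of a J] by (intro disjI2 exI[of _ "\<lambda>_. 1"]) auto
next
  case (Suc N)
  let ?P = "polydisc J a r"
  have const: "holomorphic_vars J ?P (\<lambda>_. c)" for c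
    by (rule holomorphic_vars_const[OF open_polydisc[OF finJ]]) (rule polydisc_cylinder)
  show ?case
  proof (cases "\<forall>n. \<forall>y\<in>?P. v n N y = 0")
    case True
    define q where "q i = (\<lambda>_ :: nat \<Rightarrow> complex. if i = N then 1 else 0 :: complex)" for i :: nat
    have "holomorphic_vars J ?P (q i)" for i unfolding q_def by (rule const)
    moreover have "(\<Sum>i<Suc N. q i y * v n i y) = 0" if "y \<in> ?P" for n y
      using True that by (simp add: q_def)
    moreover have "q N a \<noteq> 0" by (simp add: q_def)
    ultimately show ?thesis
      using centre_in_polydisc[OF r, of a J] by (intro disjI1 exI[of _ q]) blast
  next
    case False
    then obtain n0 where p0: "\<exists>y\<in>?P. v n0 N y \<noteq> 0" by blast
    let ?p = "v n0 N"
    have hp: "holomorphic_vars J ?P ?p" using Suc.prems by simp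
    \<comment> \<open>the entries after elimination of the last column with the pivot \<open>v n0 N\<close>\<close>
    define u where "u n i y = ?p y * v n i y - v n N y * v n0 i y" for n i y
    have hu: "holomorphic_vars J ?P (u n i)" if "i < N" for n i
      unfolding u_def using that by (intro holomorphic_vars_diff holomorphic_vars_mult Suc.prems) auto
    have expand: "(\<Sum>i<N. x i * u n i y) = ?p y * (\<Sum>i<N. x i * v n i y) - v n N y * (\<Sum>i<N. x i * v n0 i y)"
      for x n y
      by (simp add: u_def sum_distrib_left algebra_simps sum_subtractf)
    show ?thesis
    proof (rule disjE[OF Suc.IH[of u]], goal_cases)
      case 1
      then show ?case by (rule hu)
    next
      case 2
      then obtain q where q: "\<forall>i<N. holomorphic_vars J ?P (q i)" "\<exists>i<N. \<exists>y\<in>?P. q i y \<noteq> 0"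
        "\<forall>n. \<forall>y\<in>?P. (\<Sum>i<N. q i y * u n i y) = 0" by blast
      define q' where "q' i y = (if i < N then ?p y * q i y else - (\<Sum>i<N. q i y * v n0 i y))" for i y
      have "holomorphic_vars J ?P (q' i)" for i
      proof (cases "i < N")
        case True
        then have "q' i = (\<lambda>y. ?p y * q i y)" by (simp add: q'_def fun_eq_iff)
        then show ?thesis using holomorphic_vars_mult[OF hp] q(1) True by simp
      next
        case False
        have "holomorphic_vars J ?P (\<lambda>y. \<Sum>i<N. q i y * v n0 i y)"
          by (rule holomorphic_vars_sum[OF _ _ open_polydisc[OF finJ] polydisc_cylinder])
            (use q(1) Suc.prems in \<open>auto intro: holomorphic_vars_mult\<close>)
        from holomorphic_vars_mult[OF const[of "-1"] this] False show ?thesis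
          by (simp add: q'_def[abs_def])
      qed
      moreover have "\<exists>i<Suc N. \<exists>y\<in>?P. q' i y \<noteq> 0"
      proof -
        obtain i where i: "i < N" "\<exists>y\<in>?P. q i y \<noteq> 0" using q(2) by blast
        have "\<exists>y\<in>?P. ?p y * q i y \<noteq> 0"
          by (rule product_not_identically_zero[OF finJ hp _ p0 i(2)]) (use q(1) i(1) in blast)
        then show ?thesis using i(1) by (intro exI[of _ i]) (simp add: q'_def)
      qed
      moreover have "(\<Sum>i<Suc N. q' i y * v n i y) = 0" if "y \<in> ?P" for n y
      proof -
        have "(\<Sum>i<Suc N. q' i y * v n i y) = (\<Sum>i<N. q i y * u n i y)"
          unfolding expand by (simp add: q'_def sum_distrib_left sum_distrib_right algebra_simps)
        then show ?thesis using q(3) that by simp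
      qed
      ultimately show ?case by blast
    next
      case 3
      then obtain \<theta> where th: "holomorphic_vars J ?P \<theta>" "\<exists>y\<in>?P. \<theta> y \<noteq> 0"
        "\<forall>y\<in>?P. \<theta> y \<noteq> 0 \<longrightarrow> (\<forall>x. (\<forall>n. (\<Sum>i<N. x i * u n i y) = 0) \<longrightarrow> (\<forall>i<N. x i = 0))" by blast
      have "holomorphic_vars J ?P (\<lambda>y. ?p y * \<theta> y)" by (rule holomorphic_vars_mult[OF hp th(1)])
      moreover have "\<exists>y\<in>?P. ?p y * \<theta> y \<noteq> 0"
        by (rule product_not_identically_zero[OF finJ hp th(1) p0 th(2)])
      moreover have "x i = 0"
        if y: "y \<in> ?P" "?p y * \<theta> y \<noteq> 0" and x: "\<forall>n. (\<Sum>i<Suc N. x i * v n i y) = 0" and i: "i < Suc N"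
        for y x i
      proof -
        have s: "(\<Sum>i<N. x i * v n i y) = - (x N * v n N y)" for n
          using x[rule_format, of n] by (simp add: eq_neg_iff_add_eq_0)
        have "(\<Sum>i<N. x i * u n i y) = 0" for n unfolding expand s by simp
        then have xi: "\<forall>i<N. x i = 0" using th(3) y by auto
        then have "x N * ?p y = 0" using s[of n0] by simp
        then show ?thesis using xi i y(2) by (auto simp: less_Suc_eq)
      qed
      ultimately show ?case by blast
    qed
  qed
qed

section \<open>Extension of meromorphic functions across codimension two\<close>

text \<open>
  A meromorphic function on an open subset of \<open>\<complex>\<^sup>J\<close>, given by countably many local quotients
  \<open>g n / h n\<close>. The points that the sets \<open>V n\<close> leave out have two vanishing coordinates, hence form a
  set of codimension at least two.
\<close>
locale local_quotients =
  fixes J :: "nat set" and V :: "nat \<Rightarrow> (nat \<Rightarrow> complex) set"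
    and g h :: "nat \<Rightarrow> (nat \<Rightarrow> complex) \<Rightarrow> complex"
  assumes finJ: "finite J"
    and g_hol: "\<And>n. holomorphic_vars J (V n) (g n)"
    and h_hol: "\<And>n. holomorphic_vars J (V n) (h n)"
    and h_dense: "\<And>n. V n \<subseteq> closure {z \<in> V n. h n z \<noteq> 0}"
    and compat: "\<And>n k z. z \<in> V n \<Longrightarrow> z \<in> V k \<Longrightarrow> g n z * h k z = g k z * h n z"
    and cover: "\<And>z. (\<And>i j. i \<in> J \<Longrightarrow> j \<in> J \<Longrightarrow> z i = 0 \<Longrightarrow> z j = 0 \<Longrightarrow> i = j) \<Longrightarrow> \<exists>n. z \<in> V n"
begin

definition regular :: "(nat \<Rightarrow> complex) set" where
  "regular = (\<Union>n. {z \<in> V n. h n z \<noteq> 0})"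

definition quot :: "(nat \<Rightarrow> complex) \<Rightarrow> complex" where
  "quot z = (let n = LEAST n. z \<in> V n \<and> h n z \<noteq> 0 in g n z / h n z)"

text \<open>
  This holds also where \<open>h n\<close> vanishes: comparison with a quotient that is defined at \<open>z\<close> shows that
  \<open>g n\<close> vanishes there too.
\<close>
lemma quot_eq:
  assumes z: "z \<in> regular" and n: "z \<in> V n"
  shows "quot z * h n z = g n z"
proof -
  define k where "k = (LEAST n. z \<in> V n \<and> h n z \<noteq> 0)"
  have "\<exists>n. z \<in> V n \<and> h n z \<noteq> 0" using z by (auto simp: regular_def)
  then have k: "z \<in> V k \<and> h k z \<noteq> 0" unfolding k_def by (rule LeastI_ex)
  have "quot z = g k z / h k z" by (simp add: quot_def k_def Let_def)
  then have "(quot z * h n z) * h k z = g n z * h k z"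
    using compat[OF n, of k] k by simp
  then show ?thesis using k by simp
qed

lemma open_V: "open (V n)"
  using holomorphic_varsD(1)[OF g_hol] .

lemma quot_hol: "holomorphic_vars J regular quot"
proof (rule holomorphic_vars_locally[OF _ finJ])
  fix a assume "a \<in> regular"
  then obtain n where n: "a \<in> V n" "h n a \<noteq> 0" by (auto simp: regular_def)
  let ?W = "{z \<in> V n. h n z \<noteq> 0}"
  have oW: "open ?W" by (rule open_nonzero_set[OF h_hol])
  have cyl: "z' \<in> ?W" if z: "z \<in> ?W" and eq: "\<And>i. i \<in> J \<Longrightarrow> z' i = z i" for z z'
  proof -
    have zV: "z \<in> V n" using z by simp
    have "z' \<in> V n" by (rule holomorphic_varsD(2)[OF h_hol zV eq])
    moreover have "h n z' = h n z" by (rule holomorphic_varsD(3)[OF h_hol zV eq])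
    ultimately show ?thesis using z by simp
  qed
  have hg: "holomorphic_vars J ?W (g n)"
    by (rule holomorphic_vars_subset[OF g_hol oW _ cyl]) auto
  have hh: "holomorphic_vars J ?W (h n)"
    by (rule holomorphic_vars_subset[OF h_hol oW _ cyl]) auto
  have "holomorphic_vars J ?W (\<lambda>z. g n z / h n z)"
    by (rule holomorphic_vars_divide[OF hg hh]) auto
  moreover have "quot z = g n z / h n z" if "z \<in> ?W" for z
  proof -
    have "z \<in> regular" using that by (auto simp: regular_def)
    then show ?thesis using quot_eq[of z n] that by (simp add: field_simps)
  qed
  ultimately show "\<exists>W g. a \<in> W \<and> W \<subseteq> regular \<and> holomorphic_vars J W g \<and> (\<forall>z\<in>W. quot z = g z)"
    using n by (intro exI[of _ ?W] exI[of _ "\<lambda>z. g n z / h n z"]) (auto simp: regular_def)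
qed

lemma open_regular: "open regular"
  using holomorphic_varsD(1)[OF quot_hol] .

text \<open>
  A line with a dense set of parameters in this set cannot run inside the zero set of \<open>h n\<close> over any
  part of \<open>V n\<close>. The exterior of \<open>V n\<close> is added to make the set dense in the whole space, as Baire's
  theorem requires.
\<close>
definition nondegenerate :: "nat \<Rightarrow> (nat \<Rightarrow> complex) set" where
  "nondegenerate n = {z \<in> V n. h n z \<noteq> 0} \<union> - closure (V n)"

lemma open_nondegenerate: "open (nondegenerate n)"
  unfolding nondegenerate_def by (intro open_Un open_nonzero_set[OF h_hol] open_Compl closed_closure)

lemma dense_nondegenerate: "UNIV \<subseteq> closure (nondegenerate n)"
proof (rule denseI)
  fix O' :: "(nat \<Rightarrow> complex) set" assume O: "open O'" "O' \<noteq> {}"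
  show "\<exists>x\<in>O'. x \<in> nondegenerate n"
  proof (cases "O' \<inter> V n = {}")
    case True
    then have "O' \<inter> closure (V n) = {}" using open_Int_closure_eq_empty[OF O(1)] by blast
    then show ?thesis using O(2) unfolding nondegenerate_def by blast
  next
    case False
    then have "\<exists>x\<in>O' \<inter> V n. x \<in> {z \<in> V n. h n z \<noteq> 0}"
      using O(1) open_V by (intro denseD[OF h_dense]) auto
    then show ?thesis unfolding nondegenerate_def by blast
  qed
qed simp

text \<open>
  The restriction of the meromorphic function to a good line is again meromorphic, except perhaps at
  the parameter \<open>0\<close>: lines through the origin are considered too, and the origin need not be covered.
\<close>
definition good_line :: "(nat \<Rightarrow> complex) \<Rightarrow> (nat \<Rightarrow> complex) \<Rightarrow> bool" where
  "good_line y d \<longleftrightarrow> (\<exists>Q. (\<forall>O'. open O' \<longrightarrow> O' \<noteq> {} \<longrightarrow> (\<exists>s\<in>Q. s \<in> O')) \<and>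
      (\<forall>n. \<forall>s\<in>Q. s \<noteq> 0 \<longrightarrow> (\<lambda>i. y i + s * d i) \<in> nondegenerate n)) \<and>
    (\<forall>s. s \<noteq> 0 \<longrightarrow> (\<exists>n. (\<lambda>i. y i + s * d i) \<in> V n))"

lemma good_line_local:
  assumes gl: "good_line y d" and s0: "(\<lambda>i. y i + s0 * d i) \<in> V n"
  shows "\<exists>\<delta>>0. (\<lambda>s. g n (\<lambda>i. y i + s * d i)) holomorphic_on ball s0 \<delta>
      \<and> (\<lambda>s. h n (\<lambda>i. y i + s * d i)) holomorphic_on ball s0 \<delta>
      \<and> (\<exists>s\<in>ball s0 \<delta>. h n (\<lambda>i. y i + s * d i) \<noteq> 0)
      \<and> (\<forall>s\<in>ball s0 \<delta>. (\<lambda>i. y i + s * d i) \<in> V n)"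
proof -
  let ?L = "\<lambda>s i. y i + s * d i"
  have "open {s. ?L s \<in> V n}" by (rule open_line_preimage[OF open_V])
  then obtain \<delta> where d: "0 < \<delta>" "ball s0 \<delta> \<subseteq> {s. ?L s \<in> V n}"
    using s0 open_contains_ball[of "{s. ?L s \<in> V n}"] by blast
  obtain Q where Q: "\<forall>O'. open O' \<longrightarrow> O' \<noteq> {} \<longrightarrow> (\<exists>s\<in>Q. s \<in> O')"
      "\<forall>n. \<forall>s\<in>Q. s \<noteq> 0 \<longrightarrow> ?L s \<in> nondegenerate n"
    using gl unfolding good_line_def by (elim conjE exE)
  have "infinite (ball s0 \<delta>)" using d(1) finite_imp_not_open[of "ball s0 \<delta>"] by auto
  then have "ball s0 \<delta> - {0} \<noteq> {}"
    by (rule infinite_Diff_singleton_ne)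
  moreover have "open (ball s0 \<delta> - {0})" by (intro open_delete open_ball)
  ultimately have "\<exists>s\<in>Q. s \<in> ball s0 \<delta> - {0}" using Q(1)[rule_format, of "ball s0 \<delta> - {0}"] by blast
  then obtain s where s: "s \<in> Q" "s \<in> ball s0 \<delta>" "s \<noteq> 0" by blast
  have "?L s \<in> V n" using s d(2) by blast
  then have "?L s \<notin> - closure (V n)" using closure_subset[of "V n"] by blast
  then have "h n (?L s) \<noteq> 0"
    using Q(2)[rule_format, OF s(1,3), of n] unfolding nondegenerate_def by blast
  then show ?thesis
    using d s(2) holomorphic_on_subset[OF holomorphic_on_line[OF finJ g_hol] d(2)]
      holomorphic_on_subset[OF holomorphic_on_line[OF finJ h_hol] d(2)]
    by (intro exI[of _ \<delta>]) auto
qed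

lemma good_line_dense:
  assumes gl: "good_line y d"
  shows "closure {s. (\<lambda>i. y i + s * d i) \<in> regular} = UNIV"
proof -
  let ?L = "\<lambda>s i. y i + s * d i"
  have "UNIV \<subseteq> closure {s. ?L s \<in> regular}"
  proof (rule denseI)
    fix O' :: "complex set" assume O: "open O'" "O' \<noteq> {}"
    have "infinite O'" using O finite_imp_not_open[of O'] by auto
    then have "O' - {0} \<noteq> {}" by (rule infinite_Diff_singleton_ne)
    moreover have "open (O' - {0})" by (intro open_delete O(1))
    moreover obtain Q where Q: "\<forall>O'. open O' \<longrightarrow> O' \<noteq> {} \<longrightarrow> (\<exists>s\<in>Q. s \<in> O')"
      "\<forall>n. \<forall>s\<in>Q. s \<noteq> 0 \<longrightarrow> ?L s \<in> nondegenerate n"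
      "\<forall>s. s \<noteq> 0 \<longrightarrow> (\<exists>n. ?L s \<in> V n)"
      using gl unfolding good_line_def by (elim conjE exE)
    ultimately have "\<exists>s\<in>Q. s \<in> O' - {0}" by blast
    then obtain s where s: "s \<in> Q" "s \<in> O'" "s \<noteq> 0" by blast
    obtain n where n: "?L s \<in> V n" using Q(3) s(3) by blast
    then have "?L s \<notin> - closure (V n)" using closure_subset[of "V n"] by blast
    then have "h n (?L s) \<noteq> 0"
      using Q(2)[rule_format, OF s(1,3), of n] unfolding nondegenerate_def by blast
    then have "?L s \<in> regular" using n unfolding regular_def by blast
    then show "\<exists>x\<in>O'. x \<in> {s. ?L s \<in> regular}" using s(2) by blast
  qed simp
  then show ?thesis by blast
qed

abbreviation line :: "(nat \<Rightarrow> complex) \<Rightarrow> (nat \<Rightarrow> complex) \<Rightarrow> complex \<Rightarrow> nat \<Rightarrow> complex" where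
  "line y d s \<equiv> (\<lambda>i. y i + s * d i)"

text \<open>
  There are countably many conditions, each defining an open dense set of \<open>y\<close>: for all \<open>n\<close> and all \<open>s\<close> in
  a countable dense set of parameters, \<open>y + s d\<close> is nondegenerate; and \<open>y i * d j \<noteq> y j * d i\<close> for
  \<open>i \<noteq> j\<close>, which prevents two coordinates from vanishing at the same point of the line.
\<close>
lemma generic_basepoint:
  assumes d: "\<And>i. i \<in> J \<Longrightarrow> d i \<noteq> 0" and P: "open P" "P \<noteq> {}"
    and T: "countable \<T>" "\<And>T. T \<in> \<T> \<Longrightarrow> open T" "\<And>T. T \<in> \<T> \<Longrightarrow> P \<subseteq> closure T"
  shows "\<exists>y\<in>P. y \<in> \<Inter>\<T> \<and> good_line y d \<and> (\<exists>n. y \<in> V n)"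
proof -
  obtain Q :: "complex set" where Q: "countable Q" "\<And>O'. open O' \<Longrightarrow> O' \<noteq> {} \<Longrightarrow> \<exists>s\<in>Q. s \<in> O'"
    using countable_dense_complex by blast
  define \<A> where "\<A> = (\<lambda>(n, s). (\<lambda>y. line y d s) -` nondegenerate n) ` (UNIV \<times> Q)"
  define \<B> where "\<B> = (\<lambda>(i, j). {y :: nat \<Rightarrow> complex. y i * d j \<noteq> y j * d i}) ` {(i, j). i \<in> J \<and> j \<in> J \<and> i \<noteq> j}"
  have "P \<inter> \<Inter>(\<T> \<union> \<A> \<union> \<B>) \<noteq> {}"
  proof (rule Baire_open[OF P])
    have "finite {(i, j). i \<in> J \<and> j \<in> J \<and> i \<noteq> j}"
      by (rule finite_subset[of _ "J \<times> J"]) (use finJ in auto)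
    then have "countable \<B>" unfolding \<B>_def by (intro countable_image countable_finite)
    then show "countable (\<T> \<union> \<A> \<union> \<B>)"
      using T(1) Q(1) by (auto simp: \<A>_def intro!: countable_Un countable_image countable_SIGMA)
    fix T assume "T \<in> \<T> \<union> \<A> \<union> \<B>"
    then consider "T \<in> \<T>" | n s where "T = (\<lambda>y. line y d s) -` nondegenerate n"
      | i j where "i \<in> J" "j \<in> J" "i \<noteq> j" "T = {y. y i * d j \<noteq> y j * d i}"
      by (auto simp: \<A>_def \<B>_def)
    then have "open T \<and> P \<subseteq> closure T"
    proof cases
      case 1
      then show ?thesis using T by blast
    next
      case 2
      have "open T" unfolding 2
        by (rule open_vimage[OF open_nondegenerate continuous_on_shift])
      moreover have "UNIV \<subseteq> closure T" unfolding 2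
        by (rule dense_vimage[OF dense_nondegenerate continuous_on_shift[of UNIV "\<lambda>i. - (s * d i)"]])
          (simp_all add: fun_eq_iff)
      ultimately show ?thesis by blast
    next
      case 3
      have c: "continuous_on UNIV (\<lambda>y :: nat \<Rightarrow> complex. y k)" for k
        by (rule continuous_on_product_then_coordinatewise[OF continuous_on_id])
      have "open T" unfolding 3
        by (intro open_Collect_neq continuous_on_mult c continuous_on_const)
      moreover have "UNIV \<subseteq> closure T"
      proof (rule dense_avoid_coordinate[where i = i])
        fix y :: "nat \<Rightarrow> complex"
        have "y(i := t) \<in> T" if "t \<noteq> y j * d i / d j" for t
          using that d[OF 3(2)] 3(3) by (simp add: 3(4) field_simps)
        then show "\<exists>c. \<forall>t. t \<noteq> c \<longrightarrow> y(i := t) \<in> T" by blast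
      qed
      ultimately show ?thesis by blast
    qed
    then show "open T" "P \<subseteq> closure T" by blast+
  qed
  then obtain y where y: "y \<in> P" "y \<in> \<Inter>\<T>" "y \<in> \<Inter>\<A>" "y \<in> \<Inter>\<B>" by blast
  have nd: "line y d s \<in> nondegenerate n" if "s \<in> Q" for n s
  proof -
    have "(\<lambda>y. line y d s) -` nondegenerate n \<in> \<A>" unfolding \<A>_def using that by (intro image_eqI[of _ _ "(n, s)"]) auto
    then show ?thesis using y(3) by blast
  qed
  have cov: "\<exists>n. line y d s \<in> V n" for s
  proof (rule cover)
    fix i j assume ij: "i \<in> J" "j \<in> J" "line y d s i = 0" "line y d s j = 0"
    show "i = j"
    proof (rule ccontr)
      assume "i \<noteq> j"
      then have "{y :: nat \<Rightarrow> complex. y i * d j \<noteq> y j * d i} \<in> \<B>"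
        unfolding \<B>_def using ij by (intro image_eqI[of _ _ "(i, j)"]) auto
      then have "y i * d j \<noteq> y j * d i" using y(4) by blast
      moreover have "y i = - (s * d i)" "y j = - (s * d j)"
        using ij(3,4) by (simp_all add: eq_neg_iff_add_eq_0)
      ultimately show False by simp
    qed
  qed
  have "good_line y d"
    unfolding good_line_def using Q(2) nd cov by (intro conjI exI[of _ Q]) blast+
  moreover have "\<exists>n. y \<in> V n" using cov[of 0] by simp
  ultimately show ?thesis using y(1,2) by blast
qed

text \<open>
  The same argument for lines through the origin, with the direction as the generic point. Two
  coordinates vanish at the same time only at the origin.
\<close>
lemma generic_direction: "\<exists>d. (\<forall>i\<in>J. d i \<noteq> 0) \<and> good_line (\<lambda>_. 0) d"
proof -
  obtain Q :: "complex set" where Q: "countable Q" "\<And>O'. open O' \<Longrightarrow> O' \<noteq> {} \<Longrightarrow> \<exists>s\<in>Q. s \<in> O'"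
    using countable_dense_complex by blast
  define \<A> where "\<A> = (\<lambda>(n, s). (\<lambda>d. line (\<lambda>_. 0) d s) -` nondegenerate n) ` (UNIV \<times> (Q - {0}))"
  define \<B> where "\<B> = (\<lambda>i. {d :: nat \<Rightarrow> complex. d i \<noteq> 0}) ` J"
  have "UNIV \<inter> \<Inter>(\<A> \<union> \<B>) \<noteq> {}"
  proof (rule Baire_open)
    have "countable \<A>" unfolding \<A>_def using Q(1) by (intro countable_image countable_SIGMA) auto
    moreover have "countable \<B>" unfolding \<B>_def using finJ by (intro countable_image countable_finite)
    ultimately show "countable (\<A> \<union> \<B>)" by (rule countable_Un)
    fix T assume "T \<in> \<A> \<union> \<B>"
    then consider n s where "s \<noteq> 0" "T = (\<lambda>d. line (\<lambda>_. 0) d s) -` nondegenerate n"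
      | i where "T = {d. d i \<noteq> 0}"
      by (auto simp: \<A>_def \<B>_def)
    then have "open T \<and> UNIV \<subseteq> closure T"
    proof cases
      case 1
      have c: "continuous_on UNIV (\<lambda>d :: nat \<Rightarrow> complex. line (\<lambda>_. 0) d s)" for s
        by (rule continuous_on_coordinatewise_then_product)
          (intro continuous_on_add continuous_on_mult continuous_on_const
            continuous_on_product_then_coordinatewise[OF continuous_on_id])
      have "open T" unfolding 1 by (rule open_vimage[OF open_nondegenerate c])
      moreover have "UNIV \<subseteq> closure T" unfolding 1
        by (rule dense_vimage[OF dense_nondegenerate c[of "1 / s"]])
          (use 1(1) in \<open>simp_all add: fun_eq_iff\<close>)
      ultimately show ?thesis by blast
    next
      case 2
      have c: "continuous_on UNIV (\<lambda>y :: nat \<Rightarrow> complex. y k)" for k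
        by (rule continuous_on_product_then_coordinatewise[OF continuous_on_id])
      have "open T" unfolding 2 by (intro open_Collect_neq c continuous_on_const)
      moreover have "UNIV \<subseteq> closure T"
      proof (rule dense_avoid_coordinate[where i = i])
        fix y :: "nat \<Rightarrow> complex"
        show "\<exists>c. \<forall>t. t \<noteq> c \<longrightarrow> y(i := t) \<in> T" by (rule exI[of _ 0]) (simp add: 2)
      qed
      ultimately show ?thesis by blast
    qed
    then show "open T" "UNIV \<subseteq> closure T" by blast+
  qed auto
  then obtain d where dA: "d \<in> \<Inter>\<A>" and dB: "d \<in> \<Inter>\<B>" by blast
  have d0: "d i \<noteq> 0" if "i \<in> J" for i using dB that by (auto simp: \<B>_def)
  have nd: "line (\<lambda>_. 0) d s \<in> nondegenerate n" if "s \<in> Q" "s \<noteq> 0" for n s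
  proof -
    have "(\<lambda>d. line (\<lambda>_. 0) d s) -` nondegenerate n \<in> \<A>"
      unfolding \<A>_def using that by (intro image_eqI[of _ _ "(n, s)"]) auto
    then show ?thesis using dA by blast
  qed
  have cov: "\<exists>n. line (\<lambda>_. 0) d s \<in> V n" if "s \<noteq> 0" for s
    by (rule cover) (use that d0 in auto)
  have "good_line (\<lambda>_. 0) d"
    unfolding good_line_def using Q(2) nd cov by (intro conjI exI[of _ Q]) blast+
  then show ?thesis using d0 by blast
qed

text \<open>
  The parameters of singular points do not accumulate in the annulus \<open>1 \<le> \<bar>s\<bar> \<le> 2\<close>, so their
  finitely many absolute values leave out some radius.
\<close>
lemma regular_circle:
  assumes gl: "good_line (\<lambda>_. 0) d"
  shows "\<exists>r>0. \<forall>s\<in>sphere 0 r. line (\<lambda>_. 0) d s \<in> regular"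
proof -
  define K where "K = cball (0 :: complex) 2 - ball 0 1"
  have K: "compact K" unfolding K_def by (rule compact_diff) auto
  define B where "B = {s \<in> K. line (\<lambda>_. 0) d s \<notin> regular}"
  have "finite B"
  proof (rule ccontr)
    assume "infinite B"
    then obtain x where x: "x \<in> K" "x islimpt B"
      using Heine_Borel_imp_Bolzano_Weierstrass[OF K, of B] by (auto simp: B_def)
    then have "x \<noteq> 0" by (auto simp: K_def)
    then obtain n where n: "line (\<lambda>_. 0) d x \<in> V n"
      using gl unfolding good_line_def by blast
    obtain \<delta> s1 where \<delta>: "0 < \<delta>"
      and hol: "(\<lambda>s. h n (line (\<lambda>_. 0) d s)) holomorphic_on ball x \<delta>"
      and s1: "s1 \<in> ball x \<delta>" "h n (line (\<lambda>_. 0) d s1) \<noteq> 0"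
      and inV: "\<And>s. s \<in> ball x \<delta> \<Longrightarrow> line (\<lambda>_. 0) d s \<in> V n"
      using good_line_local[OF gl n] by (elim exE conjE bexE) blast
    have "h n (line (\<lambda>_. 0) d s1) = 0"
    proof (rule analytic_continuation[OF hol open_ball connected_ball, of "B \<inter> ball x \<delta>" x])
      show "x islimpt (B \<inter> ball x \<delta>)"
        unfolding islimpt_def
      proof (intro allI impI)
        fix T assume "x \<in> T" "open T"
        then have "x \<in> T \<inter> ball x \<delta>" "open (T \<inter> ball x \<delta>)" using \<delta> by auto
        then have "\<exists>y\<in>B. y \<in> T \<inter> ball x \<delta> \<and> y \<noteq> x" using x(2) unfolding islimpt_def by blast
        then show "\<exists>y\<in>B \<inter> ball x \<delta>. y \<in> T \<and> y \<noteq> x" by blast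
      qed
      fix s assume s: "s \<in> B \<inter> ball x \<delta>"
      then have "line (\<lambda>_. 0) d s \<notin> regular" by (simp add: B_def)
      moreover have "line (\<lambda>_. 0) d s \<in> V n" using inV s by blast
      ultimately show "h n (line (\<lambda>_. 0) d s) = 0" unfolding regular_def by blast
    qed (use \<delta> s1 in auto)
    then show False using s1(2) by simp
  qed
  then have "finite (cmod ` B)" by (rule finite_imageI)
  moreover have "infinite {1..2 :: real}" by (rule infinite_Icc) simp
  ultimately have "\<not> {1..2 :: real} \<subseteq> cmod ` B" using finite_subset by blast
  then obtain r where "r \<in> {1..2}" "r \<notin> cmod ` B" by blast
  then have r: "1 \<le> r" "r \<le> 2" "r \<notin> cmod ` B" by auto
  have "line (\<lambda>_. 0) d s \<in> regular" if s: "s \<in> sphere 0 r" for s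
  proof (rule ccontr)
    assume "line (\<lambda>_. 0) d s \<notin> regular"
    then have "s \<in> B" using s r by (auto simp: B_def K_def)
    then show False using s r(3) by auto
  qed
  then show ?thesis using r by (intro exI[of _ r]) auto
qed

lemma good_line_clearing:
  assumes gl: "good_line y d" and n0: "\<exists>n. y \<in> V n"
  obtains p :: "complex poly" and \<Phi> \<Omega> where "p \<noteq> 0" "open \<Omega>" "cball 0 r \<subseteq> \<Omega>" "\<Phi> holomorphic_on \<Omega>"
    "\<And>s. s \<in> {s. line y d s \<in> regular} \<Longrightarrow> s \<in> \<Omega> \<Longrightarrow> \<Phi> s = poly p s * quot (line y d s)"
proof (rule pole_clearing_polynomial[OF good_line_dense[OF gl], where \<phi> = "\<lambda>s. quot (line y d s)" and r = r])
  fix s0 :: complex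
  have "\<exists>n. line y d s0 \<in> V n"
  proof (cases "s0 = 0")
    case True
    then show ?thesis using n0 by simp
  next
    case False
    then show ?thesis using gl unfolding good_line_def by blast
  qed
  then obtain n where n: "line y d s0 \<in> V n" by blast
  obtain \<delta> where \<delta>: "0 < \<delta>" "(\<lambda>s. g n (line y d s)) holomorphic_on ball s0 \<delta>"
     "(\<lambda>s. h n (line y d s)) holomorphic_on ball s0 \<delta>"
     "\<exists>s\<in>ball s0 \<delta>. h n (line y d s) \<noteq> 0"
     "\<forall>s\<in>ball s0 \<delta>. line y d s \<in> V n"
    using good_line_local[OF gl n] by blast
  have "quot (line y d s) * h n (line y d s) = g n (line y d s)"
    if "s \<in> {s. line y d s \<in> regular} \<inter> ball s0 \<delta>" for s
    by (rule quot_eq) (use that \<delta>(5) in blast)+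
  then show "\<exists>\<delta>>0. \<exists>a b. a holomorphic_on ball s0 \<delta> \<and> b holomorphic_on ball s0 \<delta>
      \<and> (\<exists>s\<in>ball s0 \<delta>. b s \<noteq> 0)
      \<and> (\<forall>s\<in>{s. line y d s \<in> regular} \<inter> ball s0 \<delta>. quot (line y d s) * b s = a s)"
    using \<delta> by (intro exI[of _ \<delta>] conjI exI[of _ "\<lambda>s. g n (line y d s)"] exI[of _ "\<lambda>s. h n (line y d s)"]) blast+
next
  fix P \<Phi> \<Omega>
  assume "P \<noteq> 0" "open \<Omega>" "cball 0 r \<subseteq> \<Omega>" "\<Phi> holomorphic_on \<Omega>"
    "\<And>s. s \<in> {s. line y d s \<in> regular} \<Longrightarrow> s \<in> \<Omega> \<Longrightarrow> \<Phi> s = poly P s * quot (line y d s)"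
  then show thesis by (rule that)
qed

lemma quot_line_continuous: "continuous_on {s. line y d s \<in> regular} (\<lambda>s. quot (line y d s))"
  by (rule continuous_on_compose2[OF holomorphic_varsD(4)[OF quot_hol] continuous_on_line]) blast

lemma quot_circle_integral_holomorphic:
  assumes r: "0 < r" and oP: "open P"
    and cyl: "\<And>z z'. z \<in> P \<Longrightarrow> (\<And>i. i \<in> J \<Longrightarrow> z' i = z i) \<Longrightarrow> z' \<in> P"
    and reg: "\<And>y s. y \<in> P \<Longrightarrow> s \<in> sphere 0 r \<Longrightarrow> line y d s \<in> regular"
    and k: "continuous_on (sphere 0 r) k"
  shows "holomorphic_vars J P (\<lambda>y. contour_integral (circlepath 0 r) (\<lambda>s. quot (line y d s) * k s))"
proof (rule holomorphic_vars_circle_integral[OF oP finJ r cyl])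
  have "continuous_on (P \<times> sphere 0 r) (\<lambda>p. quot (line (fst p) d (snd p)) * k (snd p))"
  proof (rule continuous_on_mult)
    show "continuous_on (P \<times> sphere 0 r) (\<lambda>p. quot (line (fst p) d (snd p)))"
    proof (rule continuous_on_compose2[OF holomorphic_varsD(4)[OF quot_hol] continuous_on_line2])
      show "(\<lambda>p. line (fst p) d (snd p)) ` (P \<times> sphere 0 r) \<subseteq> regular"
        using reg by (intro image_subsetI) (simp only: mem_Times_iff)
    qed
    show "continuous_on (P \<times> sphere 0 r) (\<lambda>p. k (snd p))"
      by (rule continuous_on_compose2[OF k continuous_on_snd[OF continuous_on_id]]) auto
  qed
  then show "continuous_on (P \<times> sphere 0 r) (\<lambda>(y, s). quot (line y d s) * k s)"
    by (simp add: case_prod_beta)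
next
  fix s :: complex assume s: "s \<in> sphere 0 r"
  have "holomorphic_vars J P (\<lambda>y. quot (\<lambda>i. y i + s * d i))"
    by (rule holomorphic_vars_subset[OF holomorphic_vars_shift[OF quot_hol, of "\<lambda>i. s * d i"] oP _ cyl])
      (use reg s in blast)
  from holomorphic_vars_mult[OF this holomorphic_vars_const[OF oP cyl, where c = "k s"]]
  show "holomorphic_vars J P (\<lambda>y. quot (line y d s) * k s)" by simp
qed

text \<open>
  On a generic line the coefficients of a polynomial that clears the poles give a linear relation
  between \<open>N\<close> consecutive moments, with \<open>N\<close> depending on the line. If there were no relation with
  holomorphic coefficients for any \<open>N\<close>, then for every \<open>N\<close> the moments would be independent on an open
  dense set of lines. By Baire's theorem some generic line would lie in all of these sets.
\<close>
lemma recurrence_of_moments: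
  assumes direction: "\<forall>i\<in>J. d i \<noteq> 0" and r: "0 < r" and e: "0 < \<epsilon>"
    and circles: "\<forall>y\<in>polydisc J (\<lambda>_. 0) \<epsilon>. \<forall>s\<in>sphere 0 r. line y d s \<in> regular"
  shows "\<exists>N q. (\<forall>i<N. holomorphic_vars J (polydisc J (\<lambda>_. 0) \<epsilon>) (q i))
    \<and> (\<exists>i<N. \<exists>y\<in>polydisc J (\<lambda>_. 0) \<epsilon>. q i y \<noteq> 0)
    \<and> (\<forall>n. \<forall>y\<in>polydisc J (\<lambda>_. 0) \<epsilon>.
      (\<Sum>i<N. q i y * contour_integral (circlepath 0 r) (\<lambda>s. quot (line y d s) * s ^ (n + i))) = 0)"
proof -
  let ?P = "polydisc J (\<lambda>_. 0) \<epsilon>"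
  have oP: "open ?P" by (rule open_polydisc[OF finJ])
  have d: "d i \<noteq> 0" if "i \<in> J" for i using direction that by blast
  have reg: "line y d s \<in> regular" if "y \<in> ?P" "s \<in> sphere 0 r" for y s
    using circles that by blast
  define c where "c n y = contour_integral (circlepath 0 r) (\<lambda>s. quot (line y d s) * s ^ n)" for n y
  have holc: "holomorphic_vars J ?P (c n)" for n
    unfolding c_def
    by (rule quot_circle_integral_holomorphic[OF r oP polydisc_cylinder reg])
      (auto intro!: continuous_intros)
  have "\<exists>N q. (\<forall>i<N. holomorphic_vars J ?P (q i)) \<and> (\<exists>i<N. \<exists>y\<in>?P. q i y \<noteq> 0)
           \<and> (\<forall>n. \<forall>y\<in>?P. (\<Sum>i<N. q i y * c (n + i) y) = 0)"
  proof (rule ccontr)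
    assume no: "\<not> ?thesis"
    define minor where "minor N \<theta> \<longleftrightarrow> holomorphic_vars J ?P \<theta> \<and> (\<exists>y\<in>?P. \<theta> y \<noteq> 0)
       \<and> (\<forall>y\<in>?P. \<theta> y \<noteq> 0 \<longrightarrow> (\<forall>x. (\<forall>n. (\<Sum>i<N. x i * c (n + i) y) = 0) \<longrightarrow> (\<forall>i<N. x i = 0)))"
      for N \<theta>
    have "\<forall>N. \<exists>\<theta>. minor N \<theta>"
    proof
      fix N
      show "\<exists>\<theta>. minor N \<theta>"
      proof (rule disjE[OF linear_relation_or_nonvanishing_minor[OF finJ e, of N "\<lambda>_. 0" "\<lambda>n i. c (n + i)"]], goal_cases)
        case 1
        show ?case by (rule holc)
      next
        case 2
        show ?case by (rule notE[OF no]) (rule exI[of _ N], rule 2)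
      next
        case 3
        then show ?case by (simp only: minor_def)
      qed
    qed
    then have "\<exists>\<theta>. \<forall>N. minor N (\<theta> N)" by (rule choice)
    then obtain \<theta> where minor: "\<And>N. minor N (\<theta> N)" by blast
    have \<theta>: "\<And>N. holomorphic_vars J ?P (\<theta> N)" "\<And>N. \<exists>y\<in>?P. \<theta> N y \<noteq> 0"
      "\<And>N y x i. y \<in> ?P \<Longrightarrow> \<theta> N y \<noteq> 0 \<Longrightarrow> (\<forall>n. (\<Sum>i<N. x i * c (n + i) y) = 0) \<Longrightarrow> i < N \<Longrightarrow> x i = 0"
      using minor unfolding minor_def by blast+
    have "\<exists>y\<in>?P. y \<in> \<Inter>(range (\<lambda>N. {y \<in> ?P. \<theta> N y \<noteq> 0})) \<and> good_line y d \<and> (\<exists>n. y \<in> V n)"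
    proof (rule generic_basepoint[OF d oP])
      show "?P \<noteq> {}" using centre_in_polydisc[OF e] by blast
      fix T assume "T \<in> range (\<lambda>N. {y \<in> ?P. \<theta> N y \<noteq> 0})"
      then obtain N where T: "T = {y \<in> ?P. \<theta> N y \<noteq> 0}" by blast
      show "open T" unfolding T by (rule open_nonzero_set[OF \<theta>(1)])
      show "?P \<subseteq> closure T"
      proof (rule denseI[OF oP])
        fix O' assume O: "open O'" "O' \<subseteq> ?P" "O' \<noteq> {}"
        obtain y where y: "y \<in> ?P" "\<theta> N y \<noteq> 0" using \<theta>(2) by blast
        obtain z where "z \<in> O'" "\<theta> N z \<noteq> 0" by (rule dense_nonzero[OF finJ \<theta>(1) y O])
        then show "\<exists>x\<in>O'. x \<in> T" using O(2) unfolding T by blast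
      qed
    qed auto
    then obtain y where y: "y \<in> ?P" "\<And>N. \<theta> N y \<noteq> 0" "good_line y d" "\<exists>n. y \<in> V n" by blast
    obtain p \<Phi> \<Omega> where p: "p \<noteq> 0" "open \<Omega>" "cball 0 r \<subseteq> \<Omega>" "\<Phi> holomorphic_on \<Omega>"
      "\<And>s. s \<in> {s. line y d s \<in> regular} \<Longrightarrow> s \<in> \<Omega> \<Longrightarrow> \<Phi> s = poly p s * quot (line y d s)"
      by (rule good_line_clearing[OF y(3,4), of r]) blast
    have pim: "path_image (circlepath 0 r) = sphere 0 r" using r by simp
    have contq: "continuous_on (sphere 0 r) (\<lambda>s. quot (line y d s))"
      by (rule continuous_on_subset[OF quot_line_continuous]) (use reg[OF y(1)] in blast)
    have rel: "(\<Sum>i<Suc (degree p). coeff p i * c (n + i) y) = 0" for n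
    proof -
      have int: "(\<lambda>s. quot (line y d s) * s ^ m) contour_integrable_on circlepath 0 r" for m
        by (rule contour_integrable_continuous_circlepath, unfold pim)
          (rule continuous_on_mult[OF contq continuous_on_power[OF continuous_on_id]])
      have "(\<Sum>i<Suc (degree p). coeff p i * c (n + i) y)
          = (\<Sum>i<Suc (degree p). contour_integral (circlepath 0 r) (\<lambda>s. coeff p i * (quot (line y d s) * s ^ (n + i))))"
        by (simp only: c_def contour_integral_lmul[OF int])
      also have "\<dots> = contour_integral (circlepath 0 r)
          (\<lambda>s. \<Sum>i<Suc (degree p). coeff p i * (quot (line y d s) * s ^ (n + i)))"
        by (rule contour_integral_sum[symmetric]) (auto intro: contour_integrable_lmul int)
      also have "\<dots> = contour_integral (circlepath 0 r) (\<lambda>s. \<Phi> s * s ^ n)"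
      proof (rule contour_integral_cong[OF refl])
        fix s assume "s \<in> path_image (circlepath 0 r)"
        then have s: "s \<in> sphere 0 r" using pim by blast
        have "\<Phi> s = poly p s * quot (line y d s)"
          by (rule p(5)) (use reg[OF y(1) s] s p(3) in auto)
        then show "(\<Sum>i<Suc (degree p). coeff p i * (quot (line y d s) * s ^ (n + i))) = \<Phi> s * s ^ n"
          by (simp add: poly_altdef lessThan_Suc_atMost sum_distrib_left sum_distrib_right power_add mult_ac)
      qed
      also have "\<dots> = 0"
      proof (rule contour_integral_unique)
        have "(\<lambda>s. \<Phi> s * s ^ n) holomorphic_on cball 0 r"
          using holomorphic_on_subset[OF p(4,3)] by (intro holomorphic_intros)
        then show "((\<lambda>s. \<Phi> s * s ^ n) has_contour_integral 0) (circlepath 0 r)"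
          by (rule Cauchy_theorem_convex_simple) (use pim in auto)
      qed
      finally show ?thesis .
    qed
    have "coeff p (degree p) = 0"
      by (rule \<theta>(3)[where N = "Suc (degree p)" and x = "coeff p", OF y(1) y(2)]) (use rel in auto)
    then show False using p(1) by simp
  qed
  then show ?thesis by (simp only: c_def)
qed

lemma polydisc_shift:
  assumes "z \<in> polydisc J (\<lambda>_. 0) \<alpha>" "\<And>i. i \<in> J \<Longrightarrow> cmod (c i) < \<beta>" "\<alpha> + \<beta> \<le> \<epsilon>"
  shows "(\<lambda>i. z i + c i) \<in> polydisc J (\<lambda>_. 0) \<epsilon>"
  unfolding polydisc_def
proof (intro CollectI ballI)
  fix i assume i: "i \<in> J"
  have "cmod (z i - 0) < \<alpha>" using assms(1) i unfolding polydisc_def by blast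
  moreover have "cmod (z i + c i) \<le> cmod (z i) + cmod (c i)" by (rule norm_triangle_ineq)
  ultimately show "cmod (z i + c i - 0) < \<epsilon>" using assms(2)[OF i] assms(3) by simp
qed

text \<open>
  Levi's extension theorem: the meromorphic function is a quotient of holomorphic functions near the
  origin, even though the origin and other points of codimension two may be left out by all \<open>V n\<close>.
\<close>
lemma local_denominator:
  obtains \<epsilon> h0 g0 where "0 < \<epsilon>" "holomorphic_vars J (polydisc J (\<lambda>_. 0) \<epsilon>) h0"
    "holomorphic_vars J (polydisc J (\<lambda>_. 0) \<epsilon>) g0" "\<exists>z\<in>polydisc J (\<lambda>_. 0) \<epsilon>. h0 z \<noteq> 0"
    "\<And>z. z \<in> polydisc J (\<lambda>_. 0) \<epsilon> \<Longrightarrow> z \<in> regular \<Longrightarrow> h0 z * quot z = g0 z"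
proof -
  obtain d where d: "\<And>i. i \<in> J \<Longrightarrow> d i \<noteq> 0" and gd: "good_line (\<lambda>_. 0) d"
    using generic_direction by blast
  obtain r where r: "0 < r" "\<forall>s\<in>sphere 0 r. line (\<lambda>_. 0) d s \<in> regular"
    using regular_circle[OF gd] by blast
  define X where "X = {y. \<forall>s\<in>sphere 0 r. line y d s \<in> regular}"
  have oX: "open X"
    using open_all_compact[OF open_regular compact_sphere[of "0::complex" r] continuous_on_line2[of UNIV d]]
    by (simp add: X_def)
  have X0: "(\<lambda>_. 0) \<in> X" unfolding X_def using r(2) by blast
  have cylX: "y' \<in> X" if y: "y \<in> X" and eq: "\<And>i. i \<in> J \<Longrightarrow> y' i = y i" for y y'
    unfolding X_def
  proof (intro CollectI ballI)
    fix s :: complex assume "s \<in> sphere 0 r"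
    then have "line y d s \<in> regular" using y unfolding X_def by blast
    then show "line y' d s \<in> regular"
      by (rule holomorphic_varsD(2)[OF quot_hol]) (simp add: eq)
  qed
  obtain \<epsilon> where e: "0 < \<epsilon>" "polydisc J (\<lambda>_. 0) \<epsilon> \<subseteq> X"
    by (rule polydisc_in_open[OF oX X0 finJ cylX])
  let ?P = "polydisc J (\<lambda>_. 0) \<epsilon>"
  have oP: "open ?P" by (rule open_polydisc[OF finJ])
  have reg: "line y d s \<in> regular" if "y \<in> ?P" "s \<in> sphere 0 r" for y s
  proof -
    have "y \<in> X" using that(1) e(2) by blast
    then show ?thesis using that(2) unfolding X_def by blast
  qed
  have d': "\<forall>i\<in>J. d i \<noteq> 0" and reg': "\<forall>y\<in>?P. \<forall>s\<in>sphere 0 r. line y d s \<in> regular"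
    using d reg by blast+
  obtain N q where q0: "\<forall>i<N. holomorphic_vars J ?P (q i)" and qnz: "\<exists>i<N. \<exists>y\<in>?P. q i y \<noteq> 0"
    and rel0: "\<forall>n. \<forall>y\<in>?P.
      (\<Sum>i<N. q i y * contour_integral (circlepath 0 r) (\<lambda>s. quot (line y d s) * s ^ (n + i))) = 0"
    using recurrence_of_moments[OF d' r(1) e(1) reg'] by blast
  have q: "holomorphic_vars J ?P (q i)" if "i < N" for i using q0 that by blast
  have rel: "(\<Sum>i<N. q i y * contour_integral (circlepath 0 r) (\<lambda>s. quot (line y d s) * s ^ (n + i))) = 0"
    if "y \<in> ?P" for n y using rel0 that by blast
  define R where "R y = (\<Sum>i<N. monom (q i y) i)" for y
  have polyR: "poly (R y) s = (\<Sum>i<N. q i y * s ^ i)" for y s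
    by (simp add: R_def poly_sum poly_monom)
  obtain i1 y0 where i1: "i1 < N" "y0 \<in> ?P" "q i1 y0 \<noteq> 0" using qnz by blast
  have sub4: "polydisc J (\<lambda>_. 0) (\<epsilon> / 4) \<subseteq> ?P"
    using e(1) by (force simp: polydisc_def)
  obtain y1 where y1: "y1 \<in> polydisc J (\<lambda>_. 0) (\<epsilon> / 4)" "q i1 y1 \<noteq> 0"
  proof (rule dense_nonzero[OF finJ q[OF i1(1)] i1(2,3) open_polydisc[OF finJ] sub4])
    show "polydisc J (\<lambda>_. 0) (\<epsilon> / 4) \<noteq> {}"
      using centre_in_polydisc[of "\<epsilon> / 4" "\<lambda>_. 0" J] e(1) by force
  qed
  have "coeff (R y1) i1 = q i1 y1"
    using i1(1) by (simp add: R_def coeff_sum)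
  then have R1: "R y1 \<noteq> 0" using y1(2) by auto
  define D where "D = 1 + (\<Sum>i\<in>J. cmod (d i))"
  have D0: "0 < D" using sum_nonneg[of J "\<lambda>i. cmod (d i)"] by (simp add: D_def)
  have dD: "cmod (d i) < D" if "i \<in> J" for i
    using member_le_sum[OF that, of "\<lambda>i. cmod (d i)"] finJ by (simp add: D_def)
  \<comment> \<open>the evaluation point must not be a root of the polynomial at \<open>y1\<close>, must lie inside the circle,
    and must move points by less than \<open>\<epsilon> / 4\<close>\<close>
  define \<eta> where "\<eta> = min r (\<epsilon> / (4 * D))"
  have eta: "0 < \<eta>" using r e D0 by (simp add: \<eta>_def)
  have "infinite (ball (0::complex) \<eta>)" using eta finite_imp_not_open[of "ball (0::complex) \<eta>"] by auto
  then have "\<not> ball 0 \<eta> \<subseteq> {s. poly (R y1) s = 0}"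
    using poly_roots_finite[OF R1] finite_subset by blast
  then obtain s0 where s0: "s0 \<in> ball 0 \<eta>" "poly (R y1) s0 \<noteq> 0" by blast
  have s0r: "s0 \<in> ball 0 r" using s0(1) by (simp add: \<eta>_def)
  have s0d: "cmod (s0 * d i) < \<epsilon> / 4" if "i \<in> J" for i
  proof -
    have "cmod s0 * cmod (d i) \<le> cmod s0 * D" using dD[OF that] by (intro mult_left_mono) auto
    also have "\<dots> < (\<epsilon> / (4 * D)) * D" using s0(1) D0 by (intro mult_strict_right_mono) (auto simp: \<eta>_def)
    also have "\<dots> = \<epsilon> / 4" using D0 by simp
    finally show ?thesis by (simp add: norm_mult)
  qed
  define I where "I i y = contour_integral (circlepath 0 r) (\<lambda>s. quot (line y d s) * (s ^ i / (s - s0)))" for i y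
  define G where "G y = (\<Sum>i<N. q i y * I i y) * (1 / (2 * complex_of_real pi * \<i>))" for y
  have ne: "s - s0 \<noteq> 0" if "s \<in> sphere 0 r" for s using that s0r by auto
  have kcont: "continuous_on (sphere 0 r) (\<lambda>s. s ^ i / (s - s0))" for i
    using ne by (intro continuous_intros) auto
  have holI: "holomorphic_vars J ?P (I i)" for i
    unfolding I_def
    by (rule quot_circle_integral_holomorphic[OF r(1) oP polydisc_cylinder reg kcont])
  have constP: "holomorphic_vars J ?P (\<lambda>_. k)" for k
    by (rule holomorphic_vars_const[OF oP polydisc_cylinder])
  have holG: "holomorphic_vars J ?P G"
    unfolding G_def
  proof (rule holomorphic_vars_mult[OF holomorphic_vars_sum[OF _ _ oP polydisc_cylinder] constP])
    show "holomorphic_vars J ?P (\<lambda>y. q k y * I k y)" if "k \<in> {..<N}" for k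
      using holomorphic_vars_mult[OF q holI] that by simp
  qed simp
  define H where "H y = (\<Sum>i<N. q i y * s0 ^ i)" for y
  have holH: "holomorphic_vars J ?P H"
    unfolding H_def
  proof (rule holomorphic_vars_sum[OF _ _ oP polydisc_cylinder])
    show "holomorphic_vars J ?P (\<lambda>y. q k y * s0 ^ k)" if "k \<in> {..<N}" for k
      using holomorphic_vars_mult[OF q constP] that by simp
  qed simp
  let ?U = "?P \<inter> {y. line y d s0 \<in> regular}"
  have holF: "holomorphic_vars J {y. line y d s0 \<in> regular} (\<lambda>y. quot (line y d s0))"
    using holomorphic_vars_shift[OF quot_hol, of "\<lambda>i. s0 * d i"] by simp
  have oU: "open ?U" by (rule open_Int[OF oP holomorphic_varsD(1)[OF holF]])
  \<comment> \<open>on good lines, which are dense, this is the lemma on cleared quotients; both sides are continuous\<close>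
  have key: "H y * quot (line y d s0) = G y" if yU: "y \<in> ?U" for y
  proof (rule continuous_eq_on_dense[OF oU, where S = "{y. good_line y d \<and> (\<exists>n. y \<in> V n)}"
        and f = "\<lambda>y. H y * quot (line y d s0)" and g = G])
    show "continuous_on ?U (\<lambda>y. H y * quot (line y d s0))"
      by (rule continuous_on_mult[OF continuous_on_subset[OF holomorphic_varsD(4)[OF holH]]
            continuous_on_subset[OF holomorphic_varsD(4)[OF holF]]]) blast+
    show "continuous_on ?U G"
      by (rule continuous_on_subset[OF holomorphic_varsD(4)[OF holG]]) blast
    show "?U \<subseteq> closure {y. good_line y d \<and> (\<exists>n. y \<in> V n)}"
    proof (rule denseI[OF oU])
      fix O' assume O: "open O'" "O' \<subseteq> ?U" "O' \<noteq> {}"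
      have "\<exists>y\<in>O'. y \<in> \<Inter>{} \<and> good_line y d \<and> (\<exists>n. y \<in> V n)"
        by (rule generic_basepoint[OF d O(1,3)]) auto
      then show "\<exists>y\<in>O'. y \<in> {y. good_line y d \<and> (\<exists>n. y \<in> V n)}" by blast
    qed
    fix y assume y: "y \<in> ?U" "y \<in> {y. good_line y d \<and> (\<exists>n. y \<in> V n)}"
    have yP: "y \<in> ?P" and gl: "good_line y d" and nV: "\<exists>n. y \<in> V n" using y by blast+
    let ?S = "{s. line y d s \<in> regular}"
    obtain p \<Phi> \<Omega> where p: "p \<noteq> 0" "open \<Omega>" "cball 0 r \<subseteq> \<Omega>" "\<Phi> holomorphic_on \<Omega>"
      "\<And>s. s \<in> ?S \<Longrightarrow> s \<in> \<Omega> \<Longrightarrow> \<Phi> s = poly p s * quot (line y d s)"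
      by (rule good_line_clearing[OF gl nV, of r]) blast
    have pim: "path_image (circlepath 0 r) = sphere 0 r" using r(1) by simp
    have sub: "sphere 0 r \<subseteq> ?S" using reg[OF yP] by blast
    have contq: "continuous_on (sphere 0 r) (\<lambda>s. quot (line y d s))"
      by (rule continuous_on_subset[OF quot_line_continuous sub])
    have expand: "contour_integral (circlepath 0 r) (\<lambda>s. poly (R y) s * quot (line y d s) * k s)
        = (\<Sum>i<N. q i y * contour_integral (circlepath 0 r) (\<lambda>s. quot (line y d s) * (s ^ i * k s)))"
      if k: "continuous_on (sphere 0 r) k" for k
    proof -
      have int: "(\<lambda>s. quot (line y d s) * (s ^ i * k s)) contour_integrable_on circlepath 0 r" for i
        by (rule contour_integrable_continuous_circlepath, unfold pim)
          (rule continuous_on_mult[OF contq continuous_on_mult[OF continuous_on_power[OF continuous_on_id] k]])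
      have "contour_integral (circlepath 0 r) (\<lambda>s. poly (R y) s * quot (line y d s) * k s)
        = contour_integral (circlepath 0 r) (\<lambda>s. \<Sum>i<N. q i y * (quot (line y d s) * (s ^ i * k s)))"
        by (simp add: polyR sum_distrib_left sum_distrib_right mult_ac)
      also have "\<dots> = (\<Sum>i<N. contour_integral (circlepath 0 r) (\<lambda>s. q i y * (quot (line y d s) * (s ^ i * k s))))"
        by (rule contour_integral_sum) (auto intro: contour_integrable_lmul int)
      finally show ?thesis by (simp only: contour_integral_lmul[OF int])
    qed
    have "poly (R y) s0 * quot (line y d s0)
        = contour_integral (circlepath 0 r) (\<lambda>s. poly (R y) s * quot (line y d s) / (s - s0)) / (2 * pi * \<i>)"
    proof (rule cleared_quotient_Cauchy[OF r(1) _ good_line_dense[OF gl] sub quot_line_continuous p(1,2,3,4,5)])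
      show "open ?S" by (rule open_line_preimage[OF open_regular])
      show "contour_integral (circlepath 0 r) (\<lambda>s. poly (R y) s * quot (line y d s) * s ^ n) = 0" for n
        using expand[of "\<lambda>s. s ^ n"] rel[OF yP, of n]
        by (simp add: continuous_on_power continuous_on_id power_add mult_ac)
      show "s0 \<in> ?S" using y(1) by blast
    qed (rule s0r | assumption)+
    also have "contour_integral (circlepath 0 r) (\<lambda>s. poly (R y) s * quot (line y d s) / (s - s0))
        = (\<Sum>i<N. q i y * I i y)"
      using expand[of "\<lambda>s. 1 / (s - s0)"] ne
      by (simp add: I_def continuous_on_divide continuous_on_const continuous_on_diff continuous_on_id)
    finally show "H y * quot (line y d s0) = G y"
      by (simp add: H_def G_def polyR)
  qed (rule yU)
  let ?c = "\<lambda>i. - (s0 * d i)"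
  let ?P2 = "polydisc J (\<lambda>_. 0) (\<epsilon> / 2)"
  have inP: "(\<lambda>i. z i + ?c i) \<in> ?P" if "z \<in> ?P2" for z
    by (rule polydisc_shift[OF that, of _ "\<epsilon> / 4"]) (use s0d e(1) in auto)
  have shiftP: "holomorphic_vars J ?P2 (\<lambda>z. F (\<lambda>i. z i + ?c i))" if "holomorphic_vars J ?P F" for F
    by (rule holomorphic_vars_subset[OF holomorphic_vars_shift[OF that] open_polydisc[OF finJ] _ polydisc_cylinder])
      (use inP in blast)
  show ?thesis
  proof (rule that[of "\<epsilon> / 2" "\<lambda>z. H (\<lambda>i. z i + ?c i)" "\<lambda>z. G (\<lambda>i. z i + ?c i)"])
    show "0 < \<epsilon> / 2" using e(1) by simp
    show "holomorphic_vars J ?P2 (\<lambda>z. H (\<lambda>i. z i + ?c i))" by (rule shiftP[OF holH])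
    show "holomorphic_vars J ?P2 (\<lambda>z. G (\<lambda>i. z i + ?c i))" by (rule shiftP[OF holG])
    have "line y1 d s0 \<in> ?P2"
      by (rule polydisc_shift[OF y1(1), of _ "\<epsilon> / 4"]) (use s0d in auto)
    moreover have "H (\<lambda>i. line y1 d s0 i + ?c i) \<noteq> 0"
      using s0(2) by (simp add: H_def polyR)
    ultimately show "\<exists>z\<in>?P2. H (\<lambda>i. z i + ?c i) \<noteq> 0"
      by (intro bexI[of _ "line y1 d s0"])
    fix z assume z: "z \<in> ?P2" "z \<in> regular"
    have eqz: "line (\<lambda>i. z i + ?c i) d s0 = z" by (simp add: fun_eq_iff)
    have "H (\<lambda>i. z i + ?c i) * quot (line (\<lambda>i. z i + ?c i) d s0) = G (\<lambda>i. z i + ?c i)"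
      by (rule key) (use inP[OF z(1)] z(2) eqz in auto)
    then show "H (\<lambda>i. z i + ?c i) * quot z = G (\<lambda>i. z i + ?c i)" by (simp only: eqz)
  qed
qed

end

section \<open>Invariance under contractions\<close>

text \<open>
  This is the factor by which \<open>exp w\<close> multiplies the monomial with exponent \<open>k\<close>.
\<close>
definition character :: "nat set \<Rightarrow> (nat \<Rightarrow> nat) \<Rightarrow> (nat \<Rightarrow> complex) \<Rightarrow> complex" where
  "character J k w = exp (\<Sum>i\<in>J. of_nat (k i) * w i)"

lemma character_add: "character J k (\<lambda>i. u i + w i) = character J k u * character J k w"
  by (simp add: character_def distrib_left sum.distrib exp_add)

lemma character_scale: "character J k (\<lambda>i. of_nat n * w i) = character J k w ^ n"
proof -
  have "(\<Sum>i\<in>J. of_nat (k i) * (of_nat n * w i)) = of_nat n * (\<Sum>i\<in>J. of_nat (k i) * w i)"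
    by (simp add: sum_distrib_left mult_ac)
  then show ?thesis by (simp add: character_def exp_of_nat_mult)
qed

lemma monomial_exp_action:
  "finite J \<Longrightarrow> monomial J k (\<lambda>i. exp (w i) * z i) = character J k w * monomial J k z"
  by (simp add: monomial_def character_def exp_sum power_mult_distrib prod.distrib exp_of_nat_mult)

lemma norm_character:
  assumes "finite J"
  shows "cmod (character J k w) = monomial J k (\<lambda>i. exp (Re (w i)))"
  using assms
  by (simp add: character_def monomial_def exp_sum exp_of_nat_mult norm_power norm_exp_eq_Re flip: prod_norm)

lemma norm_character_le_1:
  assumes "finite J" "\<And>i. i \<in> J \<Longrightarrow> Re (w i) \<le> 0"
  shows "cmod (character J k w) \<le> 1"
  unfolding norm_character[OF assms(1)] monomial_def
  using assms(2) by (intro prod_le_1 conjI power_le_one) auto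

lemma finite_large_terms:
  fixes f :: "'a \<Rightarrow> real"
  assumes S: "f summable_on A" and pos: "\<And>x. x \<in> A \<Longrightarrow> 0 \<le> f x" and e: "0 < e"
  shows "finite {x \<in> A. e \<le> f x}"
proof (rule ccontr)
  assume inf: "infinite {x \<in> A. e \<le> f x}"
  obtain n :: nat where n: "infsum f A / e < n" using reals_Archimedean2 by blast
  obtain F where F: "F \<subseteq> {x \<in> A. e \<le> f x}" "finite F" "card F = n"
    using infinite_arbitrarily_large[OF inf] by blast
  have "of_nat n * e \<le> sum f F"
    using sum_bounded_below[of F e f] F by auto
  also have "\<dots> \<le> infsum f A"
    by (rule finite_sum_le_infsum[OF S F(2)]) (use F(1) pos in auto)
  finally show False using n e by (simp add: field_simps)
qed

text \<open>
  Let \<open>v\<close> be a contraction. Only finitely many exponents \<open>k\<close> have a character at \<open>v\<close> that is at least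
  half as large as that of \<open>k0\<close>. A term \<open>k1 \<noteq> k0\<close> among these is removed by passing from the sum \<open>\<sigma> w\<close>
  to \<open>\<sigma> (w + w1) - \<chi> k1 w1 * \<sigma> w\<close>, where \<open>w1\<close> separates the characters of \<open>k0\<close> and \<open>k1\<close>; this
  multiplies the term \<open>k0\<close> by a nonzero constant. In the remaining sum at \<open>n v\<close> the term \<open>k0\<close> dominates
  for large \<open>n\<close>, and hence vanishes.
\<close>
lemma character_sum_eq_0_imp_coefficients_0:
  fixes b :: "(nat \<Rightarrow> nat) \<Rightarrow> complex"
  assumes finJ: "finite J"
    and add: "\<And>u w. u \<in> G \<Longrightarrow> w \<in> G \<Longrightarrow> (\<lambda>i. u i + w i) \<in> G"
    and contr: "\<And>w i. w \<in> G \<Longrightarrow> i \<in> J \<Longrightarrow> Re (w i) < 0"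
    and v: "v \<in> G"
    and sep: "\<And>k k'. k \<in> exponents J \<Longrightarrow> k' \<in> exponents J \<Longrightarrow> k \<noteq> k' \<Longrightarrow>
        \<exists>w\<in>G. character J k w \<noteq> character J k' w"
    and bs: "(\<lambda>k. norm (b k)) summable_on exponents J"
    and zero: "\<And>w. w \<in> G \<Longrightarrow> ((\<lambda>k. character J k w * b k) has_sum 0) (exponents J)"
    and k0: "k0 \<in> exponents J"
  shows "b k0 = 0"
proof -
  let ?E = "exponents J" and ?\<chi> = "character J"
  have chi1: "cmod (?\<chi> k w) \<le> 1" if "w \<in> G" for k w
    by (rule norm_character_le_1[OF finJ]) (use contr[OF that] in \<open>simp add: less_imp_le\<close>)
  have kill: "\<exists>a. (\<lambda>k. norm (a k)) summable_on ?E
      \<and> (\<forall>w\<in>G. ((\<lambda>k. ?\<chi> k w * a k) has_sum 0) ?E) \<and> (\<forall>k\<in>A. a k = 0) \<and> (a k0 = 0 \<longrightarrow> b k0 = 0)"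
    if "finite A" "A \<subseteq> ?E - {k0}" for A
    using that
  proof (induction A rule: finite_induct)
    case empty
    then show ?case using bs zero by blast
  next
    case (insert k1 A)
    then obtain a where a: "(\<lambda>k. norm (a k)) summable_on ?E"
      "\<forall>w\<in>G. ((\<lambda>k. ?\<chi> k w * a k) has_sum 0) ?E" "\<forall>k\<in>A. a k = 0" "a k0 = 0 \<longrightarrow> b k0 = 0" by auto
    obtain w1 where w1: "w1 \<in> G" "?\<chi> k0 w1 \<noteq> ?\<chi> k1 w1"
      using sep[OF k0, of k1] insert.prems by auto
    define a' where "a' k = (?\<chi> k w1 - ?\<chi> k1 w1) * a k" for k
    have "(\<lambda>k. norm (a' k)) summable_on ?E"
    proof (rule Infinite_Sum.abs_summable_on_comparison_test'[OF summable_on_cmult_right[OF a(1), of 2]])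
      fix k
      have "cmod (?\<chi> k w1 - ?\<chi> k1 w1) \<le> 2"
        using norm_triangle_ineq4[of "?\<chi> k w1" "?\<chi> k1 w1"] chi1[OF w1(1), of k] chi1[OF w1(1), of k1] by linarith
      then show "norm (a' k) \<le> 2 * norm (a k)"
        unfolding a'_def norm_mult by (rule mult_right_mono) simp
    qed
    moreover have "((\<lambda>k. ?\<chi> k w * a' k) has_sum 0) ?E" if w: "w \<in> G" for w
    proof -
      have "((\<lambda>k. ?\<chi> k (\<lambda>i. w i + w1 i) * a k) has_sum 0) ?E"
        using a(2) add[OF w w1(1)] by blast
      moreover have "((\<lambda>k. ?\<chi> k w * a k * (- ?\<chi> k1 w1)) has_sum (0 * (- ?\<chi> k1 w1))) ?E"
        using a(2) w by (intro has_sum_cmult_left) blast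
      ultimately have "((\<lambda>k. ?\<chi> k (\<lambda>i. w i + w1 i) * a k + ?\<chi> k w * a k * (- ?\<chi> k1 w1)) has_sum (0 + 0 * (- ?\<chi> k1 w1))) ?E"
        by (rule has_sum_add)
      then show ?thesis by (simp add: a'_def character_add algebra_simps)
    qed
    moreover have "a' k = 0" if "k \<in> insert k1 A" for k
      using a(3) that by (auto simp: a'_def)
    moreover have "a' k0 = 0 \<longrightarrow> b k0 = 0"
      using a(4) w1(2) by (simp add: a'_def)
    ultimately show ?case by blast
  qed
  define \<rho> where "\<rho> = cmod (?\<chi> k0 v)"
  have rho: "0 < \<rho>" by (simp add: \<rho>_def character_def)
  define A where "A = {k \<in> ?E. \<rho> / 2 \<le> cmod (?\<chi> k v)} - {k0}"
  have "finite {k \<in> ?E. \<rho> / 2 \<le> cmod (?\<chi> k v)}"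
  proof (rule finite_large_terms)
    show "(\<lambda>k. cmod (?\<chi> k v)) summable_on ?E"
      unfolding norm_character[OF finJ]
      by (rule summable_on_monomial[OF finJ]) (use contr[OF v] in auto)
  qed (use rho in auto)
  then have "finite A" by (simp add: A_def)
  moreover have "A \<subseteq> ?E - {k0}" by (auto simp: A_def)
  ultimately have "\<exists>a. (\<lambda>k. norm (a k)) summable_on ?E
      \<and> (\<forall>w\<in>G. ((\<lambda>k. ?\<chi> k w * a k) has_sum 0) ?E) \<and> (\<forall>k\<in>A. a k = 0) \<and> (a k0 = 0 \<longrightarrow> b k0 = 0)"
    by (rule kill)
  then obtain a where a: "(\<lambda>k. norm (a k)) summable_on ?E"
      "\<forall>w\<in>G. ((\<lambda>k. ?\<chi> k w * a k) has_sum 0) ?E" "\<forall>k\<in>A. a k = 0" "a k0 = 0 \<longrightarrow> b k0 = 0"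
    by (elim exE conjE)
  define S where "S = infsum (\<lambda>k. norm (a k)) ?E"
  have multv: "(\<lambda>i. of_nat (Suc n) * v i) \<in> G" for n
  proof (induction n)
    case 0
    then show ?case using v by simp
  next
    case (Suc n)
    from add[OF this v] show ?case by (simp add: algebra_simps)
  qed
  have bound: "norm (a k0) \<le> S * (1 / 2) ^ Suc n" for n
  proof -
    let ?t = "\<lambda>k. ?\<chi> k v ^ Suc n * a k"
    have "(?t has_sum 0) ?E"
      using bspec[OF a(2) multv[of n]] by (simp only: character_scale)
    then have tail: "(?t has_sum (0 - ?t k0)) (?E - {k0})"
      by (rule has_sum_Diff) (use k0 in \<open>auto intro: has_sum_finiteI\<close>)
    have a1: "(\<lambda>k. norm (a k)) summable_on (?E - {k0})"
      by (rule summable_on_subset_banach[OF a(1)]) auto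
    have "norm (0 - ?t k0) \<le> (\<rho> / 2) ^ Suc n * infsum (\<lambda>k. norm (a k)) (?E - {k0})"
    proof (rule norm_infsum_le[OF tail has_sum_cmult_right[OF has_sum_infsum[OF a1]]])
      fix k assume k: "k \<in> ?E - {k0}"
      show "norm (?t k) \<le> (\<rho> / 2) ^ Suc n * norm (a k)"
      proof (cases "k \<in> A")
        case True
        then show ?thesis using a(3) by simp
      next
        case False
        then have "cmod (?\<chi> k v) \<le> \<rho> / 2" using k by (auto simp: A_def)
        then show ?thesis
          unfolding norm_mult norm_power by (intro mult_right_mono power_mono) auto
      qed
    qed
    also have "\<dots> \<le> (\<rho> / 2) ^ Suc n * S"
      unfolding S_def using rho
      by (intro mult_left_mono infsum_mono_neutral[OF a1 a(1)]) auto
    finally have "\<rho> ^ Suc n * norm (a k0) \<le> \<rho> ^ Suc n * (S * (1 / 2) ^ Suc n)"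
      by (simp add: norm_mult norm_power \<rho>_def power_divide mult_ac)
    then show ?thesis using rho by (simp del: power_Suc)
  qed
  have "(\<lambda>n. S * (1 / 2) ^ Suc n) \<longlonglongrightarrow> S * 0"
    by (intro tendsto_mult_left LIMSEQ_Suc LIMSEQ_power_zero) simp
  then have "norm (a k0) \<le> S * 0"
    by (rule Lim_bounded2) (use bound in auto)
  then show ?thesis using a(4) by simp
qed

context local_quotients
begin

text \<open>
  The quotient is constant near the origin by comparison of power series. Points off the coordinate
  hyperplanes are moved there by a contraction, and the others are reached by continuity.
\<close>
theorem quot_constant:
  assumes add: "\<And>u w. u \<in> G \<Longrightarrow> w \<in> G \<Longrightarrow> (\<lambda>i. u i + w i) \<in> G"
    and contr: "\<And>w i. w \<in> G \<Longrightarrow> i \<in> J \<Longrightarrow> Re (w i) < 0"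
    and v: "v \<in> G"
    and sep: "\<And>k k'. k \<in> exponents J \<Longrightarrow> k' \<in> exponents J \<Longrightarrow> k \<noteq> k' \<Longrightarrow>
        \<exists>w\<in>G. character J k w \<noteq> character J k' w"
    and inv: "\<And>n z w. z \<in> V n \<Longrightarrow> w \<in> G \<Longrightarrow> (\<lambda>i. exp (w i) * z i) \<in> V n
        \<and> g n (\<lambda>i. exp (w i) * z i) = g n z \<and> h n (\<lambda>i. exp (w i) * z i) = h n z"
  shows "\<exists>c. \<forall>z\<in>regular. quot z = c"
proof -
  let ?E = "exponents J"
  have inv_quot: "(\<lambda>i. exp (w i) * z i) \<in> regular \<and> quot (\<lambda>i. exp (w i) * z i) = quot z"
    if z: "z \<in> regular" and w: "w \<in> G" for z w
  proof -
    let ?z = "\<lambda>i. exp (w i) * z i"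
    obtain n where n: "z \<in> V n" "h n z \<noteq> 0" using z by (auto simp: regular_def)
    have n': "?z \<in> V n" "g n ?z = g n z" "h n ?z = h n z" using inv[OF n(1) w] by blast+
    then have reg: "?z \<in> regular" using n(2) unfolding regular_def by auto
    have "quot ?z * h n z = quot z * h n z"
      using quot_eq[OF reg n'(1)] quot_eq[OF z n(1)] n' by simp
    then show ?thesis using reg n(2) by simp
  qed
  obtain \<epsilon> h0 g0 where e: "0 < \<epsilon>" and h0: "holomorphic_vars J (polydisc J (\<lambda>_. 0) \<epsilon>) h0"
    and g0: "holomorphic_vars J (polydisc J (\<lambda>_. 0) \<epsilon>) g0" and nz: "\<exists>z\<in>polydisc J (\<lambda>_. 0) \<epsilon>. h0 z \<noteq> 0"
    and eq: "\<And>z. z \<in> polydisc J (\<lambda>_. 0) \<epsilon> \<Longrightarrow> z \<in> regular \<Longrightarrow> h0 z * quot z = g0 z"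
    by (rule local_denominator) blast
  have z0: "(\<lambda>_. 0) \<in> polydisc J (\<lambda>_. 0) \<epsilon>" by (rule centre_in_polydisc[OF e])
  obtain r1 c1 M1 where r1: "0 < r1" "polydisc J (\<lambda>_. 0) r1 \<subseteq> polydisc J (\<lambda>_. 0) \<epsilon>"
    and c1: "\<And>k. k \<in> ?E \<Longrightarrow> cmod (c1 k) \<le> M1 / r1 ^ (\<Sum>i\<in>J. k i)"
    and s1: "\<And>z. z \<in> polydisc J (\<lambda>_. 0) r1 \<Longrightarrow> ((\<lambda>k. c1 k * monomial J k (\<lambda>i. z i - 0)) has_sum h0 z) ?E"
    by (rule local_power_series[OF finJ h0 z0]) blast
  obtain r2 c2 M2 where r2: "0 < r2" "polydisc J (\<lambda>_. 0) r2 \<subseteq> polydisc J (\<lambda>_. 0) \<epsilon>"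
    and c2: "\<And>k. k \<in> ?E \<Longrightarrow> cmod (c2 k) \<le> M2 / r2 ^ (\<Sum>i\<in>J. k i)"
    and s2: "\<And>z. z \<in> polydisc J (\<lambda>_. 0) r2 \<Longrightarrow> ((\<lambda>k. c2 k * monomial J k (\<lambda>i. z i - 0)) has_sum g0 z) ?E"
    by (rule local_power_series[OF finJ g0 z0]) blast
  define r where "r = min r1 r2"
  have r: "0 < r" using r1 r2 by (simp add: r_def)
  have sub: "polydisc J (\<lambda>_. 0) r \<subseteq> polydisc J (\<lambda>_. 0) r1" "polydisc J (\<lambda>_. 0) r \<subseteq> polydisc J (\<lambda>_. 0) r2"
    by (auto simp: polydisc_def r_def)
  have coeffs: "monomial J k z * (quot z * c1 k - c2 k) = 0"
    if z: "z \<in> polydisc J (\<lambda>_. 0) r" "z \<in> regular" and k: "k \<in> ?E" for z k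
  proof -
    have zr: "cmod (z i) < r1" "cmod (z i) < r2" if "i \<in> J" for i
      using z(1) that by (auto simp: polydisc_def r_def)
    define b where "b k = monomial J k z * (quot z * c1 k - c2 k)" for k
    have "b k = 0"
    proof (rule character_sum_eq_0_imp_coefficients_0[where G = G and v = v and b = b, OF finJ])
      have S1: "(\<lambda>k. cmod (c1 k) * monomial J k (\<lambda>i. cmod (z i))) summable_on ?E"
        by (rule power_series_summable[OF finJ r1(1) c1 zr(1)]) auto
      have S2: "(\<lambda>k. cmod (c2 k) * monomial J k (\<lambda>i. cmod (z i))) summable_on ?E"
        by (rule power_series_summable[OF finJ r2(1) c2 zr(2)]) auto
      show "(\<lambda>k. norm (b k)) summable_on ?E"
      proof (rule Infinite_Sum.abs_summable_on_comparison_test'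
          [OF summable_on_add[OF summable_on_cmult_right[OF S1, of "cmod (quot z)"] S2]])
        fix k
        have "0 \<le> monomial J k (\<lambda>i. cmod (z i))" by (auto simp: monomial_def intro!: prod_nonneg)
        moreover have "cmod (quot z * c1 k - c2 k) \<le> cmod (quot z) * cmod (c1 k) + cmod (c2 k)"
          using norm_triangle_ineq4[of "quot z * c1 k" "c2 k"] by (simp add: norm_mult)
        ultimately have "monomial J k (\<lambda>i. cmod (z i)) * cmod (quot z * c1 k - c2 k)
            \<le> monomial J k (\<lambda>i. cmod (z i)) * (cmod (quot z) * cmod (c1 k) + cmod (c2 k))"
          by (intro mult_left_mono)
        then show "norm (b k) \<le> cmod (quot z) * (cmod (c1 k) * monomial J k (\<lambda>i. cmod (z i)))
            + cmod (c2 k) * monomial J k (\<lambda>i. cmod (z i))"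
          unfolding b_def norm_mult norm_monomial by (simp add: algebra_simps)
      qed
      fix w assume w: "w \<in> G"
      let ?z = "\<lambda>i. exp (w i) * z i"
      have inr: "?z \<in> polydisc J (\<lambda>_. 0) r"
        unfolding polydisc_def
      proof (intro CollectI ballI)
        fix i assume i: "i \<in> J"
        have "cmod (exp (w i)) * cmod (z i) \<le> 1 * cmod (z i)"
          using contr[OF w i] by (intro mult_right_mono) auto
        then show "cmod (?z i - 0) < r" using z(1) i by (auto simp: norm_mult polydisc_def)
      qed
      have "?z \<in> polydisc J (\<lambda>_. 0) \<epsilon>" using inr sub(1) r1(2) by blast
      then have hg: "h0 ?z * quot z = g0 ?z" using eq inv_quot[OF z(2) w] by metis
      have "((\<lambda>k. c1 k * monomial J k ?z * quot z) has_sum h0 ?z * quot z) ?E"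
        using s1[of ?z] inr sub(1) by (intro has_sum_cmult_left) auto
      moreover have "((\<lambda>k. c2 k * monomial J k ?z * (- 1)) has_sum g0 ?z * (- 1)) ?E"
        using s2[of ?z] inr sub(2) by (intro has_sum_cmult_left) auto
      ultimately have "((\<lambda>k. c1 k * monomial J k ?z * quot z + c2 k * monomial J k ?z * (- 1))
          has_sum (h0 ?z * quot z + g0 ?z * (- 1))) ?E"
        by (rule has_sum_add)
      then have "((\<lambda>k. c1 k * monomial J k ?z * quot z + c2 k * monomial J k ?z * (- 1)) has_sum 0) ?E"
        by (simp add: hg)
      then show "((\<lambda>k. character J k w * b k) has_sum 0) ?E"
        unfolding monomial_exp_action[OF finJ] by (simp add: b_def algebra_simps)
    qed (rule k add contr v sep; assumption)+
    then show ?thesis by (simp add: b_def)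
  qed
  obtain k1 where k1: "k1 \<in> ?E" "c1 k1 \<noteq> 0"
  proof (rule ccontr)
    assume "\<not> thesis"
    then have c0: "c1 k = 0" if "k \<in> ?E" for k using that \<open>\<And>k1. k1 \<in> ?E \<Longrightarrow> c1 k1 \<noteq> 0 \<Longrightarrow> thesis\<close> by blast
    have h00: "h0 z = 0" if "z \<in> polydisc J (\<lambda>_. 0) r1" for z
    proof -
      have "((\<lambda>k. c1 k * monomial J k (\<lambda>i. z i - 0)) has_sum 0) ?E"
        by (rule has_sum_0) (simp add: c0)
      then show ?thesis using s1[OF that] has_sum_unique by blast
    qed
    have "h0 z = 0" if "z \<in> polydisc J (\<lambda>_. 0) \<epsilon>" for z
      by (rule identity_theorem[OF finJ h0 open_polydisc[OF finJ] r1(2) _ h00 that])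
        (use centre_in_polydisc[OF r1(1)] in blast)
    then show False using nz by blast
  qed
  define c where "c = c2 k1 / c1 k1"
  have small: "quot z = c" if "z \<in> polydisc J (\<lambda>_. 0) r" "z \<in> regular" "\<forall>i\<in>J. z i \<noteq> 0" for z
  proof -
    have "monomial J k1 z \<noteq> 0" using that(3) finJ by (simp add: monomial_def)
    then show ?thesis using coeffs[OF that(1,2) k1(1)] k1(2) by (simp add: c_def field_simps)
  qed
  have torus: "quot z = c" if z: "z \<in> regular" "\<forall>i\<in>J. z i \<noteq> 0" for z
  proof -
    have lim: "(\<lambda>n. exp (Re (v i)) ^ n * cmod (z i)) \<longlonglongrightarrow> 0" if "i \<in> J" for i
      using contr[OF v that] by (intro tendsto_mult_left_zero LIMSEQ_power_zero) simp
    have "\<forall>\<^sub>F n in sequentially. \<forall>i\<in>J. exp (Re (v i)) ^ n * cmod (z i) < r"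
      using order_tendstoD(2)[OF lim r] by (intro eventually_ball_finite[OF finJ]) auto
    then obtain n where n: "\<forall>i\<in>J. exp (Re (v i)) ^ n * cmod (z i) < r"
      using eventually_happens trivial_limit_sequentially by blast
    define y where "y m = (\<lambda>i. exp (v i) ^ m * z i)" for m
    have y: "y m \<in> regular \<and> quot (y m) = quot z" for m
    proof (induction m)
      case 0
      then show ?case using z by (simp add: y_def)
    next
      case (Suc m)
      have "y (Suc m) = (\<lambda>i. exp (v i) * y m i)" by (simp add: y_def fun_eq_iff)
      then show ?case using inv_quot[of "y m" v] Suc v by simp
    qed
    have "quot (y n) = c"
    proof (rule small)
      show "y n \<in> polydisc J (\<lambda>_. 0) r"
        unfolding polydisc_def
        using n by (auto simp: y_def norm_mult norm_power norm_exp_eq_Re)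
    qed (use y z in \<open>auto simp: y_def\<close>)
    then show ?thesis using y by simp
  qed
  have "quot z = c" if z: "z \<in> regular" for z
  proof (rule continuous_eq_on_dense[where U = regular and S = "{z. \<forall>i\<in>J. z i \<noteq> 0}" and f = quot and g = "\<lambda>_. c"])
    show "regular \<subseteq> closure {z. \<forall>i\<in>J. z i \<noteq> 0}"
    proof (rule denseI[OF open_regular])
      fix O' :: "(nat \<Rightarrow> complex) set" assume O: "open O'" "O' \<noteq> {}"
      have "O' \<inter> \<Inter>((\<lambda>i. {z. z i \<noteq> 0}) ` J) \<noteq> {}"
      proof (rule Baire_open[OF O])
        show "countable ((\<lambda>i. {z. z i \<noteq> 0}) ` J :: (nat \<Rightarrow> complex) set set)"
          using finJ by (intro countable_finite) auto
        fix T :: "(nat \<Rightarrow> complex) set" assume "T \<in> (\<lambda>i. {z. z i \<noteq> 0}) ` J"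
        then obtain i where T: "T = {z. z i \<noteq> 0}" by blast
        show "open T" unfolding T
          by (intro open_Collect_neq continuous_on_const continuous_on_product_then_coordinatewise[OF continuous_on_id])
        have "UNIV \<subseteq> closure T"
        proof (rule dense_avoid_coordinate[where i = i])
          show "\<exists>c. \<forall>t. t \<noteq> c \<longrightarrow> y(i := t) \<in> T" for y by (rule exI[of _ 0]) (simp add: T)
        qed
        then show "O' \<subseteq> closure T" by blast
      qed
      then show "\<exists>x\<in>O'. x \<in> {z. \<forall>i\<in>J. z i \<noteq> 0}" by blast
    qed
  qed (use open_regular holomorphic_varsD(4)[OF quot_hol] torus z in auto)
  then show ?thesis by blast
qed

end

section \<open>Exponent subspaces\<close>

lemma exp_2pi_i_eq_1_imp_int:
  fixes x :: complex
  assumes "exp (2 * pi * \<i> * x) = 1"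
  shows "\<exists>n :: int. x = of_int n"
proof -
  obtain n :: int where n: "Re (2 * pi * \<i> * x) = 0" "Im (2 * pi * \<i> * x) = of_int (2 * n) * pi"
    using assms unfolding exp_eq_1 by blast
  have "Im x = 0" using n(1) by simp
  moreover have "Re x = of_int n" using n(2) by simp
  ultimately show ?thesis by (intro exI[of _ n]) (simp add: complex_eq_iff)
qed

text \<open>
  Here \<open>W\<close> is the Lie algebra \<open>\<cc>\<close> of the group acting on the complement of the coordinate subspaces, and
  \<open>Gh\<close> is the set of ghost vertices.
\<close>
locale exponent_subspace =
  fixes J Gh :: "nat set" and W :: "(nat \<Rightarrow> complex) set"
  assumes finJ: "finite J" and finGh: "finite Gh" and disj: "J \<inter> Gh = {}" and card_Gh: "card Gh \<le> 1"
    and W_ne: "W \<noteq> {}"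
    and W_add: "\<And>u w. u \<in> W \<Longrightarrow> w \<in> W \<Longrightarrow> (\<lambda>i. u i + w i) \<in> W"
    and W_scale: "\<And>c w. w \<in> W \<Longrightarrow> (\<lambda>i. c * w i) \<in> W"
    and no_integral_relation: "\<And>\<kappa> :: nat \<Rightarrow> int. (\<And>w. w \<in> W \<Longrightarrow> (\<Sum>i\<in>J \<union> Gh. of_int (\<kappa> i) * w i) = 0)
        \<Longrightarrow> (\<And>i. i \<in> J \<union> Gh \<Longrightarrow> \<kappa> i = 0)"
    and contracting: "\<exists>w\<in>W. (\<forall>i\<in>J. Re (w i) < 0) \<and> (\<forall>g\<in>Gh. Re (w g) = 0)"
begin

lemma Gh_cases:
  obtains "Gh = {}" | g where "Gh = {g}"
proof -
  have "card Gh = 0 \<or> card Gh = 1" using card_Gh by linarith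
  then show ?thesis using that finGh by (auto simp: card_1_singleton_iff)
qed

text \<open>
  If the ghost coordinate vanished on \<open>W\<close>, it would itself be an integral relation.
\<close>
lemma ghost_unit: "\<exists>w\<in>W. \<forall>g\<in>Gh. w g = 1"
proof (cases rule: Gh_cases)
  case 1
  then show ?thesis using W_ne by auto
next
  case (2 g)
  have "\<exists>w\<in>W. w g \<noteq> 0"
  proof (rule ccontr)
    assume no: "\<not> ?thesis"
    define \<kappa> :: "nat \<Rightarrow> int" where "\<kappa> i = (if i = g then 1 else 0)" for i
    have "(\<Sum>i\<in>J \<union> Gh. of_int (\<kappa> i) * w i) = 0" if "w \<in> W" for w
    proof (rule sum.neutral, rule ballI)
      show "of_int (\<kappa> i) * w i = 0" for i using no that by (auto simp: \<kappa>_def)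
    qed
    then have "\<kappa> g = 0" by (rule no_integral_relation) (auto simp: 2)
    then show False by (simp add: \<kappa>_def)
  qed
  then obtain w where w: "w \<in> W" "w g \<noteq> 0" by blast
  have "(\<lambda>i. (1 / w g) * w i) \<in> W" by (rule W_scale[OF w(1)])
  then show ?thesis using w(2) 2 by (intro bexI[of _ "\<lambda>i. (1 / w g) * w i"]) auto
qed

text \<open>
  These are the elements whose exponentials fix the ghost coordinate and shrink all the others.
\<close>
definition contractions :: "(nat \<Rightarrow> complex) set" where
  "contractions = {w \<in> W. (\<forall>g\<in>Gh. \<exists>k :: int. w g = 2 * pi * \<i> * of_int k) \<and> (\<forall>i\<in>J. Re (w i) < 0)}"

lemma contractions_add:
  assumes u: "u \<in> contractions" and w: "w \<in> contractions"
  shows "(\<lambda>i. u i + w i) \<in> contractions"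
proof -
  have "\<exists>k :: int. u g + w g = 2 * pi * \<i> * of_int k" if g: "g \<in> Gh" for g
  proof -
    obtain k k' :: int where "u g = 2 * pi * \<i> * of_int k" "w g = 2 * pi * \<i> * of_int k'"
      using u w g unfolding contractions_def by blast
    then have "u g + w g = 2 * pi * \<i> * of_int (k + k')" by (simp add: distrib_left)
    then show ?thesis by blast
  qed
  moreover have "Re (u i + w i) < 0" if "i \<in> J" for i
    using u w that unfolding contractions_def by (simp add: add_neg_neg)
  moreover have "(\<lambda>i. u i + w i) \<in> W" using W_add u w unfolding contractions_def by blast
  ultimately show ?thesis unfolding contractions_def by simp
qed

text \<open>
  Start from \<open>w\<close> with negative real parts on \<open>J\<close> and purely imaginary ghost coordinate. Adding a small
  multiple \<open>i \<delta> u\<close>, where \<open>u\<close> has ghost coordinate \<open>1\<close>, makes the ghost coordinate nonzero and leaves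
  the real parts negative; a positive multiple then has ghost coordinate \<open>2\<pi>i\<close> or \<open>-2\<pi>i\<close>.
\<close>
lemma contractions_nonempty: "contractions \<noteq> {}"
proof -
  obtain w where w: "w \<in> W" "\<And>i. i \<in> J \<Longrightarrow> Re (w i) < 0" "\<And>g. g \<in> Gh \<Longrightarrow> Re (w g) = 0"
    using contracting by blast
  show ?thesis
  proof (cases rule: Gh_cases)
    case 1
    then have "w \<in> contractions" unfolding contractions_def using w by auto
    then show ?thesis by blast
  next
    case (2 g)
    obtain u where u: "u \<in> W" "u g = 1" using ghost_unit 2 by auto
    have lim: "(\<lambda>\<delta>. Re (w i) - \<delta> * Im (u i)) \<midarrow>0\<rightarrow> Re (w i) - 0 * Im (u i)" for i
      by (intro tendsto_intros)
    have "\<forall>\<^sub>F \<delta> in at 0. Re (w i) - \<delta> * Im (u i) < 0" if i: "i \<in> J" for i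
      by (rule order_tendstoD(2)[OF lim]) (use w(2)[OF i] in simp)
    then have "\<forall>\<^sub>F \<delta> in at 0. \<forall>i\<in>J. Re (w i) - \<delta> * Im (u i) < 0"
      by (intro eventually_ball_finite[OF finJ]) blast
    moreover have "\<forall>\<^sub>F \<delta> in at 0. \<delta> \<noteq> - Im (w g)"
      using t1_space_nhds[of 0 "- Im (w g)"] eventually_at_filter
      by (cases "Im (w g) = 0") (auto simp: eventually_at_filter elim: eventually_mono)
    ultimately have "\<forall>\<^sub>F \<delta> in at 0. (\<forall>i\<in>J. Re (w i) - \<delta> * Im (u i) < 0) \<and> \<delta> \<noteq> - Im (w g)"
      by (rule eventually_conj)
    then obtain \<delta> where d: "\<And>i. i \<in> J \<Longrightarrow> Re (w i) - \<delta> * Im (u i) < 0" "\<delta> \<noteq> - Im (w g)"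
      using eventually_happens[of _ "at (0 :: real)"] trivial_limit_at[of "0 :: real"] by blast
    define \<beta> where "\<beta> = Im (w g) + \<delta>"
    have b: "\<beta> \<noteq> 0" using d(2) by (auto simp: \<beta>_def)
    define x where "x i = w i + (\<i> * \<delta>) * u i" for i
    have xW: "x \<in> W" unfolding x_def using W_add[OF w(1) W_scale[OF u(1)]] by simp
    have xg: "x g = \<i> * \<beta>"
      using w(3)[of g] 2 u(2) by (simp add: x_def \<beta>_def complex_eq_iff)
    have xJ: "Re (x i) < 0" if "i \<in> J" for i using d(1)[OF that] by (simp add: x_def)
    define c where "c = 2 * pi / \<bar>\<beta>\<bar>"
    have c: "0 < c" using b by (simp add: c_def)
    have "(\<lambda>i. of_real c * x i) \<in> W" by (rule W_scale[OF xW])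
    moreover have "Re (of_real c * x i) < 0" if "i \<in> J" for i
      using xJ[OF that] c by (simp add: mult_pos_neg)
    moreover have "of_real c * x g = 2 * pi * \<i> * of_int (if 0 < \<beta> then 1 else - 1)"
      using b by (auto simp: xg c_def abs_if field_simps)
    ultimately have "(\<lambda>i. of_real c * x i) \<in> contractions"
      unfolding contractions_def by (auto simp: 2)
    then show ?thesis by blast
  qed
qed

text \<open>
  If two characters agree on the contractions, then they agree on all \<open>w \<in> W\<close> with ghost coordinate in
  \<open>2\<pi>i\<int>\<close>, because \<open>w + n v\<close> is a contraction for large \<open>n\<close>. So the linear form \<open>L = k - k'\<close> takes
  values in \<open>2\<pi>i\<int>\<close> there. It vanishes on the subspace where the ghost coordinate is zero, and is
  therefore an integral multiple of the ghost coordinate. This is an integral relation on \<open>W\<close>.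
\<close>
lemma contractions_separate:
  assumes k: "k \<in> exponents J" and k': "k' \<in> exponents J" and ne: "k \<noteq> k'"
  shows "\<exists>w\<in>contractions. character J k w \<noteq> character J k' w"
proof (rule ccontr)
  assume no: "\<not> ?thesis"
  let ?L = "\<lambda>w. \<Sum>i\<in>J. (of_nat (k i) - of_nat (k' i)) * w i :: complex"
  have Ladd: "?L (\<lambda>i. u i + w i) = ?L u + ?L w" for u w
    by (simp add: distrib_left sum.distrib)
  have Lscale: "?L (\<lambda>i. c * w i) = c * ?L w" for c w
    by (simp add: sum_distrib_left mult_ac)
  have Lc: "exp (?L w) = 1" if "w \<in> contractions" for w
  proof -
    have "character J k w = character J k' w" using no that by blast
    moreover have "exp (?L w) = character J k w / character J k' w"
      by (simp add: character_def left_diff_distrib sum_subtractf exp_diff)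
    ultimately show ?thesis by (simp add: character_def)
  qed
  obtain v where v: "v \<in> contractions" using contractions_nonempty by blast
  have trivial: "exp (?L w) = 1" if w: "w \<in> W" "\<And>g. g \<in> Gh \<Longrightarrow> \<exists>j :: int. w g = 2 * pi * \<i> * of_int j" for w
  proof -
    have neg: "Re (v i) < 0" if "i \<in> J" for i using v that unfolding contractions_def by blast
    have "\<exists>n :: nat. \<forall>i\<in>J. Re (w i) < real n * - Re (v i)"
    proof -
      have "\<exists>N. \<forall>n\<ge>N. Re (w i) < real n * - Re (v i)" if i: "i \<in> J" for i
      proof -
        obtain N :: nat where N: "Re (w i) < real N * - Re (v i)"
          using reals_Archimedean3[of "- Re (v i)"] neg[OF i] by auto
        have "Re (w i) < real n * - Re (v i)" if "n \<ge> N" for n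
        proof -
          have "real N * - Re (v i) \<le> real n * - Re (v i)"
            using that neg[OF i] by (intro mult_right_mono) auto
          then show ?thesis using N by linarith
        qed
        then show ?thesis by blast
      qed
      then have "\<forall>\<^sub>F n in sequentially. \<forall>i\<in>J. Re (w i) < real n * - Re (v i)"
        by (intro eventually_ball_finite[OF finJ]) (simp add: eventually_sequentially)
      then show ?thesis using eventually_happens trivial_limit_sequentially by blast
    qed
    then obtain n :: nat where n: "\<And>i. i \<in> J \<Longrightarrow> Re (w i) < real n * - Re (v i)" by blast
    let ?u = "\<lambda>i. w i + of_nat n * v i"
    have "?u \<in> W" using W_add[OF w(1) W_scale[of v]] v unfolding contractions_def by blast
    moreover have "Re (?u i) < 0" if "i \<in> J" for i using n[OF that] by simp
    moreover have "\<exists>j :: int. ?u g = 2 * pi * \<i> * of_int j" if g: "g \<in> Gh" for g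
    proof -
      obtain j1 j2 :: int where "w g = 2 * pi * \<i> * of_int j1" "v g = 2 * pi * \<i> * of_int j2"
        using w(2)[OF g] v g unfolding contractions_def by blast
      then have "?u g = 2 * pi * \<i> * of_int (j1 + int n * j2)" by (simp add: algebra_simps)
      then show ?thesis by blast
    qed
    ultimately have "?u \<in> contractions" unfolding contractions_def by simp
    from Lc[OF this] have "exp (?L w + of_nat n * ?L v) = 1"
      unfolding Ladd Lscale .
    then show ?thesis using Lc[OF v] by (simp add: exp_add exp_of_nat_mult)
  qed
  have L0: "?L w = 0" if w: "w \<in> W" "\<And>g. g \<in> Gh \<Longrightarrow> w g = 0" for w
  proof (rule ccontr)
    assume nz: "?L w \<noteq> 0"
    have "exp (?L (\<lambda>i. (1 / ?L w) * w i)) = 1"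
      by (rule trivial[OF W_scale[OF w(1)]]) (use w(2) in \<open>auto intro: exI[of _ 0]\<close>)
    then have "exp (1 :: complex) = 1" unfolding Lscale using nz by simp
    then have "Re (exp (1 :: complex)) = 1" by simp
    then show False using exp_gt_one[of "1 :: real"] by (simp add: Re_exp)
  qed
  obtain u where u: "u \<in> W" "\<And>g. g \<in> Gh \<Longrightarrow> u g = 1" using ghost_unit by blast
  have "exp (?L (\<lambda>i. (2 * pi * \<i>) * u i)) = 1"
    by (rule trivial[OF W_scale[OF u(1)]]) (use u(2) in \<open>auto intro: exI[of _ 1]\<close>)
  then have "exp ((2 * pi * \<i>) * ?L u) = 1" unfolding Lscale .
  then obtain \<mu> :: int where lam: "?L u = of_int \<mu>"
    using exp_2pi_i_eq_1_imp_int by blast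
  define \<kappa> :: "nat \<Rightarrow> int" where "\<kappa> i = (if i \<in> J then int (k i) - int (k' i) else - \<mu>)" for i
  have "(\<Sum>i\<in>J \<union> Gh. of_int (\<kappa> i) * w i) = 0" if w: "w \<in> W" for w
  proof -
    have "(\<Sum>i\<in>J. of_int (\<kappa> i) * w i) = ?L w"
      by (rule sum.cong) (auto simp: \<kappa>_def)
    moreover have "(\<Sum>i\<in>Gh. of_int (\<kappa> i) * w i) = (\<Sum>i\<in>Gh. - of_int \<mu> * w i)"
      by (rule sum.cong) (use disj in \<open>auto simp: \<kappa>_def\<close>)
    moreover have "?L w = (\<Sum>i\<in>Gh. of_int \<mu> * w i)"
    proof (cases rule: Gh_cases)
      case 1
      then show ?thesis using L0[OF w] by simp
    next
      case (2 g)
      have "(\<lambda>i. w i + (- w g) * u i) \<in> W" by (rule W_add[OF w W_scale[OF u(1)]])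
      then have "?L (\<lambda>i. w i + (- w g) * u i) = 0" by (rule L0) (use 2 u(2) in auto)
      then have "?L w + (- w g) * ?L u = 0" unfolding Ladd Lscale .
      moreover have "x = b * a" if "x + (- a) * b = 0" for x a b :: complex
        using that by (simp add: add_eq_0_iff mult.commute)
      ultimately have "?L w = ?L u * w g" by blast
      then show ?thesis unfolding lam by (simp add: 2)
    qed
    ultimately show ?thesis
      using sum.union_disjoint[OF finJ finGh disj, of "\<lambda>i. of_int (\<kappa> i) * w i"] by (simp add: sum_negf)
  qed
  then have \<kappa>0: "\<kappa> i = 0" if "i \<in> J" for i using that no_integral_relation[of \<kappa> i] by blast
  have "k i = k' i" for i
  proof (cases "i \<in> J")
    case True
    then show ?thesis using \<kappa>0[OF True] by (simp add: \<kappa>_def)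
  next
    case False
    then show ?thesis using k k' by (simp add: exponents_def)
  qed
  then show False using ne by auto
qed

end

section \<open>The exponent subspace of a complete fan\<close>

lemma underdetermined_system:
  fixes y :: "'j \<Rightarrow> 'i \<Rightarrow> real"
  assumes "finite I" "finite U" "card I < card U"
  shows "\<exists>x. (\<exists>j\<in>U. x j \<noteq> 0) \<and> (\<forall>i\<in>I. (\<Sum>j\<in>U. x j * y j i) = 0)"
  using assms
proof (induction I arbitrary: U y rule: finite_induct)
  case empty
  then have "U \<noteq> {}" by auto
  then show ?case by (intro exI[of _ "\<lambda>_. 1"]) auto
next
  case (insert i I)
  show ?case
  proof (cases "\<forall>j\<in>U. y j i = 0")
    case True
    have "\<exists>x. (\<exists>j\<in>U. x j \<noteq> 0) \<and> (\<forall>i\<in>I. (\<Sum>j\<in>U. x j * y j i) = 0)"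
      using insert.hyps insert.prems by (intro insert.IH) auto
    then obtain x where x: "\<exists>j\<in>U. x j \<noteq> 0" "\<forall>i\<in>I. (\<Sum>j\<in>U. x j * y j i) = 0" by blast
    have "(\<Sum>j\<in>U. x j * y j i) = 0" by (rule sum.neutral) (use True in simp)
    then show ?thesis using x by blast
  next
    case False
    then obtain j0 where j0: "j0 \<in> U" "y j0 i \<noteq> 0" by blast
    define U' where "U' = U - {j0}"
    define y' where "y' j k = y j k - y j i / y j0 i * y j0 k" for j k
    have "\<exists>x. (\<exists>j\<in>U'. x j \<noteq> 0) \<and> (\<forall>k\<in>I. (\<Sum>j\<in>U'. x j * y' j k) = 0)"
      by (rule insert.IH) (use insert.hyps insert.prems j0 in \<open>auto simp: U'_def\<close>)
    then obtain x where x: "\<exists>j\<in>U'. x j \<noteq> 0" "\<And>k. k \<in> I \<Longrightarrow> (\<Sum>j\<in>U'. x j * y' j k) = 0" by blast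
    define x' where "x' j = (if j = j0 then - (\<Sum>j\<in>U'. x j * y j i) / y j0 i else x j)" for j
    have split: "(\<Sum>j\<in>U. x' j * y j k) = x' j0 * y j0 k + (\<Sum>j\<in>U'. x j * y j k)" for k
    proof -
      have "(\<Sum>j\<in>U. x' j * y j k) = x' j0 * y j0 k + (\<Sum>j\<in>U'. x' j * y j k)"
        unfolding U'_def by (rule sum.remove[OF insert.prems(1) j0(1)])
      moreover have "(\<Sum>j\<in>U'. x' j * y j k) = (\<Sum>j\<in>U'. x j * y j k)"
        by (rule sum.cong) (auto simp: x'_def U'_def)
      ultimately show ?thesis by simp
    qed
    have x0: "x' j0 = - (\<Sum>j\<in>U'. x j * y j i) / y j0 i" by (simp add: x'_def)
    have "(\<Sum>j\<in>U. x' j * y j i) = 0" unfolding split x0 using j0(2) by simp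
    moreover have "(\<Sum>j\<in>U. x' j * y j k) = 0" if "k \<in> I" for k
    proof -
      have "(\<Sum>j\<in>U'. x j * y' j k) = (\<Sum>j\<in>U'. x j * y j k) - (\<Sum>j\<in>U'. x j * y j i) / y j0 i * y j0 k"
        by (simp add: y'_def right_diff_distrib sum_subtractf sum_distrib_left sum_distrib_right
            sum_divide_distrib mult_ac)
      then show ?thesis unfolding split x0 using x(2)[OF that] by simp
    qed
    moreover have "\<exists>j\<in>U. x' j \<noteq> 0" using x(1) by (auto simp: x'_def U'_def)
    ultimately show ?thesis by blast
  qed
qed

lemma clinear_map_zero:
  assumes "clinear_map l m \<Psi>"
  shows "\<Psi> (\<lambda>_. 0) = (\<lambda>_. 0)"
proof -
  have scale: "\<Psi> (\<lambda>i. c * u i) = (\<lambda>i. c * \<Psi> u i)" if "u \<in> coord_space l" for c u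
    using assms that unfolding clinear_map_def by blast
  have "(\<lambda>_. 0) \<in> coord_space l" by (simp add: coord_space_def)
  from scale[OF this, of 0] show ?thesis by simp
qed

lemma coord_space_scale: "w \<in> coord_space k \<Longrightarrow> (\<lambda>i. c * w i) \<in> coord_space k" for c :: "'a::mult_zero"
  by (simp add: coord_space_def)

lemma coord_space_add: "u \<in> coord_space k \<Longrightarrow> w \<in> coord_space k \<Longrightarrow> (\<lambda>i. u i + w i) \<in> coord_space k"
  for u w :: "nat \<Rightarrow> 'a::monoid_add"
  by (simp add: coord_space_def)

definition basis_vector :: "nat \<Rightarrow> nat \<Rightarrow> complex" where
  "basis_vector j = (\<lambda>i. if i = j then 1 else 0)"

lemma basis_vector_coord_space: "j \<in> {1..l} \<Longrightarrow> basis_vector j \<in> coord_space l"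
  by (auto simp: basis_vector_def coord_space_def)

lemma clinear_map_sum:
  assumes lin: "clinear_map l m \<Psi>" and F: "finite F" "F \<subseteq> {1..l}"
  shows "\<Psi> (\<lambda>i. if i \<in> F then u i else 0) = (\<lambda>i. \<Sum>j\<in>F. u j * \<Psi> (basis_vector j) i)"
  using F
proof (induction F rule: finite_induct)
  case empty
  then show ?case using clinear_map_zero[OF lin] by simp
next
  case (insert j F)
  have add: "\<Psi> (\<lambda>i. x i + y i) = (\<lambda>i. \<Psi> x i + \<Psi> y i)" if "x \<in> coord_space l" "y \<in> coord_space l" for x y
    using lin that unfolding clinear_map_def by blast
  have scale: "\<Psi> (\<lambda>i. c * x i) = (\<lambda>i. c * \<Psi> x i)" if "x \<in> coord_space l" for c x
    using lin that unfolding clinear_map_def by blast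
  have j: "basis_vector j \<in> coord_space l" using insert.prems by (intro basis_vector_coord_space) auto
  have F: "(\<lambda>i. if i \<in> F then u i else 0) \<in> coord_space l"
    using insert.prems by (auto simp: coord_space_def)
  have eq: "(\<lambda>i. if i \<in> insert j F then u i else 0)
      = (\<lambda>i. u j * basis_vector j i + (if i \<in> F then u i else 0))"
    using insert.hyps by (auto simp: fun_eq_iff basis_vector_def)
  show ?case
    unfolding eq add[OF coord_space_scale[OF j] F] scale[OF j] using insert by simp
qed

lemma clinear_map_expansion:
  assumes lin: "clinear_map l m \<Psi>" and u: "u \<in> coord_space l"
  shows "\<Psi> u i = (\<Sum>j=1..l. u j * \<Psi> (basis_vector j) i)"
proof -
  have "(\<lambda>i. if i \<in> {1..l} then u i else 0) = u"
    using u by (auto simp: coord_space_def fun_eq_iff)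
  then show ?thesis using clinear_map_sum[OF lin, of "{1..l}" u] by simp
qed

lemma vector_map_sum:
  "finite U \<Longrightarrow> vector_map m a (\<lambda>i. \<Sum>j\<in>U. x j * y j i) = (\<Sum>j\<in>U. x j *\<^sub>R vector_map m a (y j))"
  unfolding vector_map_def
  by (simp add: scaleR_sum_left scaleR_sum_right sum.swap[of _ U])

lemma cone_in_image:
  assumes "I \<subseteq> {1..m}" "v \<in> spanned_cone a I"
  obtains \<mu> where "\<And>i. 0 \<le> \<mu> i" "v = vector_map m a (\<lambda>i. if i \<in> I then \<mu> i else 0)"
proof -
  obtain \<mu> where mu: "v = (\<Sum>i\<in>I. \<mu> i *\<^sub>R a i)" "\<forall>i\<in>I. 0 \<le> \<mu> i"
    using assms(2) by (auto simp: spanned_cone_def)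
  have "vector_map m a (\<lambda>i. if i \<in> I then (if i \<in> I then \<mu> i else 0) else 0) = (\<Sum>i\<in>I. \<mu> i *\<^sub>R a i)"
    unfolding vector_map_def using assms(1)
    by (intro sum.mono_neutral_cong_right) auto
  then show ?thesis using mu by (intro that[of "\<lambda>i. if i \<in> I then \<mu> i else 0"]) auto
qed

text \<open>
  A count of dimensions. If \<open>x\<close> is in the kernel, then \<open>x\<close>, the \<open>2 l\<close> real parts of \<open>\<Psi>\<close> at \<open>e\<^sub>j\<close> and
  \<open>i e\<^sub>j\<close>, and preimages of the \<open>n\<close> basis vectors are \<open>m + 1\<close> vectors of real \<open>m\<close>-space, hence
  linearly dependent. Applying \<open>A\<close> shows that the preimages do not occur in a dependency, and \<open>x\<close> does
  occur since \<open>Re \<circ> \<Psi>\<close> is injective.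
\<close>
lemma kernel_eq_real_parts:
  fixes a :: "nat \<Rightarrow> 'v::real_vector"
  assumes dims: "m = n + 2 * l"
    and dim_N: "\<exists>B::'v set. finite B \<and> card B = n \<and> independent B \<and> span B = UNIV"
    and complex: "abstract_simplicial_complex m K"
    and fan: "complete_fan_data K a"
    and lin: "clinear_map l m \<Psi>"
    and inj: "inj_on (\<lambda>u i. Re (\<Psi> u i)) (coord_space l)"
    and ker: "\<And>u. u \<in> coord_space l \<Longrightarrow> vector_map m a (\<lambda>i. Re (\<Psi> u i)) = 0"
    and x: "x \<in> vector_map_ker m a"
  shows "\<exists>u\<in>coord_space l. \<forall>i. Re (\<Psi> u i) = x i"
proof -
  obtain B :: "'v set" where B: "finite B" "card B = n" "independent B" using dim_N by blast
  have "\<exists>p. v = vector_map m a p" for v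
  proof -
    obtain I where I: "I \<in> K" "v \<in> spanned_cone a I"
      using fan unfolding complete_fan_data_def by blast
    have "I \<subseteq> {1..m}" using I(1) complex unfolding abstract_simplicial_complex_def by blast
    then show ?thesis using cone_in_image[OF _ I(2)] by blast
  qed
  then obtain p where p: "\<And>v. vector_map m a (p v) = v" by metis
  \<comment> \<open>\<open>Inl (j, True)\<close> and \<open>Inl (j, False)\<close> stand for the real parts of \<open>\<Psi>\<close> at the basis vector \<open>j\<close>
    and at \<open>i\<close> times it, \<open>Inr None\<close> for \<open>x\<close>, and \<open>Inr (Some v)\<close> for a preimage of \<open>v \<in> B\<close>\<close>
  define U :: "(nat \<times> bool + 'v option) set" where
    "U = Inl ` ({1..l} \<times> UNIV) \<union> Inr ` insert None (Some ` B)"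
  define y :: "nat \<times> bool + 'v option \<Rightarrow> nat \<Rightarrow> real" where
    "y = (\<lambda>j i. case j of Inl (j, b) \<Rightarrow> Re ((if b then 1 else \<i>) * \<Psi> (basis_vector j) i)
        | Inr None \<Rightarrow> x i | Inr (Some v) \<Rightarrow> p v i)"
  have finU: "finite U" using B(1) by (simp add: U_def)
  have "card U = card (Inl ` ({1..l} \<times> (UNIV :: bool set)) :: (nat \<times> bool + 'v option) set)
      + card (Inr ` insert None (Some ` B) :: (nat \<times> bool + 'v option) set)"
    unfolding U_def using B(1) by (intro card_Un_disjoint) auto
  also have "card (Inr ` insert None (Some ` B) :: (nat \<times> bool + 'v option) set) = card (insert None (Some ` B))"
    by (rule card_image[OF inj_Inr])
  also have "card (insert None (Some ` B)) = Suc n"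
    using B(1,2) by (simp add: card_image)
  also have "card (Inl ` ({1..l} \<times> (UNIV :: bool set)) :: (nat \<times> bool + 'v option) set) = l * 2"
    by (simp add: card_image card_cartesian_product)
  finally have cardU: "card {1..m} < card U" by (simp add: dims)
  have sumU: "sum f U = (\<Sum>j=1..l. f (Inl (j, True)) + f (Inl (j, False))) + f (Inr None) + (\<Sum>v\<in>B. f (Inr (Some v)))"
    for f :: "_ \<Rightarrow> 'w::ab_group_add"
  proof -
    have "sum f U = sum f (Inl ` ({1..l} \<times> UNIV)) + sum f (Inr ` insert None (Some ` B))"
      unfolding U_def using B(1) by (intro sum.union_disjoint) auto
    moreover have "sum f (Inl ` ({1..l} \<times> UNIV)) = (\<Sum>j=1..l. f (Inl (j, True)) + f (Inl (j, False)))"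
    proof -
      have "sum f (Inl ` ({1..l} \<times> UNIV)) = (\<Sum>p\<in>{1..l} \<times> UNIV. f (Inl p))"
        by (simp add: sum.reindex)
      also have "\<dots> = (\<Sum>j=1..l. \<Sum>b\<in>UNIV. f (Inl (j, b)))"
        by (subst sum.cartesian_product) (simp add: case_prod_unfold)
      finally show ?thesis by (simp add: UNIV_bool add.commute)
    qed
    moreover have "sum f (Inr ` insert None (Some ` B)) = f (Inr None) + (\<Sum>v\<in>B. f (Inr (Some v)))"
    proof -
      have "(Inr ` Some ` B :: (nat \<times> bool + 'v option) set) = (\<lambda>v. Inr (Some v)) ` B"
        by (rule image_image)
      moreover have "sum f ((\<lambda>v. Inr (Some v)) ` B) = (\<Sum>v\<in>B. f (Inr (Some v)))"
        by (subst sum.reindex) (auto simp: inj_on_def)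
      moreover have "(Inr None :: nat \<times> bool + 'v option) \<notin> Inr ` Some ` B" by blast
      ultimately show ?thesis using B(1) by simp
    qed
    ultimately show ?thesis by (simp add: add.assoc)
  qed
  have "\<exists>t. (\<exists>j\<in>U. t j \<noteq> 0) \<and> (\<forall>i\<in>{1..m}. (\<Sum>j\<in>U. t j * y j i) = 0)"
    by (rule underdetermined_system[OF _ finU cardU]) simp
  then obtain t where t: "\<exists>j\<in>U. t j \<noteq> 0" "\<And>i. i \<in> {1..m} \<Longrightarrow> (\<Sum>j\<in>U. t j * y j i) = 0"
    by blast
  define u where "u j = (if j \<in> {1..l} then complex_of_real (t (Inl (j, True))) + \<i> * complex_of_real (t (Inl (j, False))) else 0)" for j
  have u: "u \<in> coord_space l" by (simp add: u_def coord_space_def)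
  have Reu: "Re (\<Psi> u i) = (\<Sum>j=1..l. t (Inl (j, True)) * y (Inl (j, True)) i + t (Inl (j, False)) * y (Inl (j, False)) i)" for i
  proof -
    have "\<Psi> u i = (\<Sum>j=1..l. (complex_of_real (t (Inl (j, True))) + \<i> * complex_of_real (t (Inl (j, False)))) * \<Psi> (basis_vector j) i)"
      unfolding clinear_map_expansion[OF lin u] by (rule sum.cong) (auto simp: u_def)
    then show ?thesis by (simp add: y_def Re_sum algebra_simps)
  qed
  have yInl: "vector_map m a (y (Inl (j, b))) = 0" if j: "j \<in> {1..l}" for j b
  proof -
    let ?c = "if b then 1 else \<i>"
    have bj: "basis_vector j \<in> coord_space l" by (rule basis_vector_coord_space[OF j])
    have "\<Psi> (\<lambda>i. ?c * basis_vector j i) = (\<lambda>i. ?c * \<Psi> (basis_vector j) i)"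
      using lin bj unfolding clinear_map_def by blast
    then have "y (Inl (j, b)) = (\<lambda>i. Re (\<Psi> (\<lambda>i. ?c * basis_vector j i) i))" by (simp add: y_def)
    then show ?thesis using ker[OF coord_space_scale[OF bj]] by simp
  qed
  have yx: "vector_map m a (y (Inr None)) = 0" using x by (simp add: y_def vector_map_ker_def)
  have yp: "vector_map m a (y (Inr (Some v))) = v" for v using p by (simp add: y_def)
  have "vector_map m a (\<lambda>i. \<Sum>j\<in>U. t j * y j i) = 0"
    unfolding vector_map_def by (rule sum.neutral) (use t(2) in auto)
  then have "(\<Sum>j\<in>U. t j *\<^sub>R vector_map m a (y j)) = 0" by (simp only: vector_map_sum[OF finU])
  then have "(\<Sum>v\<in>B. t (Inr (Some v)) *\<^sub>R v) = 0"
    unfolding sumU by (simp add: yInl yx yp)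
  then have tB: "t (Inr (Some v)) = 0" if "v \<in> B" for v
    using independentD[OF B(3,1) subset_refl, of "\<lambda>v. t (Inr (Some v))" v] that by simp
  have rel: "Re (\<Psi> u i) + t (Inr None) * x i = 0" for i
  proof (cases "i \<in> {1..m}")
    case True
    have "(\<Sum>v\<in>B. t (Inr (Some v)) * y (Inr (Some v)) i) = 0" by (rule sum.neutral) (use tB in auto)
    then show ?thesis using t(2)[OF True] unfolding sumU Reu by (simp add: y_def)
  next
    case False
    have "\<Psi> u \<in> coord_space m" using lin u unfolding clinear_map_def by blast
    moreover have "x \<in> coord_space m" using x by (simp add: vector_map_ker_def)
    ultimately show ?thesis using False by (auto simp: coord_space_def)
  qed
  have t0: "t (Inr None) \<noteq> 0"
  proof
    assume z: "t (Inr None) = 0"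
    have zero: "(\<lambda>_. 0) \<in> coord_space l" by (simp add: coord_space_def)
    have "(\<lambda>i. Re (\<Psi> u i)) = (\<lambda>i. Re (\<Psi> (\<lambda>_. 0) i))"
      using rel z by (simp add: clinear_map_zero[OF lin] fun_eq_iff)
    then have "u = (\<lambda>_. 0)" using inj_onD[OF inj _ u zero] by blast
    then have uj: "Re (u j) = 0" "Im (u j) = 0" for j by simp_all
    have "t (Inl (j, b)) = 0" if "j \<in> {1..l}" for j b
      using uj[of j] that by (cases b) (simp_all add: u_def)
    then show False using t(1) z tB by (auto simp: U_def)
  qed
  define s where "s = - 1 / t (Inr None)"
  have "Re (\<Psi> (\<lambda>j. complex_of_real s * u j) i) = x i" for i
  proof -
    have "\<Psi> (\<lambda>j. complex_of_real s * u j) = (\<lambda>i. complex_of_real s * \<Psi> u i)"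
      using lin u unfolding clinear_map_def by blast
    moreover have "Re (\<Psi> u i) = - (t (Inr None) * x i)" using rel[of i] by simp
    ultimately show ?thesis using t0 by (simp add: s_def)
  qed
  then show ?thesis using coord_space_scale[OF u] by blast
qed

text \<open>
  An integral relation on the image of \<open>\<Psi>\<close> is a rational linear function that vanishes on the kernel
  of \<open>A\<close>. For the contraction, write minus the sum of the non-ghost vectors as a nonnegative combination
  of generators of a cone; this gives a relation with coefficients at least \<open>1\<close> on \<open>J\<close> and without
  ghosts.
\<close>
lemma fan_exponent_subspace:
  fixes a :: "nat \<Rightarrow> 'v::real_vector"
  assumes dims: "m = n + 2 * l"
    and dim_N: "\<exists>B::'v set. finite B \<and> card B = n \<and> independent B \<and> span B = UNIV"
    and complex: "abstract_simplicial_complex m K"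
    and fan: "complete_fan_data K a"
    and lin: "clinear_map l m \<Psi>"
    and inj: "inj_on (\<lambda>u i. Re (\<Psi> u i)) (coord_space l)"
    and ker: "\<And>u. u \<in> coord_space l \<Longrightarrow> vector_map m a (\<lambda>i. Re (\<Psi> u i)) = 0"
    and ghost: "card (ghost_vertices m K) \<le> 1"
    and generic: "\<And>\<phi>. rational_linear_form m \<phi> \<Longrightarrow> (\<forall>x\<in>vector_map_ker m a. \<phi> x = 0)
                    \<Longrightarrow> (\<forall>x\<in>coord_space m. \<phi> x = 0)"
  shows "exponent_subspace {i \<in> {1..m}. {i} \<in> K} (ghost_vertices m K) (\<Psi> ` coord_space l)"
proof -
  let ?J = "{i \<in> {1..m}. {i} \<in> K}" and ?G = "ghost_vertices m K" and ?W = "\<Psi> ` coord_space l"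
  have union: "?J \<union> ?G = {1..m}" by (auto simp: ghost_vertices_def)
  have real_parts: "\<exists>u\<in>coord_space l. \<forall>i. Re (\<Psi> u i) = x i" if "x \<in> vector_map_ker m a" for x
    by (rule kernel_eq_real_parts[OF dims dim_N complex fan lin inj ker that])
  show ?thesis
  proof
    show "?J \<inter> ?G = {}" by (auto simp: ghost_vertices_def)
    show "?W \<noteq> {}" by (auto simp: coord_space_def)
    show "(\<lambda>i. u i + w i) \<in> ?W" if mem: "u \<in> ?W" "w \<in> ?W" for u w
    proof -
      obtain u' w' where uw: "u' \<in> coord_space l" "u = \<Psi> u'" "w' \<in> coord_space l" "w = \<Psi> w'" using mem by blast
      have "\<Psi> (\<lambda>i. u' i + w' i) = (\<lambda>i. u i + w i)" using lin uw unfolding clinear_map_def by blast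
      then show ?thesis using coord_space_add[OF uw(1,3)] by (metis imageI)
    qed
    show "(\<lambda>i. c * w i) \<in> ?W" if mem: "w \<in> ?W" for c w
    proof -
      obtain w' where w: "w' \<in> coord_space l" "w = \<Psi> w'" using mem by blast
      have "\<Psi> (\<lambda>i. c * w' i) = (\<lambda>i. c * w i)" using lin w unfolding clinear_map_def by blast
      then show ?thesis using coord_space_scale[OF w(1)] by (metis imageI)
    qed
  next
    fix \<kappa> :: "nat \<Rightarrow> int" and i
    assume zero: "\<And>w. w \<in> ?W \<Longrightarrow> (\<Sum>i\<in>?J \<union> ?G. of_int (\<kappa> i) * w i) = 0" and i: "i \<in> ?J \<union> ?G"
    define \<phi> where "\<phi> x = (\<Sum>i=1..m. of_int (\<kappa> i) * x i)" for x :: "nat \<Rightarrow> real"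
    have "rational_linear_form m \<phi>"
      unfolding rational_linear_form_def linear_form_def
      by (auto simp: \<phi>_def distrib_left sum.distrib sum_distrib_left mult_ac intro!: Rats_sum Rats_mult)
    moreover have "\<phi> x = 0" if xk: "x \<in> vector_map_ker m a" for x
    proof -
      obtain u where u: "u \<in> coord_space l" "\<And>i. Re (\<Psi> u i) = x i" using real_parts[of x] xk by blast
      have "(\<Sum>i=1..m. of_int (\<kappa> i) * \<Psi> u i) = 0" using zero[of "\<Psi> u"] u(1) unfolding union by blast
      then have "Re (\<Sum>i=1..m. of_int (\<kappa> i) * \<Psi> u i) = 0" by simp
      then show ?thesis by (simp add: \<phi>_def Re_sum u(2))
    qed
    ultimately have \<phi>0: "\<forall>x\<in>coord_space m. \<phi> x = 0" using generic by blast
    have "(\<lambda>j. if j = i then 1 else 0) \<in> coord_space m" using i unfolding union by (auto simp: coord_space_def)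
    then have "\<phi> (\<lambda>j. if j = i then 1 else 0) = 0" using \<phi>0 by blast
    moreover have "\<phi> (\<lambda>j. if j = i then 1 else 0) = of_int (\<kappa> i)"
      using i unfolding union \<phi>_def by (simp add: if_distrib[of "\<lambda>x. _ * x"] cong: if_cong)
    ultimately show "\<kappa> i = 0" by simp
  next
    obtain I where I: "I \<in> K" "- (\<Sum>i\<in>?J. a i) \<in> spanned_cone a I"
      using fan unfolding complete_fan_data_def by blast
    have Isub: "I \<subseteq> {1..m}" and sing: "\<And>i. i \<in> I \<Longrightarrow> {i} \<in> K"
      using I(1) complex unfolding abstract_simplicial_complex_def by (blast, simp)
    obtain \<mu> where mu: "\<And>i. 0 \<le> \<mu> i" "- (\<Sum>i\<in>?J. a i) = vector_map m a (\<lambda>i. if i \<in> I then \<mu> i else 0)"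
      by (rule cone_in_image[OF Isub I(2)]) blast
    define x where "x i = - ((if i \<in> ?J then 1 else 0) + (if i \<in> I then \<mu> i else 0))" for i
    have "vector_map m a (\<lambda>i. if i \<in> ?J then 1 else 0) = (\<Sum>i\<in>?J. a i)"
      unfolding vector_map_def by (intro sum.mono_neutral_cong_right) auto
    moreover have "vector_map m a x = - (vector_map m a (\<lambda>i. if i \<in> ?J then 1 else 0)
        + vector_map m a (\<lambda>i. if i \<in> I then \<mu> i else 0))"
      unfolding vector_map_def x_def by (simp only: scaleR_minus_left scaleR_add_left sum_negf sum.distrib)
    ultimately have "vector_map m a x = - ((\<Sum>i\<in>?J. a i) + - (\<Sum>i\<in>?J. a i))"
      by (simp only: mu(2))
    then have "vector_map m a x = 0" by simp
    moreover have "x \<in> coord_space m" using Isub by (auto simp: x_def coord_space_def)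
    ultimately have "x \<in> vector_map_ker m a" by (simp add: vector_map_ker_def)
    then obtain u where u: "u \<in> coord_space l" "\<And>i. Re (\<Psi> u i) = x i" using real_parts[of x] by blast
    have "Re (\<Psi> u i) < 0" if "i \<in> ?J" for i
    proof -
      have "x i = - (1 + (if i \<in> I then \<mu> i else 0))" unfolding x_def using that by simp
      then show ?thesis using mu(1)[of i] u(2)[of i] by auto
    qed
    moreover have "Re (\<Psi> u g) = 0" if g: "g \<in> ?G" for g
    proof -
      have "g \<notin> I" "g \<notin> ?J" using g sing by (auto simp: ghost_vertices_def)
      then show ?thesis using u(2)[of g] by (simp add: x_def)
    qed
    ultimately show "\<exists>w\<in>?W. (\<forall>i\<in>?J. Re (w i) < 0) \<and> (\<forall>g\<in>?G. Re (w g) = 0)" using u(1) by blast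
  qed (use ghost in \<open>auto simp: ghost_vertices_def\<close>)
qed

section \<open>Meromorphic functions on moment-angle manifolds\<close>

locale moment_angle = exponent_subspace "{i \<in> {1..m}. {i} \<in> K}" "ghost_vertices m K" W
  for m :: nat and K :: "nat set set" and W :: "(nat \<Rightarrow> complex) set" +
  fixes C :: "(nat \<Rightarrow> complex) set"
  assumes complex: "abstract_simplicial_complex m K"
    and C_eq: "C = {(\<lambda>i. if i \<in> {1..m} then exp (w i) else 0) | w. w \<in> W}"
begin

abbreviation J :: "nat set" where "J \<equiv> {i \<in> {1..m}. {i} \<in> K}"
abbreviation Gh :: "nat set" where "Gh \<equiv> ghost_vertices m K"
abbreviation Z :: "(nat \<Rightarrow> complex) set topology" where "Z \<equiv> Z_topology m K C"

definition act :: "(nat \<Rightarrow> complex) \<Rightarrow> (nat \<Rightarrow> complex) \<Rightarrow> nat \<Rightarrow> complex" where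
  "act w z = (\<lambda>i. exp (w i) * z i)"

lemma orbit_eq:
  assumes "z \<in> coord_space m"
  shows "orbit C z = {act w z | w. w \<in> W}"
proof -
  define E where "E w = (\<lambda>i. if i \<in> {1..m} then exp (w i) else 0)" for w :: "nat \<Rightarrow> complex"
  have E: "(\<lambda>i. E w i * z i) = act w z" for w
    using assms by (auto simp: E_def act_def coord_space_def fun_eq_iff)
  have "C = {E w | w. w \<in> W}" by (simp add: C_eq E_def)
  then have "orbit C z = {\<lambda>i. E w i * z i | w. w \<in> W}" unfolding orbit_def by blast
  then show ?thesis by (simp only: E)
qed

lemma act_coord_space: "z \<in> coord_space m \<Longrightarrow> act w z \<in> coord_space m"
  by (simp add: act_def coord_space_def)

lemma W_zero: "(\<lambda>_. 0) \<in> W"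
proof -
  obtain w where "w \<in> W" using W_ne by blast
  from W_scale[OF this, of 0] show ?thesis by simp
qed

lemma orbit_act:
  assumes z: "z \<in> coord_space m" and w: "w \<in> W"
  shows "orbit C (act w z) = orbit C z"
proof -
  have 1: "act u (act w z) = act (\<lambda>i. u i + w i) z" for u by (simp add: act_def exp_add fun_eq_iff)
  have 2: "act u z = act (\<lambda>i. u i + (- 1) * w i) (act w z)" for u
    by (simp add: act_def exp_add[symmetric] fun_eq_iff mult.assoc[symmetric])
  show ?thesis
    unfolding orbit_eq[OF z] orbit_eq[OF act_coord_space[OF z]]
  proof (intro subset_antisym subsetI)
    fix y assume "y \<in> {act u (act w z) | u. u \<in> W}"
    then show "y \<in> {act u z | u. u \<in> W}" using 1 W_add[OF _ w] by blast
  next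
    fix y assume "y \<in> {act u z | u. u \<in> W}"
    then obtain u where u: "u \<in> W" "y = act u z" by blast
    then show "y \<in> {act u (act w z) | u. u \<in> W}"
      using 2[of u] W_add[OF u(1) W_scale[OF w, of "- 1"]] by blast
  qed
qed

lemma U_coord_space: "z \<in> U_set m K \<Longrightarrow> z \<in> coord_space m"
  by (simp add: U_set_def)

lemma act_U_set: "z \<in> U_set m K \<Longrightarrow> act w z \<in> U_set m K"
  by (simp add: U_set_def act_coord_space) (simp add: act_def)

lemma ghost_coordinate_nonzero:
  assumes z: "z \<in> U_set m K" and g: "g \<in> Gh"
  shows "z g \<noteq> 0"
proof
  assume "z g = 0"
  then have "{g} \<subseteq> {i \<in> {1..m}. z i = 0}" using g by (auto simp: ghost_vertices_def)
  moreover have "{i \<in> {1..m}. z i = 0} \<in> K" using z by (simp add: U_set_def)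
  ultimately have "{g} \<in> K" using complex unfolding abstract_simplicial_complex_def by blast
  then show False using g by (simp add: ghost_vertices_def)
qed

lemma topspace_Z: "topspace Z = orbit C ` U_set m K"
  by (simp add: Z_topology_def topspace_quotient_topology)

lemma openin_Z: "openin Z V \<longleftrightarrow> V \<subseteq> orbit C ` U_set m K \<and> openin (top_of_set (U_set m K)) {z \<in> U_set m K. orbit C z \<in> V}"
  by (simp add: Z_topology_def openin_quotient_topology)

lemma continuous_act: "continuous_on X (act w)"
  unfolding act_def
  by (rule continuous_on_coordinatewise_then_product)
    (intro continuous_on_mult continuous_on_const continuous_on_product_then_coordinatewise[OF continuous_on_id])

text \<open>
  The saturation of an open set is the union of its translates.
\<close>
lemma open_orbit_map:
  assumes "open T"
  shows "openin Z (orbit C ` (T \<inter> U_set m K))"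
proof -
  have "{z \<in> U_set m K. orbit C z \<in> orbit C ` (T \<inter> U_set m K)} = U_set m K \<inter> (\<Union>w\<in>W. act w -` T)"
  proof (intro subset_antisym subsetI)
    fix z assume "z \<in> {z \<in> U_set m K. orbit C z \<in> orbit C ` (T \<inter> U_set m K)}"
    then obtain y where y: "z \<in> U_set m K" "y \<in> T" "y \<in> U_set m K" "orbit C z = orbit C y" by blast
    have "y = act (\<lambda>_. 0) y" by (simp add: act_def)
    then have "y \<in> orbit C y" unfolding orbit_eq[OF U_coord_space[OF y(3)]] using W_zero by blast
    then have "y \<in> orbit C z" using y(4) by simp
    then obtain w where "w \<in> W" "y = act w z" unfolding orbit_eq[OF U_coord_space[OF y(1)]] by blast
    then show "z \<in> U_set m K \<inter> (\<Union>w\<in>W. act w -` T)" using y by blast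
  next
    fix z assume "z \<in> U_set m K \<inter> (\<Union>w\<in>W. act w -` T)"
    then obtain w where w: "z \<in> U_set m K" "w \<in> W" "act w z \<in> T" by blast
    have "orbit C z = orbit C (act w z)" using orbit_act[OF U_coord_space[OF w(1)] w(2)] by simp
    then show "z \<in> {z \<in> U_set m K. orbit C z \<in> orbit C ` (T \<inter> U_set m K)}"
      using w act_U_set[OF w(1)] by blast
  qed
  moreover have "open (\<Union>w\<in>W. act w -` T)"
    by (intro open_UN ballI open_vimage[OF assms continuous_act])
  ultimately show ?thesis unfolding openin_Z by (auto simp: openin_open)
qed

text \<open>
  The points with ghost coordinate \<open>1\<close>, parametrized by their coordinates in \<open>J\<close>.
\<close>
definition slice :: "(nat \<Rightarrow> complex) \<Rightarrow> nat \<Rightarrow> complex" where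
  "slice z = (\<lambda>i. if i \<in> J then z i else if i \<in> Gh then 1 else 0)"

lemma slice_J: "i \<in> J \<Longrightarrow> slice z i = z i"
  unfolding slice_def by (simp only: if_True)

lemma slice_Gh: "i \<in> Gh \<Longrightarrow> slice z i = 1"
  unfolding slice_def using disj by auto

lemma slice_other: "i \<notin> J \<Longrightarrow> i \<notin> Gh \<Longrightarrow> slice z i = 0"
  unfolding slice_def by (simp only: if_False)

lemma slice_coord_space: "slice z \<in> coord_space m"
  unfolding coord_space_def using slice_other by (auto simp: ghost_vertices_def)

lemma slice_cong: "(\<And>i. i \<in> J \<Longrightarrow> z' i = z i) \<Longrightarrow> slice z' = slice z"
  unfolding slice_def by (rule ext) simp

lemma slice_upd: "i \<in> J \<Longrightarrow> slice (z(i := t)) = (slice z)(i := t)"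
  unfolding slice_def by (rule ext) simp

lemma continuous_slice: "continuous_on X slice"
proof (rule continuous_on_coordinatewise_then_product)
  fix i
  have "continuous_on X (\<lambda>z :: nat \<Rightarrow> complex. z i)"
    by (rule continuous_on_product_then_coordinatewise[OF continuous_on_id])
  moreover have "continuous_on X (\<lambda>z. slice z i)" if "i \<notin> J"
  proof (cases "i \<in> Gh")
    case True
    show ?thesis unfolding slice_Gh[OF True] by (rule continuous_on_const)
  next
    case False
    show ?thesis unfolding slice_other[OF that False] by (rule continuous_on_const)
  qed
  moreover have "continuous_on X (\<lambda>z. z i) \<Longrightarrow> continuous_on X (\<lambda>z. slice z i)" if "i \<in> J"
    unfolding slice_J[OF that] .
  ultimately show "continuous_on X (\<lambda>z. slice z i)" by blast
qed

lemma slice_in_U: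
  assumes "\<And>i j. i \<in> J \<Longrightarrow> j \<in> J \<Longrightarrow> z i = 0 \<Longrightarrow> z j = 0 \<Longrightarrow> i = j"
  shows "slice z \<in> U_set m K"
proof -
  have zeros: "{i \<in> {1..m}. slice z i = 0} = {i \<in> J. z i = 0}"
    by (auto simp: slice_def ghost_vertices_def)
  have "{i \<in> J. z i = 0} \<in> K"
  proof (cases "{i \<in> J. z i = 0} = {}")
    case True
    then show ?thesis using complex unfolding abstract_simplicial_complex_def by (simp only:)
  next
    case False
    then obtain i where i: "i \<in> J" "z i = 0" by blast
    then have "{i \<in> J. z i = 0} = {i}" using assms by blast
    then show ?thesis using i by simp
  qed
  then show ?thesis unfolding U_set_def using slice_coord_space zeros by simp
qed

definition pullback :: "(nat \<Rightarrow> complex) set set \<Rightarrow> (nat \<Rightarrow> complex) set" where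
  "pullback V = {z. slice z \<in> U_set m K \<and> orbit C (slice z) \<in> V}"

lemma pullback_holomorphic:
  assumes "Z_holomorphic m K C V g"
  shows "holomorphic_vars J (pullback V) (\<lambda>z. g (orbit C (slice z)))"
proof -
  let ?P = "{z \<in> U_set m K. orbit C z \<in> V}"
  have hol: "holomorphic_coord m ?P (\<lambda>z. g (orbit C z))"
    using assms by (simp add: Z_holomorphic_def)
  obtain T where T: "open T" "?P = coord_space m \<inter> T"
    using hol unfolding holomorphic_coord_def openin_open by blast
  have inP: "slice z \<in> ?P \<longleftrightarrow> z \<in> pullback V" for z by (simp add: pullback_def)
  have pb: "pullback V = slice -` T"
    using T(2) slice_coord_space inP by blast
  show ?thesis
  proof (rule holomorphic_varsI)
    show "open (pullback V)" unfolding pb by (rule open_vimage[OF T(1) continuous_slice])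
    show "continuous_on (pullback V) (\<lambda>z. g (orbit C (slice z)))"
    proof (rule continuous_on_compose2[OF _ continuous_slice])
      show "continuous_on ?P (\<lambda>z. g (orbit C z))" using hol unfolding holomorphic_coord_def by blast
      show "slice ` pullback V \<subseteq> ?P" using inP by blast
    qed
    fix z z' assume z: "z \<in> pullback V" and eq: "\<And>i. i \<in> J \<Longrightarrow> z' i = z i"
    have s: "slice z' = slice z" by (rule slice_cong[OF eq])
    show "z' \<in> pullback V" using z by (simp add: pullback_def s)
    show "g (orbit C (slice z')) = g (orbit C (slice z))" by (simp add: s)
  next
    fix z i assume z: "z \<in> pullback V" and i: "i \<in> J"
    have "slice z i = z i" using i by (simp add: slice_def)
    moreover have "(\<lambda>t. g (orbit C ((slice z)(i := t)))) field_differentiable at (slice z i)"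
      using hol inP[of z] z i unfolding holomorphic_coord_def by blast
    ultimately show "(\<lambda>t. g (orbit C (slice (z(i := t))))) field_differentiable at (z i)"
      by (simp only: slice_upd[OF i])
  qed
qed

definition ghost_vector :: "nat \<Rightarrow> complex" where
  "ghost_vector = (SOME u. u \<in> W \<and> (\<forall>g\<in>Gh. u g = 1))"

lemma ghost_vector: "ghost_vector \<in> W" "\<And>g. g \<in> Gh \<Longrightarrow> ghost_vector g = 1"
proof -
  have "ghost_vector \<in> W \<and> (\<forall>g\<in>Gh. ghost_vector g = 1)"
    unfolding ghost_vector_def by (rule someI_ex[of "\<lambda>u. u \<in> W \<and> (\<forall>g\<in>Gh. u g = 1)"]) (use ghost_unit in blast)
  then show "ghost_vector \<in> W" "\<And>g. g \<in> Gh \<Longrightarrow> ghost_vector g = 1" by blast+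
qed

text \<open>
  The translate of \<open>y\<close> under the group that has ghost coordinate \<open>1\<close>. The sum has at most one term.
\<close>
definition normalize :: "(nat \<Rightarrow> complex) \<Rightarrow> nat \<Rightarrow> complex" where
  "normalize y = act (\<lambda>i. (- (\<Sum>g\<in>Gh. Ln (y g))) * ghost_vector i) y"

lemma normalize_orbit:
  assumes y: "y \<in> U_set m K"
  shows "orbit C (normalize y) = orbit C y" "normalize y \<in> U_set m K"
  unfolding normalize_def
  by (rule orbit_act[OF U_coord_space[OF y] W_scale[OF ghost_vector(1)]]) (rule act_U_set[OF y])

lemma slice_normalize:
  assumes y: "y \<in> U_set m K" and z: "\<And>i. i \<in> J \<Longrightarrow> z i = normalize y i"
  shows "slice z = normalize y"
proof
  fix i
  consider "i \<in> J" | "i \<in> Gh" "i \<notin> J" | "i \<notin> {1..m}" "i \<notin> J" "i \<notin> Gh"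
    by (auto simp: ghost_vertices_def)
  then show "slice z i = normalize y i"
  proof cases
    case 1
    then show ?thesis using z slice_J by metis
  next
    case 2
    then have "Gh = {i}" by (cases rule: Gh_cases) auto
    then have "normalize y i = exp (- Ln (y i)) * y i"
      using ghost_vector(2)[OF 2(1)] by (simp add: normalize_def act_def)
    also have "\<dots> = 1" using ghost_coordinate_nonzero[OF y 2(1)] by (simp add: exp_minus)
    finally show ?thesis using slice_Gh[OF 2(1)] by simp
  next
    case 3
    have "y i = 0" using U_coord_space[OF y] 3(1) by (simp add: coord_space_def)
    then show ?thesis using slice_other[OF 3(2,3)] by (simp add: normalize_def act_def)
  qed
qed

text \<open>
  The slice is transversal to the orbits: a point \<open>y\<close> near \<open>slice z0\<close> is moved into the slice, close to
  \<open>z0\<close>, by \<open>normalize\<close>. The branch of the logarithm is continuous near the ghost coordinate \<open>1\<close>.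
\<close>
lemma pullback_dense:
  assumes V: "openin Z V" and A: "V \<subseteq> Z closure_of A" and oP: "open (pullback V)"
  shows "pullback V \<subseteq> closure {z \<in> pullback V. orbit C (slice z) \<in> A}"
proof (rule denseI[OF oP])
  fix O' assume O: "open O'" "O' \<subseteq> pullback V" "O' \<noteq> {}"
  obtain z0 where z0: "z0 \<in> O'" using O(3) by blast
  have z0V: "slice z0 \<in> U_set m K" "orbit C (slice z0) \<in> V" using z0 O(2) by (auto simp: pullback_def)
  define \<sigma> where "\<sigma> y = (\<lambda>i. if i \<in> J then normalize y i else z0 i)" for y
  define T1 where "T1 = (\<Inter>g\<in>Gh. {y :: nat \<Rightarrow> complex. y g \<in> - \<real>\<^sub>\<le>\<^sub>0})"
  have coord: "continuous_on X (\<lambda>y :: nat \<Rightarrow> complex. y i)" for i X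
    by (rule continuous_on_product_then_coordinatewise[OF continuous_on_id])
  have "open {y :: nat \<Rightarrow> complex. y g \<in> - \<real>\<^sub>\<le>\<^sub>0}" for g
    using open_vimage[OF _ coord[of UNIV g], of "- \<real>\<^sub>\<le>\<^sub>0"] by (simp add: vimage_def open_Compl)
  then have oT1: "open T1" unfolding T1_def by (intro open_INT finGh) blast
  have contLn: "continuous_on T1 (\<lambda>y. Ln (y g))" if "g \<in> Gh" for g
  proof (rule continuous_on_compose2[OF _ coord])
    show "continuous_on (- \<real>\<^sub>\<le>\<^sub>0) Ln" by (rule continuous_on_Ln) simp
    show "(\<lambda>y. y g) ` T1 \<subseteq> - \<real>\<^sub>\<le>\<^sub>0" using that unfolding T1_def by blast
  qed
  have cont: "continuous_on T1 \<sigma>"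
  proof (rule continuous_on_coordinatewise_then_product)
    fix i
    show "continuous_on T1 (\<lambda>y. \<sigma> y i)"
    proof (cases "i \<in> J")
      case True
      have "continuous_on T1 (\<lambda>y. exp ((- (\<Sum>g\<in>Gh. Ln (y g))) * ghost_vector i) * y i)"
        by (intro continuous_on_mult continuous_on_exp continuous_on_minus continuous_on_sum contLn
            continuous_on_const coord)
      then show ?thesis unfolding \<sigma>_def normalize_def act_def using True by simp
    next
      case False
      have "(\<lambda>y. \<sigma> y i) = (\<lambda>_. z0 i)" unfolding \<sigma>_def using False by (simp only: if_False)
      then show ?thesis by (simp only: continuous_on_const)
    qed
  qed
  \<comment> \<open>points near the slice that normalization moves into \<open>O'\<close>\<close>
  define T2 where "T2 = T1 \<inter> \<sigma> -` O'"
  have oT2: "open T2" unfolding T2_def by (rule continuous_open_preimage[OF cont oT1 O(1)])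
  have s1: "slice z0 g = 1" if "g \<in> Gh" for g by (rule slice_Gh[OF that])
  have "slice z0 \<in> T2"
  proof -
    have "slice z0 \<in> T1" using s1 by (auto simp: T1_def)
    moreover have "(\<Sum>g\<in>Gh. Ln (slice z0 g)) = 0" by (rule sum.neutral) (simp add: s1)
    then have "normalize (slice z0) = slice z0" by (simp add: normalize_def act_def)
    then have "\<sigma> (slice z0) = z0" by (auto simp: \<sigma>_def slice_def fun_eq_iff)
    ultimately show ?thesis using z0 by (simp add: T2_def)
  qed
  then have mem: "orbit C (slice z0) \<in> orbit C ` (T2 \<inter> U_set m K) \<inter> V" using z0V by blast
  have "openin Z (orbit C ` (T2 \<inter> U_set m K) \<inter> V)" by (rule openin_Int[OF open_orbit_map[OF oT2] V])
  with mem have nbhd: "orbit C (slice z0) \<in> orbit C ` (T2 \<inter> U_set m K) \<inter> V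
      \<and> openin Z (orbit C ` (T2 \<inter> U_set m K) \<inter> V)" by (rule conjI)
  have "\<exists>x. x \<in> A \<and> x \<in> orbit C ` (T2 \<inter> U_set m K) \<inter> V"
    by (rule mp[OF spec[OF conjunct2[OF subsetD[OF A z0V(2), unfolded in_closure_of]]] nbhd])
  then obtain x where x: "x \<in> A" "x \<in> orbit C ` (T2 \<inter> U_set m K) \<inter> V" by (elim exE conjE)
  then obtain y where y: "y \<in> T2" "y \<in> U_set m K" "x = orbit C y" by blast
  have sl: "slice (\<sigma> y) = normalize y" by (rule slice_normalize[OF y(2)]) (simp add: \<sigma>_def)
  have "orbit C (slice (\<sigma> y)) = x" "slice (\<sigma> y) \<in> U_set m K"
    unfolding sl using normalize_orbit[OF y(2)] y(3) by simp_all
  then have "\<sigma> y \<in> {z \<in> pullback V. orbit C (slice z) \<in> A}" using x by (simp add: pullback_def)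
  moreover have "\<sigma> y \<in> O'" using y(1) by (simp add: T2_def)
  ultimately show "\<exists>x\<in>O'. x \<in> {z \<in> pullback V. orbit C (slice z) \<in> A}" by blast
qed

text \<open>
  The pair \<open>(f, 1)\<close> on \<open>D\<close> is added to the local quotients as a further one. In this way \<open>f\<close> itself is
  compared with the constant value of the quotient.
\<close>
theorem meromorphic_constant:
  assumes mero: "meromorphic_function Z (Z_holomorphic m K C) D f"
  shows "f constant_on D"
proof -
  have D: "openin Z D" "Z closure_of D = topspace Z" "Z_holomorphic m K C D f"
    and loc: "\<And>x. x \<in> topspace Z \<Longrightarrow> \<exists>V g h. openin Z V \<and> x \<in> V \<and> Z_holomorphic m K C V g \<and> Z_holomorphic m K C V h \<and>
        V \<subseteq> Z closure_of {y \<in> V. h y \<noteq> 0} \<and> (\<forall>y\<in>V \<inter> D. f y * h y = g y)"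
    using mero unfolding meromorphic_function_def by blast+
  define \<F> where "\<F> = {(V, g, h). openin Z V \<and> Z_holomorphic m K C V g \<and> Z_holomorphic m K C V h
      \<and> V \<subseteq> Z closure_of {y \<in> V. h y \<noteq> 0} \<and> (\<forall>y\<in>V \<inter> D. f y * h y = g y)}"
  have D1: "Z_holomorphic m K C D (\<lambda>_. 1)"
    using D(3) unfolding Z_holomorphic_def by (auto simp: holomorphic_coord_def continuous_on_const)
  have DF: "(D, f, \<lambda>_. 1) \<in> \<F>"
    using D(1,3) D1 closure_of_subset[OF openin_subset[OF D(1)]] by (simp add: \<F>_def)
  have opb: "open (pullback V)" if "(V, g, h) \<in> \<F>" for V g h
    by (rule holomorphic_varsD(1)[OF pullback_holomorphic[of V g]]) (use that in \<open>simp add: \<F>_def\<close>)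
  obtain \<V> where \<V>: "\<V> \<subseteq> (pullback \<circ> fst) ` \<F>" "countable \<V>" "\<Union>\<V> = \<Union>((pullback \<circ> fst) ` \<F>)"
  proof (rule Lindelof[of "(pullback \<circ> fst) ` \<F>"])
    fix S assume "S \<in> (pullback \<circ> fst) ` \<F>"
    then show "open S" using opb by auto
  qed
  \<comment> \<open>a countable subfamily covers the same part of the slice\<close>
  obtain \<G> where \<G>: "\<G> \<subseteq> \<F>" "countable \<G>" "\<V> = (pullback \<circ> fst) ` \<G>"
    using \<V>(1,2) countable_subset_image[of \<V> "pullback \<circ> fst" \<F>] by blast
  define \<H> where "\<H> = insert (D, f, \<lambda>_. 1) \<G>"
  have H: "countable \<H>" "\<H> \<noteq> {}" "\<H> \<subseteq> \<F>" using \<G> DF by (auto simp: \<H>_def)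
  define T where "T n = from_nat_into \<H> n" for n
  define V where "V n = fst (T n)" for n
  define g where "g n = fst (snd (T n))" for n
  define h where "h n = snd (snd (T n))" for n
  have TF: "(V n, g n, h n) \<in> \<F>" for n
    using from_nat_into[OF H(2), of n] H(3) by (auto simp: V_def g_def h_def T_def)
  have TH: "\<exists>n. (V n, g n, h n) = t" if "t \<in> \<H>" for t
    using from_nat_into_surj[OF H(1) that] by (auto simp: V_def g_def h_def T_def)
  have props: "openin Z (V n)" "Z_holomorphic m K C (V n) (g n)" "Z_holomorphic m K C (V n) (h n)"
    "V n \<subseteq> Z closure_of {y \<in> V n. h n y \<noteq> 0}" "\<And>y. y \<in> V n \<Longrightarrow> y \<in> D \<Longrightarrow> f y * h n y = g n y" for n
    using TF[of n] by (auto simp: \<F>_def)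
  let ?V = "\<lambda>n. pullback (V n)" and ?g = "\<lambda>n z. g n (orbit C (slice z))" and ?h = "\<lambda>n z. h n (orbit C (slice z))"
  have covers: "\<exists>n. z \<in> ?V n" if z: "slice z \<in> U_set m K" for z
  proof -
    have "orbit C (slice z) \<in> topspace Z" using z by (simp add: topspace_Z)
    from loc[OF this] obtain V' g' h' where "(V', g', h') \<in> \<F>" "orbit C (slice z) \<in> V'"
      unfolding \<F>_def by blast
    then have "z \<in> \<Union>((pullback \<circ> fst) ` \<F>)" using z by (force simp: pullback_def)
    then have "z \<in> \<Union>((pullback \<circ> fst) ` \<G>)" using \<V>(3) \<G>(3) by simp
    then obtain t where t: "t \<in> \<H>" "z \<in> pullback (fst t)" by (auto simp: \<H>_def)
    obtain n where "(V n, g n, h n) = t" using TH[OF t(1)] by blast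
    then show ?thesis using t(2) by auto
  qed
  have oV: "open (?V n)" for n by (rule opb[OF TF])
  have gcont: "continuous_on (?V n) (?g n)" and hcont: "continuous_on (?V n) (?h n)" for n
    using holomorphic_varsD(4)[OF pullback_holomorphic] props(2,3) by blast+
  have compat: "?g n z * ?h k z = ?g k z * ?h n z" if z: "z \<in> ?V n" "z \<in> ?V k" for n k z
  proof (rule continuous_eq_on_dense[where U = "?V n \<inter> ?V k" and S = "{z \<in> pullback (V n \<inter> V k). orbit C (slice z) \<in> D}"
      and f = "\<lambda>z. ?g n z * ?h k z" and g = "\<lambda>z. ?g k z * ?h n z"])
    show "open (?V n \<inter> ?V k)" using oV by blast
    show "continuous_on (?V n \<inter> ?V k) (\<lambda>z. ?g n z * ?h k z)"
      by (rule continuous_on_mult[OF continuous_on_subset[OF gcont] continuous_on_subset[OF hcont]]) auto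
    show "continuous_on (?V n \<inter> ?V k) (\<lambda>z. ?g k z * ?h n z)"
      by (rule continuous_on_mult[OF continuous_on_subset[OF gcont] continuous_on_subset[OF hcont]]) auto
    have eq: "pullback (V n \<inter> V k) = ?V n \<inter> ?V k" by (auto simp: pullback_def)
    have "pullback (V n \<inter> V k) \<subseteq> closure {z \<in> pullback (V n \<inter> V k). orbit C (slice z) \<in> D}"
    proof (rule pullback_dense)
      show "openin Z (V n \<inter> V k)" by (rule openin_Int[OF props(1) props(1)])
      show "V n \<inter> V k \<subseteq> Z closure_of D" using openin_subset[OF props(1)[of n]] D(2) by blast
      show "open (pullback (V n \<inter> V k))" unfolding eq using oV by blast
    qed
    then show "?V n \<inter> ?V k \<subseteq> closure {z \<in> pullback (V n \<inter> V k). orbit C (slice z) \<in> D}" unfolding eq .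
    fix x assume x: "x \<in> ?V n \<inter> ?V k" "x \<in> {z \<in> pullback (V n \<inter> V k). orbit C (slice z) \<in> D}"
    let ?o = "orbit C (slice x)"
    have "f ?o * h n ?o = g n ?o" "f ?o * h k ?o = g k ?o"
      using x props(5) by (auto simp: pullback_def)
    then show "?g n x * ?h k x = ?g k x * ?h n x" by (simp flip: \<open>f ?o * h n ?o = g n ?o\<close> \<open>f ?o * h k ?o = g k ?o\<close>)
  qed (use z in auto)
  interpret lq: local_quotients J ?V ?g ?h
  proof
    show "?V n \<subseteq> closure {z \<in> ?V n. ?h n z \<noteq> 0}" for n
    proof -
      have "?V n \<subseteq> closure {z \<in> ?V n. orbit C (slice z) \<in> {y \<in> V n. h n y \<noteq> 0}}"
        by (rule pullback_dense[OF props(1,4) oV])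
      also have "{z \<in> ?V n. orbit C (slice z) \<in> {y \<in> V n. h n y \<noteq> 0}} = {z \<in> ?V n. ?h n z \<noteq> 0}"
        by (auto simp: pullback_def)
      finally show ?thesis .
    qed
    show "holomorphic_vars J (?V n) (?g n)" "holomorphic_vars J (?V n) (?h n)" for n
      by (rule pullback_holomorphic[OF props(2)], rule pullback_holomorphic[OF props(3)])
    show "\<exists>n. z \<in> ?V n" if "\<And>i j. i \<in> J \<Longrightarrow> j \<in> J \<Longrightarrow> z i = 0 \<Longrightarrow> z j = 0 \<Longrightarrow> i = j" for z
      by (rule covers[OF slice_in_U[OF that]])
  qed (use compat in auto)
  obtain v where v: "v \<in> contractions" using contractions_nonempty by blast
  have slice_act: "slice (\<lambda>i. exp (w i) * z i) = act w (slice z)" if w: "w \<in> contractions" for w z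
  proof
    fix i
    have "exp (w i) = 1" if i: "i \<in> Gh"
    proof -
      obtain k :: int where "w i = 2 * pi * \<i> * of_int k" using w i unfolding contractions_def by blast
      then show ?thesis by (simp add: exp_eq_1)
    qed
    then show "slice (\<lambda>i. exp (w i) * z i) i = act w (slice z) i" by (simp add: slice_def act_def)
  qed
  have "\<exists>c. \<forall>z\<in>lq.regular. lq.quot z = c"
  proof (rule lq.quot_constant[of contractions])
    fix n z w assume z: "z \<in> ?V n" and w: "w \<in> contractions"
    have wW: "w \<in> W" using w unfolding contractions_def by blast
    have o: "orbit C (slice (\<lambda>i. exp (w i) * z i)) = orbit C (slice z)"
      unfolding slice_act[OF w] by (rule orbit_act[OF slice_coord_space wW])
    have u: "slice (\<lambda>i. exp (w i) * z i) \<in> U_set m K"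
      unfolding slice_act[OF w] by (rule act_U_set) (use z in \<open>simp add: pullback_def\<close>)
    show "(\<lambda>i. exp (w i) * z i) \<in> ?V n \<and> ?g n (\<lambda>i. exp (w i) * z i) = ?g n z \<and> ?h n (\<lambda>i. exp (w i) * z i) = ?h n z"
      using z u by (simp add: pullback_def o)
  next
    show "Re (w i) < 0" if "w \<in> contractions" "i \<in> J" for w i
      using that unfolding contractions_def by blast
  qed (use contractions_add v contractions_separate in auto)
  then obtain c where c: "\<And>z. z \<in> lq.regular \<Longrightarrow> lq.quot z = c" by blast
  have "f x = c" if x: "x \<in> D" for x
  proof -
    have "x \<in> topspace Z" using x openin_subset[OF D(1)] by blast
    then obtain y where y: "y \<in> U_set m K" "x = orbit C y" by (auto simp: topspace_Z)
    let ?z = "normalize y"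
    have s: "slice ?z = ?z" by (rule slice_normalize[OF y(1) refl])
    have o: "orbit C (slice ?z) = x" "slice ?z \<in> U_set m K" using normalize_orbit[OF y(1)] y(2) s by simp_all
    obtain n where n: "(V n, g n, h n) = (D, f, \<lambda>_. 1)" using TH[of "(D, f, \<lambda>_. 1)"] by (auto simp: \<H>_def)
    have zV: "?z \<in> ?V n" using n o x by (simp add: pullback_def)
    have h1: "?h n ?z = 1" using n by simp
    have reg: "?z \<in> lq.regular" unfolding lq.regular_def using zV h1 by auto
    have "lq.quot ?z * ?h n ?z = ?g n ?z" by (rule lq.quot_eq[OF reg zV])
    then show ?thesis using c[OF reg] n o by simp
  qed
  then show ?thesis unfolding constant_on_def by blast
qed

end

theorem corollary4p16:
  fixes m n l :: nat
    and K :: "nat set set"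
    and a :: "nat \<Rightarrow> 'v::real_vector"
    and \<Psi> :: "(nat \<Rightarrow> complex) \<Rightarrow> (nat \<Rightarrow> complex)"
    and C :: "(nat \<Rightarrow> complex) set"
  assumes dims: "m = n + 2 * l"
    and dim_N: "\<exists>B::'v set. finite B \<and> card B = n \<and> independent B \<and> span B = UNIV"
    and complex: "abstract_simplicial_complex m K"
    and fan: "complete_fan_data K a"
    and Psi_linear: "clinear_map l m \<Psi>"
    and Re_Psi_inj: "inj_on (\<lambda>u i. Re (\<Psi> u i)) (coord_space l)"
    and A_Re_Psi: "\<And>u. u \<in> coord_space l \<Longrightarrow> vector_map m a (\<lambda>i. Re (\<Psi> u i)) = 0"
    and C_def: "C = exp_group l m \<Psi>"
    and ghost: "card (ghost_vertices m K) \<le> 1"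
    and generic: "\<And>\<phi>. rational_linear_form m \<phi> \<Longrightarrow> (\<forall>x\<in>vector_map_ker m a. \<phi> x = 0)
                    \<Longrightarrow> (\<forall>x\<in>coord_space m. \<phi> x = 0)"
  shows "\<And>D f. meromorphic_function (Z_topology m K C) (Z_holomorphic m K C) D f
                    \<Longrightarrow> f constant_on D"
proof -
  fix D f assume mero: "meromorphic_function (Z_topology m K C) (Z_holomorphic m K C) D f"
  interpret exponent_subspace "{i \<in> {1..m}. {i} \<in> K}" "ghost_vertices m K" "\<Psi> ` coord_space l"
    by (rule fan_exponent_subspace[OF dims dim_N complex fan Psi_linear Re_Psi_inj A_Re_Psi ghost generic])
  interpret moment_angle m K "\<Psi> ` coord_space l" C
    by unfold_locales (use complex C_def in \<open>auto simp: exp_group_def\<close>)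
  show "f constant_on D" by (rule meromorphic_constant[OF mero])
qed

end
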